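(* Let $E\to M$ be a Courant algebroid over a smooth manifold and let $t\mapsto J_t$ be a smooth family of generalized complex structures on $E$. Let $L_t\subset E\otimes\mathbb{C}$ be the $+i$-eigenbundle of $J_t$ and define $\dot\omega_t\in\Gamma(\wedge^2L_t^* )$ by $\dot\omega_t(v,w)=\langle v,\dot J_tw\rangle$ for all $v,w\in\Gamma(L_t)$, where $\dot J_t=\frac{d}{dt}J_t$. Then $d_{L_t}\dot\omega_t=0$ for all $t$, where $d_{L_t}$ is the Lie algebroid differential of $L_t$.
   Context: A Courant algebroid is a vector bundle $E\to M$ with a non-degenerate symmetric bilinear form $\langle\cdot,\cdot\rangle$, a skew-symmetric bracket $[\![\cdot,\cdot]\!]$ on $\Gamma(E)$ and a smooth bundle map $\rho:E\to TM$ (the anchor), such that, with $\mathcal{D}:C^\infty(M)\to\Gamma(E)$ defined by $\langle\mathcal{D}f,a\rangle=\frac12\rho(a)f$, one has for all $a,b,c\in\Gamma(E)$, $f,g\in C^\infty(M)$: (i) $\rho([\![a,b]\!])=[\rho(a),\rho(b)]$; (ii) $[\![[\![a,b]\!],c]\!]+[\![[\![b,c]\!],a]\!]+[\![[\![c,a]\!],b]\!]=\frac13\mathcal{D}\big(\langle[\![a,b]\!],c\rangle+\langle[\![b,c]\!],a\rangle+\langle[\![c,a]\!],b\rangle\big)$; (iii) $[\![a,fb]\!]=f[\![a,b]\!]+(\rho(a)f)b-\langle a,b\rangle\mathcal{D}f$; (iv) $\rho\circ\mathcal{D}=0$, i.e. $\langle\mathcal{D}f,\mathcal{D}g\rangle=0$;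 (v) $\rho(a)\langle b,c\rangle=\langle[\![a,b]\!]+\mathcal{D}\langle a,b\rangle,c\rangle+\langle b,[\![a,c]\!]+\mathcal{D}\langle a,c\rangle\rangle$. A generalized complex structure on $E$ is a vector bundle map $J:E\to E$ over $\mathrm{id}_M$ with $J^2=-\mathrm{id}$, orthogonal for $\langle\cdot,\cdot\rangle$, and integrable: $[\![Jx,Jy]\!]-[\![x,y]\!]-J([\![Jx,y]\!]+[\![x,Jy]\!])=0$ for all $x,y\in\Gamma(E)$. The structure of $E$ is extended $\mathbb{C}$-linearly to $E\otimes\mathbb{C}=L\oplus\overline L$, with $L$ (resp. $\overline L$) the $+i$- (resp. $-i$-) eigenbundle. $L$ is isotropic and $\Gamma(L)$ is closed under the bracket, so $L$ is a complex Lie algebroid with anchor $\rho|_L$ and bracket $[\![\cdot,\cdot]\!]$. Its differential on $\alpha\in\Gamma(\wedge^nL^* )$ is $(d_L\alpha)(x_0,\dots,x_n)=\sum_i(-1)^i\rho(x_i)\alpha(x_0,\dots,\widehat{x_i},\dots,x_n)+\sum_{i<j}(-1)^{i+j}\alpha([\![x_i,x_j]\!],x_0,\dots,\widehat{x_i},\dots,\widehat{x_j},\dots,x_n)$ for $x_0,\dots,x_n\in\Gamma(L)$. *)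

theory Defs
  imports "HOL-Analysis.Analysis" "HOL-Library.Function_Algebras"
begin

section \<open>Smooth functions and smooth manifolds\<close>

primrec ck_on :: "nat \<Rightarrow> 'a::real_normed_vector set \<Rightarrow> ('a \<Rightarrow> 'b::real_normed_vector) \<Rightarrow> bool" where
  "ck_on 0 S f \<longleftrightarrow> continuous_on S f"
| "ck_on (Suc k) S f \<longleftrightarrow> (\<forall>x\<in>S. f differentiable (at x)) \<and>
     (\<forall>v. ck_on k S (\<lambda>x. frechet_derivative f (at x) v))"

text \<open>Only used for open \<open>S\<close> in finite-dimensional spaces, where it is the usual notion.\<close>

definition smooth_on :: "'a::real_normed_vector set \<Rightarrow> ('a \<Rightarrow> 'b::real_normed_vector) \<Rightarrow> bool" where
  "smooth_on S f \<longleftrightarrow> (\<forall>k. ck_on k S f)"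

text \<open>The model spaces of manifolds and the typical fibres of vector bundles are Euclidean spaces
  of arbitrary finite dimension.  The class \<open>euclidean_space\<close> is not used for this purpose because
  it excludes dimension 0.\<close>

definition finite_dim :: "'a::real_vector itself \<Rightarrow> bool" where
  "finite_dim _ \<longleftrightarrow> (\<exists>B::'a set. finite B \<and> span B = UNIV)"

text \<open>A chart is a pair of its domain and a map that is only relevant on that domain.
  The manifold is the whole (Hausdorff, second countable) type \<open>'m\<close>.\<close>

type_synonym ('m, 'n) atlas = "('m set \<times> ('m \<Rightarrow> 'n)) set"

definition smooth_manifold ::
  "('m::{t2_space,second_countable_topology}, 'n::real_inner) atlas \<Rightarrow> bool" where
  "smooth_manifold A \<longleftrightarrow>
     finite_dim TYPE('n) \<and>
     (\<Union>(U, \<phi>)\<in>A. U) = UNIV \<and>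
     (\<forall>(U, \<phi>)\<in>A. open U \<and> open (\<phi> ` U) \<and> homeomorphism U (\<phi> ` U) \<phi> (inv_into U \<phi>)) \<and>
     (\<forall>(U, \<phi>)\<in>A. \<forall>(V, \<theta>)\<in>A. smooth_on (\<phi> ` (U \<inter> V)) (\<theta> \<circ> inv_into U \<phi>))"

text \<open>Smoothness on an open subset \<open>W\<close> of the manifold of a function into a normed space.\<close>

definition msmooth_on ::
  "('m, 'n::real_inner) atlas \<Rightarrow> 'm set \<Rightarrow> ('m \<Rightarrow> 'b::real_normed_vector) \<Rightarrow> bool" where
  "msmooth_on A W f \<longleftrightarrow> (\<forall>(U, \<phi>)\<in>A. smooth_on (\<phi> ` (U \<inter> W)) (f \<circ> inv_into U \<phi>))"

definition smooth_near ::
  "('m::topological_space, 'n::real_inner) atlas \<Rightarrow> 'm \<Rightarrow> ('m \<Rightarrow> real) \<Rightarrow> bool" where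
  "smooth_near A p f \<longleftrightarrow> (\<exists>W. open W \<and> p \<in> W \<and> msmooth_on A W f)"


section \<open>Vector bundles\<close>

text \<open>A family of vector spaces is rendered as a family of linear subspaces \<open>fibre F p\<close> of one
  ambient vector space \<open>'v\<close>; no topology on \<open>'v\<close> is involved, the smooth structure of the bundle
  is given by the local trivialisations \<open>(U, \<psi>)\<close>, where \<open>\<psi> p\<close> maps the fibre over \<open>p \<in> U\<close>
  isomorphically onto the typical fibre \<open>'k\<close>.\<close>

record ('m, 'v, 'k) vbundle =
  fibre :: "'m \<Rightarrow> 'v set"
  trivs :: "('m set \<times> ('m \<Rightarrow> 'v \<Rightarrow> 'k)) set"

definition linear_between ::
  "'v::real_vector set \<Rightarrow> 'w::real_vector set \<Rightarrow> ('v \<Rightarrow> 'w) \<Rightarrow> bool" where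
  "linear_between S T h \<longleftrightarrow> h ` S \<subseteq> T \<and>
     (\<forall>v\<in>S. \<forall>w\<in>S. \<forall>c d. h (c *\<^sub>R v + d *\<^sub>R w) = c *\<^sub>R h v + d *\<^sub>R h w)"

abbreviation triv_inv ::
  "('m, 'v, 'k, 'z) vbundle_scheme \<Rightarrow> ('m \<Rightarrow> 'v \<Rightarrow> 'k) \<Rightarrow> 'm \<Rightarrow> 'k \<Rightarrow> 'v" where
  "triv_inv F \<psi> p \<equiv> inv_into (fibre F p) (\<psi> p)"

definition vector_bundle ::
  "('m::{t2_space,second_countable_topology}, 'n::real_inner) atlas \<Rightarrow>
   ('m, 'v::real_vector, 'k::real_inner, 'z) vbundle_scheme \<Rightarrow> bool" where
  "vector_bundle A F \<longleftrightarrow>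
     finite_dim TYPE('k) \<and>
     (\<forall>p. subspace (fibre F p)) \<and>
     (\<Union>(U, \<psi>)\<in>trivs F. U) = UNIV \<and>
     (\<forall>(U, \<psi>)\<in>trivs F. open U \<and>
        (\<forall>p\<in>U. linear_between (fibre F p) UNIV (\<psi> p) \<and> bij_betw (\<psi> p) (fibre F p) UNIV)) \<and>
     (\<forall>(U, \<psi>)\<in>trivs F. \<forall>(V, \<theta>)\<in>trivs F. \<forall>x.
        msmooth_on A (U \<inter> V) (\<lambda>p. \<theta> p (triv_inv F \<psi> p x)))"

definition sections ::
  "('m, 'n::real_inner) atlas \<Rightarrow> ('m, 'v, 'k::real_inner, 'z) vbundle_scheme \<Rightarrow> ('m \<Rightarrow> 'v) set" where
  "sections A F =
     {s. (\<forall>p. s p \<in> fibre F p) \<and> (\<forall>(U, \<psi>)\<in>trivs F. msmooth_on A U (\<lambda>p. \<psi> p (s p)))}"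

text \<open>Smooth vector bundle maps over the identity: fibrewise linear maps whose matrices with
  respect to the local trivialisations depend smoothly on the base point.\<close>

definition bundle_map ::
  "('m, 'n::real_inner) atlas \<Rightarrow>
   ('m, 'v::real_vector, 'k::real_inner, 'y) vbundle_scheme \<Rightarrow>
   ('m, 'w::real_vector, 'l::real_inner, 'z) vbundle_scheme \<Rightarrow> ('m \<Rightarrow> 'v \<Rightarrow> 'w) \<Rightarrow> bool" where
  "bundle_map A F G H \<longleftrightarrow>
     (\<forall>p. linear_between (fibre F p) (fibre G p) (H p)) \<and>
     (\<forall>(U, \<psi>)\<in>trivs F. \<forall>(V, \<theta>)\<in>trivs G. \<forall>x.
        msmooth_on A (U \<inter> V) (\<lambda>p. \<theta> p (H p (triv_inv F \<psi> p x))))"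


section \<open>The tangent bundle\<close>

instantiation "fun" :: (type, real_vector) real_vector
begin

definition scaleR_fun :: "real \<Rightarrow> ('a \<Rightarrow> 'b) \<Rightarrow> 'a \<Rightarrow> 'b" where
  "scaleR_fun c f = (\<lambda>x. c *\<^sub>R f x)"

instance
  by standard (simp_all add: scaleR_fun_def plus_fun_def scaleR_add_left scaleR_add_right)

end

text \<open>Tangent vectors at \<open>p\<close> are the derivations at \<open>p\<close> of germs of smooth functions.  They are
  represented by functionals on all functions \<open>'m \<Rightarrow> real\<close>, with the dummy value 0 at functions that
  are not smooth near \<open>p\<close>.\<close>

definition tangent_space ::
  "('m::topological_space, 'n::real_inner) atlas \<Rightarrow> 'm \<Rightarrow> (('m \<Rightarrow> real) \<Rightarrow> real) set" where
  "tangent_space A p = {X.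
     (\<forall>f g. smooth_near A p f \<longrightarrow> smooth_near A p g \<longrightarrow>
        (\<forall>c d. X (\<lambda>q. c * f q + d * g q) = c * X f + d * X g) \<and>
        X (\<lambda>q. f q * g q) = f p * X g + g p * X f \<and>
        ((\<forall>\<^sub>F q in nhds p. f q = g q) \<longrightarrow> X f = X g)) \<and>
     (\<forall>f. \<not> smooth_near A p f \<longrightarrow> X f = 0)}"

text \<open>The local trivialisation induced by a chart \<open>(U, \<phi>)\<close> is the differential of \<open>\<phi>\<close>: the
  component of the image of \<open>X\<close> in the direction \<open>y\<close> is \<open>X\<close> applied to the \<open>y\<close>-component of \<open>\<phi>\<close>.\<close>

definition chart_differential :: "('m \<Rightarrow> 'n::real_inner) \<Rightarrow> (('m \<Rightarrow> real) \<Rightarrow> real) \<Rightarrow> 'n" where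
  "chart_differential \<phi> X = (THE w. \<forall>y. w \<bullet> y = X (\<lambda>q. \<phi> q \<bullet> y))"

definition tangent_bundle ::
  "('m::topological_space, 'n::real_inner) atlas \<Rightarrow> ('m, ('m \<Rightarrow> real) \<Rightarrow> real, 'n) vbundle" where
  "tangent_bundle A =
     \<lparr>fibre = tangent_space A, trivs = {(U, \<lambda>_. chart_differential \<phi>) | U \<phi>. (U, \<phi>) \<in> A}\<rparr>"

definition lie_bracket ::
  "('m::topological_space, 'n::real_inner) atlas \<Rightarrow> ('m \<Rightarrow> ('m \<Rightarrow> real) \<Rightarrow> real) \<Rightarrow>
   ('m \<Rightarrow> ('m \<Rightarrow> real) \<Rightarrow> real) \<Rightarrow> 'm \<Rightarrow> ('m \<Rightarrow> real) \<Rightarrow> real" where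
  "lie_bracket A X Y p f =
     (if smooth_near A p f then X p (\<lambda>q. Y q f) - Y p (\<lambda>q. X q f) else 0)"


section \<open>Courant algebroids\<close>

record ('m, 'v, 'k) courant = "('m, 'v, 'k) vbundle" +
  pairing :: "'m \<Rightarrow> 'v \<Rightarrow> 'v \<Rightarrow> real"
  bracket :: "('m \<Rightarrow> 'v) \<Rightarrow> ('m \<Rightarrow> 'v) \<Rightarrow> 'm \<Rightarrow> 'v"
  anchor :: "'m \<Rightarrow> 'v \<Rightarrow> ('m \<Rightarrow> real) \<Rightarrow> real"

definition courant_D :: "('m, 'v, 'k, 'z) courant_scheme \<Rightarrow> ('m \<Rightarrow> real) \<Rightarrow> 'm \<Rightarrow> 'v" where
  "courant_D E f p =
     (THE d. d \<in> fibre E p \<and> (\<forall>a\<in>fibre E p. pairing E p d a = 1 / 2 * anchor E p a f))"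

abbreviation spairing ::
  "('m, 'v, 'k, 'z) courant_scheme \<Rightarrow> ('m \<Rightarrow> 'v) \<Rightarrow> ('m \<Rightarrow> 'v) \<Rightarrow> 'm \<Rightarrow> real" where
  "spairing E a b \<equiv> (\<lambda>q. pairing E q (a q) (b q))"

definition bundle_metric ::
  "('m, 'n::real_inner) atlas \<Rightarrow> ('m, 'v::real_vector, 'k::real_inner, 'z) vbundle_scheme \<Rightarrow>
   ('m \<Rightarrow> 'v \<Rightarrow> 'v \<Rightarrow> real) \<Rightarrow> bool" where
  "bundle_metric A F g \<longleftrightarrow>
     (\<forall>p. \<forall>v\<in>fibre F p. linear_between (fibre F p) UNIV (g p v)) \<and>
     (\<forall>p. \<forall>v\<in>fibre F p. \<forall>w\<in>fibre F p. g p v w = g p w v) \<and>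
     (\<forall>p. \<forall>v\<in>fibre F p. (\<forall>w\<in>fibre F p. g p v w = 0) \<longrightarrow> v = 0) \<and>
     (\<forall>(U, \<psi>)\<in>trivs F. \<forall>x y. msmooth_on A U (\<lambda>p. g p (triv_inv F \<psi> p x) (triv_inv F \<psi> p y)))"

text \<open>Brackets are taken on smooth sections only; the value of \<open>bracket E\<close> elsewhere is irrelevant.
  The first three conditions on the bracket spell out ``skew-symmetric bracket on the real vector
  space of sections''.\<close>

definition courant_algebroid ::
  "('m::{t2_space,second_countable_topology}, 'n::real_inner) atlas \<Rightarrow>
   ('m, 'v::real_vector, 'k::real_inner, 'z) courant_scheme \<Rightarrow> bool" where
  "courant_algebroid A E \<longleftrightarrow>
     vector_bundle A E \<and>
     bundle_metric A E (pairing E) \<and>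
     bundle_map A E (tangent_bundle A) (anchor E) \<and>
     (let \<Gamma> = sections A E; br = bracket E; \<rho> = anchor E; D = courant_D E in
      (\<forall>a\<in>\<Gamma>. \<forall>b\<in>\<Gamma>. br a b \<in> \<Gamma>) \<and>
      (\<forall>a\<in>\<Gamma>. \<forall>b\<in>\<Gamma>. \<forall>p. br a b p = - br b a p) \<and>
      (\<forall>a\<in>\<Gamma>. \<forall>b\<in>\<Gamma>. \<forall>c\<in>\<Gamma>. \<forall>r s p.
         br a (\<lambda>q. r *\<^sub>R b q + s *\<^sub>R c q) p = r *\<^sub>R br a b p + s *\<^sub>R br a c p) \<and>
      (\<forall>a\<in>\<Gamma>. \<forall>b\<in>\<Gamma>. \<forall>p.
         \<rho> p (br a b p) = lie_bracket A (\<lambda>q. \<rho> q (a q)) (\<lambda>q. \<rho> q (b q)) p) \<and>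
      (\<forall>a\<in>\<Gamma>. \<forall>b\<in>\<Gamma>. \<forall>c\<in>\<Gamma>. \<forall>p.
         br (br a b) c p + br (br b c) a p + br (br c a) b p =
         (1 / 3) *\<^sub>R D (\<lambda>q. spairing E (br a b) c q + spairing E (br b c) a q
                        + spairing E (br c a) b q) p) \<and>
      (\<forall>a\<in>\<Gamma>. \<forall>b\<in>\<Gamma>. \<forall>f. msmooth_on A UNIV f \<longrightarrow> (\<forall>p.
         br a (\<lambda>q. f q *\<^sub>R b q) p =
         f p *\<^sub>R br a b p + \<rho> p (a p) f *\<^sub>R b p - pairing E p (a p) (b p) *\<^sub>R D f p)) \<and>
      (\<forall>f. msmooth_on A UNIV f \<longrightarrow> (\<forall>p. \<rho> p (D f p) = 0)) \<and>
      (\<forall>a\<in>\<Gamma>. \<forall>b\<in>\<Gamma>. \<forall>c\<in>\<Gamma>. \<forall>p.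
         \<rho> p (a p) (spairing E b c) =
         pairing E p (br a b p + D (spairing E a b) p) (c p)
         + pairing E p (b p) (br a c p + D (spairing E a c) p)))"


section \<open>Generalized complex structures\<close>

definition gen_complex_structure ::
  "('m::{t2_space,second_countable_topology}, 'n::real_inner) atlas \<Rightarrow>
   ('m, 'v::real_vector, 'k::real_inner, 'z) courant_scheme \<Rightarrow> ('m \<Rightarrow> 'v \<Rightarrow> 'v) \<Rightarrow> bool" where
  "gen_complex_structure A E J \<longleftrightarrow>
     bundle_map A E E J \<and>
     (\<forall>p. \<forall>v\<in>fibre E p. J p (J p v) = - v) \<and>
     (\<forall>p. \<forall>v\<in>fibre E p. \<forall>w\<in>fibre E p. pairing E p (J p v) (J p w) = pairing E p v w) \<and>
     (\<forall>x\<in>sections A E. \<forall>y\<in>sections A E.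
        let Jx = (\<lambda>q. J q (x q)); Jy = (\<lambda>q. J q (y q)) in
        \<forall>p. bracket E Jx Jy p - bracket E x y p - J p (bracket E Jx y p + bracket E x Jy p) = 0)"

text \<open>Smoothness of a family of bundle endomorphisms jointly in the parameter \<open>t\<close>, which ranges
  over an open interval \<open>I\<close>, and in the base point (in terms of matrices in local trivialisations).\<close>

definition smooth_endo_family ::
  "('m, 'n::real_inner) atlas \<Rightarrow> ('m, 'v::real_vector, 'k::real_inner, 'z) vbundle_scheme \<Rightarrow>
   real set \<Rightarrow> (real \<Rightarrow> 'm \<Rightarrow> 'v \<Rightarrow> 'v) \<Rightarrow> bool" where
  "smooth_endo_family A F I J \<longleftrightarrow>
     (\<forall>t\<in>I. bundle_map A F F (J t)) \<and>
     (\<forall>(W, \<phi>)\<in>A. \<forall>(U, \<psi>)\<in>trivs F. \<forall>(V, \<theta>)\<in>trivs F. \<forall>x.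
        smooth_on (I \<times> \<phi> ` (W \<inter> U \<inter> V))
          (\<lambda>(t, u). let p = inv_into W \<phi> u in \<theta> p (J t p (triv_inv F \<psi> p x))))"

text \<open>The derivative at \<open>t\<close> of a curve \<open>c\<close> in the finite-dimensional vector space \<open>fibre F p\<close>.\<close>

definition fibre_deriv ::
  "('m, 'v, 'k::real_inner, 'z) vbundle_scheme \<Rightarrow> 'm \<Rightarrow> (real \<Rightarrow> 'v) \<Rightarrow> real \<Rightarrow> 'v" where
  "fibre_deriv F p c t = (THE w. w \<in> fibre F p \<and>
     (\<forall>(U, \<psi>)\<in>trivs F. p \<in> U \<longrightarrow> ((\<lambda>s. \<psi> p (c s)) has_vector_derivative \<psi> p w) (at t)))"

definition J_dot ::
  "('m, 'v, 'k::real_inner, 'z) vbundle_scheme \<Rightarrow> (real \<Rightarrow> 'm \<Rightarrow> 'v \<Rightarrow> 'v) \<Rightarrow> real \<Rightarrow> 'm \<Rightarrow> 'v \<Rightarrow> 'v" where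
  "J_dot F J t p v = fibre_deriv F p (\<lambda>s. J s p v) t"


section \<open>Complexification\<close>

text \<open>The element \<open>a + \<i> b\<close> of the complexification of \<open>fibre E p\<close> is represented by the pair
  \<open>(a, b)\<close>.  The structure maps of the Courant algebroid are extended complex (bi)linearly.\<close>

definition cscale :: "complex \<Rightarrow> 'v::real_vector \<times> 'v \<Rightarrow> 'v \<times> 'v" where
  "cscale c z = (Re c *\<^sub>R fst z - Im c *\<^sub>R snd z, Re c *\<^sub>R snd z + Im c *\<^sub>R fst z)"

definition cpairing ::
  "('m, 'v, 'k, 'z) courant_scheme \<Rightarrow> 'm \<Rightarrow> 'v \<times> 'v \<Rightarrow> 'v \<times> 'v \<Rightarrow> complex" where
  "cpairing E p z w =
     Complex (pairing E p (fst z) (fst w) - pairing E p (snd z) (snd w))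
             (pairing E p (fst z) (snd w) + pairing E p (snd z) (fst w))"

definition canchor ::
  "('m, 'v, 'k, 'z) courant_scheme \<Rightarrow> 'm \<Rightarrow> 'v \<times> 'v \<Rightarrow> ('m \<Rightarrow> complex) \<Rightarrow> complex" where
  "canchor E p z f =
     Complex (anchor E p (fst z) (\<lambda>q. Re (f q)) - anchor E p (snd z) (\<lambda>q. Im (f q)))
             (anchor E p (fst z) (\<lambda>q. Im (f q)) + anchor E p (snd z) (\<lambda>q. Re (f q)))"

definition cbracket ::
  "('m, 'v::real_vector, 'k, 'z) courant_scheme \<Rightarrow>
   ('m \<Rightarrow> 'v \<times> 'v) \<Rightarrow> ('m \<Rightarrow> 'v \<times> 'v) \<Rightarrow> 'm \<Rightarrow> 'v \<times> 'v" where
  "cbracket E x y p =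
     (bracket E (fst \<circ> x) (fst \<circ> y) p - bracket E (snd \<circ> x) (snd \<circ> y) p,
      bracket E (fst \<circ> x) (snd \<circ> y) p + bracket E (snd \<circ> x) (fst \<circ> y) p)"

definition eigenbundle ::
  "('m, 'v::real_vector, 'k, 'z) vbundle_scheme \<Rightarrow> ('m \<Rightarrow> 'v \<Rightarrow> 'v) \<Rightarrow> 'm \<Rightarrow> ('v \<times> 'v) set" where
  "eigenbundle F J p = {z \<in> fibre F p \<times> fibre F p. map_prod (J p) (J p) z = cscale \<i> z}"

definition csections ::
  "('m, 'n::real_inner) atlas \<Rightarrow> ('m, 'v, 'k::real_inner, 'z) vbundle_scheme \<Rightarrow>
   ('m \<Rightarrow> ('v \<times> 'v) set) \<Rightarrow> ('m \<Rightarrow> 'v \<times> 'v) set" where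
  "csections A F L =
     {x. fst \<circ> x \<in> sections A F \<and> snd \<circ> x \<in> sections A F \<and> (\<forall>p. x p \<in> L p)}"


section \<open>Forms on \<open>L\<close> and the Lie algebroid differential\<close>

text \<open>An \<open>n\<close>-form on \<open>L\<close> assigns to every point a function of lists of length \<open>n\<close> of vectors;
  \<open>form_section A F L n \<alpha>\<close> says that \<open>\<alpha>\<close> is a smooth section of the \<open>n\<close>-th exterior power of the
  complex dual of \<open>L\<close>.\<close>

definition form_section ::
  "('m, 'n::real_inner) atlas \<Rightarrow> ('m, 'v::real_vector, 'k::real_inner, 'z) vbundle_scheme \<Rightarrow>
   ('m \<Rightarrow> ('v \<times> 'v) set) \<Rightarrow> nat \<Rightarrow> ('m \<Rightarrow> ('v \<times> 'v) list \<Rightarrow> complex) \<Rightarrow> bool" where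
  "form_section A F L n \<alpha> \<longleftrightarrow>
     (\<forall>p vs i z w c d. length vs = n \<and> set vs \<subseteq> L p \<and> i < n \<and> z \<in> L p \<and> w \<in> L p \<longrightarrow>
        \<alpha> p (vs[i := cscale c z + cscale d w]) = c * \<alpha> p (vs[i := z]) + d * \<alpha> p (vs[i := w])) \<and>
     (\<forall>p vs i j. length vs = n \<and> set vs \<subseteq> L p \<and> i < j \<and> j < n \<and> vs ! i = vs ! j \<longrightarrow>
        \<alpha> p vs = 0) \<and>
     (\<forall>xs. length xs = n \<and> set xs \<subseteq> csections A F L \<longrightarrow>
        msmooth_on A UNIV (\<lambda>p. \<alpha> p (map (\<lambda>x. x p) xs)))"

definition omit :: "nat \<Rightarrow> 'a list \<Rightarrow> 'a list" where
  "omit i xs = take i xs @ drop (Suc i) xs"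

text \<open>The value of \<open>d\<^sub>L \<alpha>\<close> on a list of \<open>n + 1\<close> sections of \<open>L\<close>, for an \<open>n\<close>-form \<open>\<alpha>\<close>.  As
  \<open>i < j\<close>, \<open>omit i (omit j xs)\<close> removes the entries with indices \<open>i\<close> and \<open>j\<close>.\<close>

definition lie_algebroid_d ::
  "('m, 'v::real_vector, 'k, 'z) courant_scheme \<Rightarrow> ('m \<Rightarrow> ('v \<times> 'v) list \<Rightarrow> complex) \<Rightarrow>
   ('m \<Rightarrow> 'v \<times> 'v) list \<Rightarrow> 'm \<Rightarrow> complex" where
  "lie_algebroid_d E \<alpha> xs p =
     (\<Sum>i<length xs. (-1) ^ i * canchor E p ((xs ! i) p) (\<lambda>q. \<alpha> q (map (\<lambda>x. x q) (omit i xs))))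
     + (\<Sum>j<length xs. \<Sum>i<j. (-1) ^ (i + j) *
          \<alpha> p (map (\<lambda>x. x p) (cbracket E (xs ! i) (xs ! j) # omit i (omit j xs))))"

definition omega_dot ::
  "('m, 'v::real_vector, 'k::real_inner, 'z) courant_scheme \<Rightarrow> (real \<Rightarrow> 'm \<Rightarrow> 'v \<Rightarrow> 'v) \<Rightarrow> real \<Rightarrow>
   'm \<Rightarrow> ('v \<times> 'v) list \<Rightarrow> complex" where
  "omega_dot E J t p vs =
     cpairing E p (vs ! 0) (map_prod (J_dot E J t p) (J_dot E J t p) (vs ! 1))"

end

theory Submission
  imports Defs "HOL-Computational_Algebra.Polynomial"
begin

text \<open>Differentiate the integrability condition of \<open>J\<^sub>s\<close> at \<open>s = t\<close> and pair it with a third section.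
  On sections \<open>x, y, z\<close> of \<open>L\<close>, where \<open>J\<^sub>t\<close> is multiplication by \<open>\<i>\<close>, this gives
  \<open>\<langle>[J' x, y] + [x, J' y] - J' [x, y], z\<rangle> = 0\<close>.  The invariance axiom (v) rewrites the left-hand
  side as \<open>-(d\<^sub>L \<omega>)(x, y, z)\<close> plus terms \<open>\<rho>(J' x)\<langle>y, z\<rangle>/2\<close>, which vanish because \<open>L\<close> is isotropic.

  The analytic point is that \<open>d/ds\<close> commutes with the bracket.  After multiplication by
  a bump function, \<open>J\<^sub>s x\<close> is a finite sum \<open>\<Sum>f\<^sub>b(s) e\<^sub>b\<close> with fixed global sections \<open>e\<^sub>b\<close>; by the
  Leibniz rule the bracket then involves \<open>s\<close> only through \<open>f\<^sub>b(s)\<close> and \<open>X f\<^sub>b(s)\<close> for tangent vectors \<open>X\<close>.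
  Tangent vectors are derivations, so Hadamard's lemma is needed to write \<open>X\<close> as a directional
  derivative, and then mixed partial derivatives commute.\<close>

section \<open>Finite-dimensional inner product spaces\<close>

text \<open>The bracket is known only through its axioms, on global sections, so no limit may be
  taken inside it: this forces the bump functions and the expansion along fixed sections. Pairing
  with a vector z of one fibre turns all of it into real functions of s. Skewness of
  \<open>J s\<close> moves the outer \<open>J s\<close> of the integrability condition onto z, and
  the section \<open>courant_D E f\<close> of the Leibniz rule becomes half the derivative of f
  along the anchor of z. On sections of L each of the six terms of the differentiated condition
  carries one factor i; they combine in pairs, to 2i times the stated identity, with the J' of J'
  [x, y] moved onto z. The computation itself is real: x = x1 + i x2 satisfies J x1 = - x2 and J x2
  = x1, and the complex identity is assembled from eight real ones. Smoothness is joint in time and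
  base point, hence calculus on the product of the reals with the model space. That space may have
  dimension 0, so orthonormal bases are replaced by Parseval frames.\<close>

definition parseval_frame :: "'a::real_inner set \<Rightarrow> bool" where
  "parseval_frame B \<longleftrightarrow> finite B \<and> (\<forall>x. (\<Sum>b\<in>B. (x \<bullet> b) *\<^sub>R b) = x)"

text \<open>Orthogonalising a finite spanning set, dropping 0 and normalising leaves an orthonormal
  basis, which is empty in dimension 0. Of its properties only finiteness and the expansion identity
  are retained.\<close>

lemma finite_dim_parseval_frame:
  assumes "finite_dim TYPE('a::real_inner)"
  obtains B :: "'a::real_inner set" where "parseval_frame B"
proof -
  obtain C0 :: "'a set" where C0: "finite C0" "span C0 = UNIV"
    using assms unfolding finite_dim_def by blast
  obtain C :: "'a set" where C: "finite C" "span C = UNIV" "pairwise orthogonal C"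
    using basis_orthogonal[OF C0(1)] unfolding C0(2) by blast
  define B where "B = (\<lambda>b. (1 / norm b) *\<^sub>R b) ` (C - {0})"
  have fB: "finite B" using C(1) by (simp add: B_def)
  have "c \<in> span B" if "c \<in> C" for c
  proof (cases "c = 0")
    case False
    then have "(1 / norm c) *\<^sub>R c \<in> B" using that by (auto simp: B_def)
    then have "norm c *\<^sub>R ((1 / norm c) *\<^sub>R c) \<in> span B" by (intro span_scale span_base)
    then show ?thesis using False by simp
  qed (simp add: span_zero)
  then have "span C \<subseteq> span B" by (simp add: span_minimal subsetI)
  then have sB: "span B = UNIV" using C(2) by auto
  have one: "b \<bullet> b = 1" if "b \<in> B" for b
    using that by (auto simp: B_def power2_norm_eq_inner[symmetric] power2_eq_square split: if_splits)
  have orth: "b \<bullet> c = 0" if bc: "b \<in> B" "c \<in> B" "b \<noteq> c" for b c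
  proof -
    obtain b' c' where b': "b' \<in> C" "b = (1 / norm b') *\<^sub>R b'" and c': "c' \<in> C" "c = (1 / norm c') *\<^sub>R c'"
      using bc unfolding B_def by blast
    then have "b' \<noteq> c'" using bc(3) by blast
    then have "b' \<bullet> c' = 0" using C(3) b'(1) c'(1) by (auto simp: pairwise_def orthogonal_def)
    then show ?thesis unfolding b'(2) c'(2) by simp
  qed
  have "(\<Sum>b\<in>B. (x \<bullet> b) *\<^sub>R b) = x" for x
  proof -
    \<comment> \<open>The defect \<open>y\<close> of the expansion is orthogonal to
      \<open>B\<close>, hence to \<open>span B\<close>, which is everything; so it is orthogonal to
      itself.\<close>
    define y where "y = x - (\<Sum>b\<in>B. (x \<bullet> b) *\<^sub>R b)"
    have "orthogonal y c" if c: "c \<in> B" for c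
    proof -
      have "(\<Sum>b\<in>B. (x \<bullet> b) * (b \<bullet> c)) = (\<Sum>b\<in>B. if b = c then x \<bullet> c else 0)"
        by (rule sum.cong) (auto simp: one orth c)
      then show ?thesis
        using fB c by (simp add: y_def orthogonal_def inner_diff_left inner_sum_left)
    qed
    then have "orthogonal y y" using orthogonal_to_span[of y B y] sB by auto
    then show ?thesis by (simp add: y_def orthogonal_self)
  qed
  then show ?thesis using fB that unfolding parseval_frame_def by blast
qed

lemma frame_finite: "parseval_frame B \<Longrightarrow> finite B"
  by (simp add: parseval_frame_def)

lemma frame_expand: "parseval_frame B \<Longrightarrow> (\<Sum>b\<in>B. (x \<bullet> b) *\<^sub>R b) = x"
  by (simp add: parseval_frame_def)

lemma frame_linear:
  assumes "parseval_frame B" "linear f"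
  shows "f x = (\<Sum>b\<in>B. (x \<bullet> b) *\<^sub>R f b)"
proof -
  have "f (\<Sum>b\<in>B. (x \<bullet> b) *\<^sub>R b) = (\<Sum>b\<in>B. (x \<bullet> b) *\<^sub>R f b)"
    using assms(2) by (simp add: linear_sum linear_scale)
  then show ?thesis by (simp add: frame_expand[OF assms(1)])
qed

text \<open>The explicit weights matter: the same weighted sum, taken for a difference of two
  derivatives, is the error term in \<open>ray_integral_has_derivative\<close>.\<close>

lemma frame_linear_norm_le:
  fixes f :: "'a::real_inner \<Rightarrow> 'b::real_normed_vector" and B :: "'a set"
  assumes "parseval_frame B" "linear f"
  shows "norm (f x) \<le> norm x * (\<Sum>b\<in>B. norm b * norm (f b))"
proof -
  have "norm (f x) \<le> (\<Sum>b\<in>B. norm ((x \<bullet> b) *\<^sub>R f b))"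
    unfolding frame_linear[OF assms, of x] by (rule norm_sum)
  also have "\<dots> \<le> (\<Sum>b\<in>B. norm x * (norm b * norm (f b)))"
    by (intro sum_mono) (auto simp: mult.assoc[symmetric] Cauchy_Schwarz_ineq2 intro!: mult_right_mono)
  finally show ?thesis by (simp add: sum_distrib_left)
qed

lemma frame_bounded_linear:
  fixes f :: "'a::real_inner \<Rightarrow> 'b::real_normed_vector" and B :: "'a set"
  assumes "parseval_frame B" "linear f"
  shows "bounded_linear f"
proof (rule bounded_linear_intro)
  show "norm (f x) \<le> norm x * (\<Sum>b\<in>B. norm b * norm (f b))" for x
    by (rule frame_linear_norm_le[OF assms])
qed (use assms(2) in \<open>simp_all add: linear_add linear_scale\<close>)

text \<open>The ball is a closed subset of the vectors whose frame coefficients are bounded, and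
  these form a finite Minkowski sum of segments. Compactness of balls is what makes the supports of
  bump functions closed.\<close>

lemma frame_compact_cball:
  fixes a :: "'a::real_inner" and B :: "'a set"
  assumes B: "parseval_frame B"
  shows "compact (cball a r)"
proof -
  \<comment> \<open>The bound is Cauchy-Schwarz: a point z of the ball has norm at most
    \<open>norm a + \<bar>r\<bar>\<close>, so its coefficient along \<open>b\<close> is at most that
    number times \<open>norm b\<close>.\<close>
  define K where "K C = {(\<Sum>b\<in>C. c b *\<^sub>R b) | c. \<forall>b\<in>C. \<bar>c b\<bar> \<le> (norm a + \<bar>r\<bar>) * norm b}" for C :: "'a set"
  have "compact (K C)" if "finite C" for C
    using that
  proof (induction C rule: finite_induct)
    case empty
    then show ?case by (simp add: K_def)
  next
    case (insert x C)
    define S where "S = (\<lambda>c. c *\<^sub>R x) ` {- ((norm a + \<bar>r\<bar>) * norm x)..(norm a + \<bar>r\<bar>) * norm x}"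
    have "compact S" unfolding S_def
      by (intro compact_continuous_image continuous_intros) auto
    moreover have "K (insert x C) = {u + v |u v. u \<in> S \<and> v \<in> K C}"
    proof (intro set_eqI iffI)
      fix z assume "z \<in> K (insert x C)"
      then obtain c where c: "z = (\<Sum>b\<in>insert x C. c b *\<^sub>R b)"
        "\<forall>b\<in>insert x C. \<bar>c b\<bar> \<le> (norm a + \<bar>r\<bar>) * norm b" by (auto simp: K_def)
      have "c x *\<^sub>R x \<in> S" unfolding S_def using c(2) by (intro imageI) (auto simp: abs_le_iff)
      moreover have "(\<Sum>b\<in>C. c b *\<^sub>R b) \<in> K C" unfolding K_def using c(2) by auto
      ultimately show "z \<in> {u + v |u v. u \<in> S \<and> v \<in> K C}" using insert c(1) by auto
    next
      fix z assume "z \<in> {u + v |u v. u \<in> S \<and> v \<in> K C}"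
      then obtain k c where kc: "z = k *\<^sub>R x + (\<Sum>b\<in>C. c b *\<^sub>R b)" "\<bar>k\<bar> \<le> (norm a + \<bar>r\<bar>) * norm x"
        "\<forall>b\<in>C. \<bar>c b\<bar> \<le> (norm a + \<bar>r\<bar>) * norm b" by (auto simp: K_def S_def abs_le_iff)
      have "(\<Sum>b\<in>C. c b *\<^sub>R b) = (\<Sum>b\<in>C. (c(x:=k)) b *\<^sub>R b)"
        using insert by (intro sum.cong) auto
      then have "z = (\<Sum>b\<in>insert x C. (c(x:=k)) b *\<^sub>R b)" using insert kc by simp
      moreover have "\<forall>b\<in>insert x C. \<bar>(c(x:=k)) b\<bar> \<le> (norm a + \<bar>r\<bar>) * norm b" using kc by auto
      ultimately show "z \<in> K (insert x C)" unfolding K_def by blast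
    qed
    ultimately show ?case using compact_sums[of S "K C"] insert by simp
  qed
  then have "compact (K B)" using B by (simp add: frame_finite)
  moreover have "cball a r \<subseteq> K B"
  proof
    fix z assume "z \<in> cball a r"
    then have "norm z \<le> norm a + \<bar>r\<bar>"
      using norm_triangle_ineq2[of z a] by (simp add: dist_norm norm_minus_commute)
    then have "\<bar>z \<bullet> b\<bar> \<le> (norm a + \<bar>r\<bar>) * norm b" for b
      using Cauchy_Schwarz_ineq2[of z b] mult_right_mono[of "norm z" "norm a + \<bar>r\<bar>" "norm b"] by simp
    then show "z \<in> K B" unfolding K_def by (intro CollectI exI[of _ "\<lambda>b. z \<bullet> b"]) (simp add: frame_expand[OF B])
  qed
  ultimately show ?thesis using compact_Int_closed[of "K B" "cball a r"] by (simp add: Int_absorb1)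
qed

text \<open>The image of a basis under an injective map is independent with the same cardinality; a
  vector outside its span would produce an independent set larger than a spanning one. The lemma
  serves to invert the Gram operator of the pairing.\<close>

lemma finite_dim_linear_inj_surj:
  fixes f :: "'a::real_vector \<Rightarrow> 'a"
  assumes fd: "finite_dim TYPE('a)" and f: "linear f" "inj f"
  shows "surj f"
proof -
  obtain C :: "'a set" where C: "finite C" "span C = UNIV"
    using fd unfolding finite_dim_def by blast
  obtain B where B: "B \<subseteq> C" "independent B" "span B = UNIV"
  proof -
    obtain B where B: "B \<subseteq> C" "independent B" "C \<subseteq> span B"
      using maximal_independent_subset by blast
    then have "span C \<subseteq> span B" by (simp add: span_minimal)
    then show ?thesis using that B C(2) by auto
  qed
  have fB: "finite B" using B(1) C(1) finite_subset by blast
  have ind: "independent (f ` B)"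
    using linear_independent_injective_image[OF f(1) B(2)] inj_on_subset[OF f(2)] by blast
  have "y \<in> span (f ` B)" for y
  proof (rule ccontr)
    assume y: "y \<notin> span (f ` B)"
    then have ins: "independent (insert y (f ` B))" using ind by (simp add: independent_insert)
    have "card (insert y (f ` B)) \<le> card B"
    proof -
      have "insert y (f ` B) \<subseteq> span B" unfolding B(3) by (rule subset_UNIV)
      from real_vector.independent_span_bound[OF fB ins this] show ?thesis by (rule conjunct2)
    qed
    moreover have "y \<notin> f ` B" using y span_superset[of "f ` B"] by blast
    moreover have "card (f ` B) = card B"
      by (rule card_image) (rule inj_on_subset[OF f(2) subset_UNIV])
    ultimately show False using fB by simp
  qed
  then have "span (f ` B) = UNIV" by blast
  moreover have "span (f ` B) = f ` span B"
    by (rule linear_span_image[OF f(1)])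
  ultimately show ?thesis unfolding B(3) by simp
qed

lemma finite_dim_frame_iff: "finite_dim TYPE('a::real_inner) \<longleftrightarrow> (\<exists>B::'a set. parseval_frame B)"
proof
  assume "finite_dim TYPE('a)"
  then show "\<exists>B::'a set. parseval_frame B" by (metis finite_dim_parseval_frame)
next
  assume "\<exists>B::'a set. parseval_frame B"
  then obtain B :: "'a set" where B: "parseval_frame B" ..
  have "x \<in> span B" for x
    by (subst frame_expand[OF B, symmetric]) (intro span_sum span_scale span_base)
  then show "finite_dim TYPE('a)" unfolding finite_dim_def using frame_finite[OF B] by blast
qed

lemma finite_dim_real: "finite_dim TYPE(real)"
  unfolding finite_dim_frame_iff by (intro exI[of _ "{1}"]) (simp add: parseval_frame_def)

lemma finite_dim_prod:
  assumes "finite_dim TYPE('a::real_inner)" "finite_dim TYPE('b::real_inner)"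
  shows "finite_dim TYPE('a \<times> 'b)"
proof -
  obtain B :: "'a set" and C :: "'b set" where BC: "parseval_frame B" "parseval_frame C"
    using assms finite_dim_frame_iff by metis
  \<comment> \<open>A frame may contain 0, and then the zero pair could arise from both factors;
    removing 0 from \<open>C\<close> keeps the union disjoint without changing any sum.\<close>
  have inj: "inj_on (\<lambda>b. (b, 0::'b)) B" "inj_on (\<lambda>c. (0::'a, c)) (C - {0})" by (auto simp: inj_on_def)
  have "(\<Sum>d\<in>(\<lambda>b. (b, 0)) ` B \<union> (\<lambda>c. (0, c)) ` (C - {0}). (x \<bullet> d) *\<^sub>R d) = x" for x :: "'a \<times> 'b"
  proof -
    have "(\<Sum>d\<in>(\<lambda>b. (b, 0)) ` B \<union> (\<lambda>c. (0, c)) ` (C - {0}). (x \<bullet> d) *\<^sub>R d)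
      = (\<Sum>b\<in>B. (fst x \<bullet> b) *\<^sub>R (b, 0)) + (\<Sum>c\<in>C - {0}. (snd x \<bullet> c) *\<^sub>R (0, c))"
      using frame_finite[OF BC(1)] frame_finite[OF BC(2)]
      by (subst sum.union_disjoint) (auto simp: sum.reindex inj inner_prod_def)
    also have "(\<Sum>c\<in>C - {0}. (snd x \<bullet> c) *\<^sub>R (0::'a, c)) = (\<Sum>c\<in>C. (snd x \<bullet> c) *\<^sub>R (0, c))"
      using frame_finite[OF BC(2)] by (intro sum.mono_neutral_left) (auto simp: zero_prod_def)
    also have "(\<Sum>b\<in>B. (fst x \<bullet> b) *\<^sub>R (b, 0::'b)) + (\<Sum>c\<in>C. (snd x \<bullet> c) *\<^sub>R (0, c)) = x"
      using frame_expand[OF BC(1), of "fst x"] frame_expand[OF BC(2), of "snd x"]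
      by (simp add: prod_eq_iff fst_sum snd_sum)
    finally show ?thesis .
  qed
  then have "parseval_frame ((\<lambda>b. (b, 0::'b)) ` B \<union> (\<lambda>c. (0::'a, c)) ` (C - {0}))"
    using frame_finite[OF BC(1)] frame_finite[OF BC(2)] by (simp add: parseval_frame_def)
  then show ?thesis unfolding finite_dim_frame_iff by blast
qed

section \<open>Calculus of smooth maps\<close>

lemma ck_on_SucD:
  assumes "ck_on (Suc k) S f"
  shows "x \<in> S \<Longrightarrow> (f has_derivative frechet_derivative f (at x)) (at x)"
    and "ck_on k S (\<lambda>x. frechet_derivative f (at x) v)"
  using assms frechet_derivative_works by auto

lemma ck_on_cong:
  assumes S: "open S" and "ck_on k S f" and "\<And>x. x \<in> S \<Longrightarrow> f x = g x"
  shows "ck_on k S g"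
  using assms(2,3)
proof (induction k arbitrary: f g)
  case 0
  then show ?case using continuous_on_cong[of S S f g] by simp
next
  case (Suc k)
  have D: "(g has_derivative frechet_derivative f (at x)) (at x)" if "x \<in> S" for x
    by (rule has_derivative_transform_within_open[OF ck_on_SucD(1)[OF Suc.prems(1) that] S that])
      (use Suc.prems in auto)
  have eq: "frechet_derivative g (at x) = frechet_derivative f (at x)" if "x \<in> S" for x
    using frechet_derivative_at[OF D[OF that]] by simp
  have "ck_on k S (\<lambda>x. frechet_derivative g (at x) v)" for v
    by (rule Suc.IH[OF ck_on_SucD(2)[OF Suc.prems(1), of v]]) (simp add: eq)
  then show ?case using D by (auto simp: differentiable_def)
qed

text \<open>\<open>frechet_derivative\<close> is a choice operator; uniqueness of derivatives at
  interior points lets any explicitly known derivative \<open>D\<close> stand in for it. The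
  inductions on the order of differentiability rest on this form.\<close>

lemma ck_on_SucI:
  assumes "open S" and D: "\<And>x. x \<in> S \<Longrightarrow> (f has_derivative D x) (at x)"
    and ck: "\<And>v. ck_on k S (\<lambda>x. D x v)"
  shows "ck_on (Suc k) S f"
proof -
  have "frechet_derivative f (at x) = D x" if "x \<in> S" for x
    using frechet_derivative_at[OF D[OF that]] by simp
  then have "ck_on k S (\<lambda>x. frechet_derivative f (at x) v)" for v
    by (intro ck_on_cong[OF assms(1) ck[of v]]) simp
  then show ?thesis using D by (auto simp: differentiable_def)
qed

lemma ck_on_Suc_imp: "ck_on (Suc k) S f \<Longrightarrow> ck_on k S f"
proof (induction k arbitrary: f)
  case 0
  then show ?case
    by (auto intro!: continuous_at_imp_continuous_on differentiable_imp_continuous_within)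
next
  case (Suc k)
  show ?case
    unfolding ck_on.simps(2)[of k]
    using Suc.prems Suc.IH ck_on.simps(2)[of "Suc k" S f] by blast
qed

lemma ck_on_subset: "ck_on k S f \<Longrightarrow> T \<subseteq> S \<Longrightarrow> ck_on k T f"
  by (induction k arbitrary: f) (auto intro: continuous_on_subset)

lemma ck_on_local:
  assumes "\<And>x. x \<in> S \<Longrightarrow> \<exists>T. open T \<and> x \<in> T \<and> ck_on k T f"
  shows "ck_on k S f"
  using assms
proof (induction k arbitrary: f)
  case 0
  have "isCont f x" if "x \<in> S" for x
    using 0[OF that] continuous_on_eq_continuous_at by auto
  then show ?case by (simp add: continuous_at_imp_continuous_on)
next
  case (Suc k)
  have "ck_on k S (\<lambda>x. frechet_derivative f (at x) v)" for v
    by (rule Suc.IH) (use Suc.prems in fastforce)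
  then show ?case using Suc.prems by fastforce
qed

lemma ck_on_const: "ck_on k S (\<lambda>x. c)"
proof (induction k arbitrary: c)
  case (Suc k)
  have "frechet_derivative (\<lambda>x. c) (at x) = (\<lambda>v. 0)" for x
    by (rule frechet_derivative_at[symmetric]) simp
  then show ?case using Suc.IH by simp
qed simp

lemma ck_on_bounded_linear:
  assumes h: "bounded_linear h" and S: "open S"
  shows "ck_on k S h"
proof (cases k)
  case 0
  then show ?thesis using h by (simp add: linear_continuous_on)
next
  case (Suc n)
  show ?thesis unfolding Suc
    by (rule ck_on_SucI[OF S bounded_linear_imp_has_derivative[OF h]]) (rule ck_on_const)
qed

lemma ck_on_add:
  assumes "ck_on k S f" "ck_on k S g" "open S"
  shows "ck_on k S (\<lambda>x. f x + g x)"
  using assms(1,2)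
proof (induction k arbitrary: f g)
  case 0
  then show ?case by (simp add: continuous_on_add)
next
  case (Suc k)
  show ?case
    by (rule ck_on_SucI[OF assms(3) has_derivative_add[OF ck_on_SucD(1)[OF Suc.prems(1)] ck_on_SucD(1)[OF Suc.prems(2)]]])
      (auto intro!: Suc.IH ck_on_SucD(2)[OF Suc.prems(1)] ck_on_SucD(2)[OF Suc.prems(2)])
qed

lemma (in bounded_bilinear) ck_on_prod:
  assumes "ck_on k S f" "ck_on k S g" "open S"
  shows "ck_on k S (\<lambda>x. prod (f x) (g x))"
  using assms(1,2)
proof (induction k arbitrary: f g)
  case 0
  then show ?case by (simp add: continuous_on)
next
  case (Suc k)
  show ?case
    by (rule ck_on_SucI[OF assms(3) FDERIV[OF ck_on_SucD(1)[OF Suc.prems(1)] ck_on_SucD(1)[OF Suc.prems(2)]]])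
      (auto intro!: ck_on_add[OF _ _ assms(3)] Suc.IH
        ck_on_SucD(2)[OF Suc.prems(1)] ck_on_SucD(2)[OF Suc.prems(2)]
        ck_on_Suc_imp[OF Suc.prems(1)] ck_on_Suc_imp[OF Suc.prems(2)])
qed

lemma ck_on_sum:
  assumes "\<And>i. i \<in> K \<Longrightarrow> ck_on k S (f i)" "open S"
  shows "ck_on k S (\<lambda>x. \<Sum>i\<in>K. f i x)"
  using assms(1)
  by (induction K rule: infinite_finite_induct) (auto intro!: ck_on_add ck_on_const assms(2))

text \<open>The chain rule evaluates the derivative of \<open>f\<close> in a direction that moves
  with x, whereas \<open>ck_on\<close> controls derivatives in fixed directions only. Expanding the
  moving direction in a frame gives a finite sum of scalars times derivatives in fixed directions,
  to which the induction applies. Hence the finite dimension of the middle space.\<close>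

lemma ck_on_compose:
  fixes g :: "'a::real_normed_vector \<Rightarrow> 'b::real_inner" and f :: "'b \<Rightarrow> 'c::real_normed_vector"
  assumes fd: "finite_dim TYPE('b)" and "open S" and "open T"
    and "ck_on k T f" and "ck_on k S g" and "g ` S \<subseteq> T"
  shows "ck_on k S (\<lambda>x. f (g x))"
proof -
  obtain B :: "'b set" where B: "parseval_frame B" using fd finite_dim_frame_iff by blast
  show ?thesis
    using assms(4,5,6)
  proof (induction k arbitrary: f g)
    case 0
    then show ?case using continuous_on_compose2 by auto
  next
    case (Suc k)
    note f = ck_on_SucD[OF Suc.prems(1)] and g = ck_on_SucD[OF Suc.prems(2)]
    show ?case
    proof (rule ck_on_SucI[OF assms(2)])
      fix x assume x: "x \<in> S"
      then have gx: "g x \<in> T" using Suc.prems(3) by auto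
      have lin: "linear (frechet_derivative f (at (g x)))"
        using f(1)[OF gx] has_derivative_linear by blast
      have "((\<lambda>x. f (g x)) has_derivative
          (\<lambda>v. frechet_derivative f (at (g x)) (frechet_derivative g (at x) v))) (at x)"
        by (rule has_derivative_compose[OF g(1)[OF x] f(1)[OF gx]])
      then show "((\<lambda>x. f (g x)) has_derivative
          (\<lambda>v. \<Sum>b\<in>B. (frechet_derivative g (at x) v \<bullet> b) *\<^sub>R frechet_derivative f (at (g x)) b)) (at x)"
        by (simp add: frame_linear[OF B lin, symmetric])
    next
      fix v
      show "ck_on k S (\<lambda>x. \<Sum>b\<in>B. (frechet_derivative g (at x) v \<bullet> b) *\<^sub>R frechet_derivative f (at (g x)) b)"
        by (intro ck_on_sum assms(2) bounded_bilinear.ck_on_prod[OF bounded_bilinear_scaleR]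
            bounded_bilinear.ck_on_prod[OF bounded_bilinear_inner] g(2) ck_on_const
            Suc.IH[OF f(2) ck_on_Suc_imp[OF Suc.prems(2)] Suc.prems(3)])
    qed
  qed
qed

section \<open>Closure properties of smooth maps\<close>

lemma smooth_on_cong: "open S \<Longrightarrow> smooth_on S f \<Longrightarrow> (\<And>x. x \<in> S \<Longrightarrow> f x = g x) \<Longrightarrow> smooth_on S g"
  unfolding smooth_on_def using ck_on_cong[of S _ f g] by simp

lemma smooth_on_subset: "smooth_on S f \<Longrightarrow> T \<subseteq> S \<Longrightarrow> smooth_on T f"
  unfolding smooth_on_def using ck_on_subset[of _ S f T] by simp

lemma smooth_on_local:
  "(\<And>x. x \<in> S \<Longrightarrow> \<exists>T. open T \<and> x \<in> T \<and> smooth_on T f) \<Longrightarrow> smooth_on S f"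
  unfolding smooth_on_def by (intro allI ck_on_local) blast

lemma smooth_on_const: "smooth_on S (\<lambda>x. c)"
  unfolding smooth_on_def by (intro allI ck_on_const)

lemma smooth_on_bounded_linear: "bounded_linear h \<Longrightarrow> open S \<Longrightarrow> smooth_on S h"
  unfolding smooth_on_def by (intro allI ck_on_bounded_linear)

lemma smooth_on_id: "open S \<Longrightarrow> smooth_on S (\<lambda>x. x)"
  by (rule smooth_on_bounded_linear[OF bounded_linear_ident])

lemma smooth_on_add: "smooth_on S f \<Longrightarrow> smooth_on S g \<Longrightarrow> open S \<Longrightarrow> smooth_on S (\<lambda>x. f x + g x)"
  unfolding smooth_on_def by (intro allI ck_on_add) auto

lemma smooth_on_sum:
  "(\<And>i. i \<in> K \<Longrightarrow> smooth_on S (f i)) \<Longrightarrow> open S \<Longrightarrow> smooth_on S (\<lambda>x. \<Sum>i\<in>K. f i x)"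
  unfolding smooth_on_def by (intro allI ck_on_sum) auto

lemma (in bounded_bilinear) smooth_on_prod:
  "smooth_on S f \<Longrightarrow> smooth_on S g \<Longrightarrow> open S \<Longrightarrow> smooth_on S (\<lambda>x. prod (f x) (g x))"
  unfolding smooth_on_def by (intro allI ck_on_prod) auto

lemmas smooth_on_scaleR = bounded_bilinear.smooth_on_prod[OF bounded_bilinear_scaleR]
lemmas smooth_on_mult = bounded_bilinear.smooth_on_prod[OF bounded_bilinear_mult]
lemmas smooth_on_inner = bounded_bilinear.smooth_on_prod[OF bounded_bilinear_inner]

lemma smooth_on_diff:
  assumes "smooth_on S f" "smooth_on S g" "open S"
  shows "smooth_on S (\<lambda>x. f x - g x)"
  using smooth_on_add[OF assms(1) smooth_on_scaleR[OF smooth_on_const[of S "-1"] assms(2,3)] assms(3)] by simp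

lemma smooth_on_compose:
  fixes g :: "'a::real_normed_vector \<Rightarrow> 'b::real_inner" and f :: "'b \<Rightarrow> 'c::real_normed_vector"
  assumes "finite_dim TYPE('b)" "open S" "open T" "smooth_on T f" "smooth_on S g" "g ` S \<subseteq> T"
  shows "smooth_on S (\<lambda>x. f (g x))"
  unfolding smooth_on_def
proof (rule allI, rule ck_on_compose[OF assms(1-3) _ _ assms(6)])
  show "ck_on k T f" "ck_on k S g" for k
    using assms(4,5) by (simp_all add: smooth_on_def)
qed

lemma smooth_on_has_derivative:
  assumes "smooth_on S f" "x \<in> S"
  shows "(f has_derivative frechet_derivative f (at x)) (at x)"
  using assms ck_on_SucD(1) unfolding smooth_on_def by blast

lemma smooth_on_frechet_derivative:
  assumes "smooth_on S f"
  shows "smooth_on S (\<lambda>x. frechet_derivative f (at x) v)"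
  using assms ck_on_SucD(2) unfolding smooth_on_def by blast

lemma smooth_on_continuous_on: "smooth_on S f \<Longrightarrow> continuous_on S f"
  unfolding smooth_on_def by (metis ck_on.simps(1))

lemma smooth_on_Pair:
  assumes "smooth_on S f" "smooth_on S g" "open S"
  shows "smooth_on S (\<lambda>x. (f x, g x))"
proof -
  have "ck_on k S (\<lambda>x. (f x, g x))" if "ck_on k S f" "ck_on k S g" for k
    using that
  proof (induction k arbitrary: f g)
    case 0
    then show ?case by (simp add: continuous_on_Pair)
  next
    case (Suc k)
    show ?case
      by (rule ck_on_SucI[OF assms(3) has_derivative_Pair[OF ck_on_SucD(1)[OF Suc.prems(1)] ck_on_SucD(1)[OF Suc.prems(2)]]])
        (auto intro!: Suc.IH ck_on_SucD(2)[OF Suc.prems(1)] ck_on_SucD(2)[OF Suc.prems(2)])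
  qed
  then show ?thesis using assms unfolding smooth_on_def by blast
qed

section \<open>Cut-off functions\<close>

lemma smooth_on_inverse: "smooth_on {x::real. x \<noteq> 0} inverse"
proof -
  have op: "open {x::real. x \<noteq> 0}" by (rule open_Collect_neq) (intro continuous_intros)+
  have "ck_on k {x::real. x \<noteq> 0} inverse" for k
  proof (induction k)
    case 0
    show ?case by (auto intro!: continuous_intros)
  next
    case (Suc k)
    show ?case
    proof (rule ck_on_SucI[OF op])
      show "(inverse has_derivative (\<lambda>v. inverse x * inverse x * (- v))) (at x)" if "x \<in> {x::real. x \<noteq> 0}" for x
        using that by (auto intro!: derivative_eq_intros simp: algebra_simps)
      show "ck_on k {x::real. x \<noteq> 0} (\<lambda>x. inverse x * inverse x * (- v))" for v
        by (intro bounded_bilinear.ck_on_prod[OF bounded_bilinear_mult] Suc ck_on_const op)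
    qed
  qed
  then show ?thesis by (simp add: smooth_on_def)
qed

lemma poly_div_exp_tendsto_0: "((\<lambda>y::real. poly p y / exp y) \<longlongrightarrow> 0) at_top"
proof -
  have "((\<lambda>y::real. \<Sum>i\<le>degree p. coeff p i * (y ^ i / exp y)) \<longlongrightarrow> (\<Sum>i\<le>degree p. coeff p i * 0)) at_top"
    by (intro tendsto_sum tendsto_mult tendsto_const tendsto_power_div_exp_0)
  then show ?thesis by (simp add: poly_altdef sum_divide_distrib)
qed

text \<open>These are the functions p(1/x) exp(-1/x), extended by 0. The polynomial factor is there
  because the derivatives of exp(-1/x) have this shape, so that the family is closed under
  differentiation.\<close>

definition flat_fun :: "real poly \<Rightarrow> real \<Rightarrow> real" where
  "flat_fun p x = (if x \<le> 0 then 0 else poly p (1 / x) / exp (1 / x))"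

text \<open>With y = 1/x, differentiating p(y) exp(-y) gives y^2 (p(y) - p'(y)) exp(-y); the
  polynomial in the statement is X^2 (p - p').\<close>

lemma flat_fun_deriv:
  "(flat_fun p has_real_derivative flat_fun ([:0, 0, 1:] * (p - pderiv p)) x) (at x)"
proof -
  consider "x < 0" | "x > 0" | "x = 0" by linarith
  then show ?thesis
  proof cases
    case 1
    have "((\<lambda>x. 0) has_real_derivative 0) (at x)" by simp
    then have "(flat_fun p has_real_derivative 0) (at x)"
      by (rule has_field_derivative_transform_within_open[of _ _ _ "{..<0}"]) (use 1 in \<open>auto simp: flat_fun_def\<close>)
    then show ?thesis using 1 by (simp add: flat_fun_def)
  next
    case 2
    have "((\<lambda>x. poly p (1 / x) / exp (1 / x)) has_real_derivative
        flat_fun ([:0, 0, 1:] * (p - pderiv p)) x) (at x)"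
      using 2 by (auto intro!: derivative_eq_intros simp: flat_fun_def field_simps power2_eq_square)
    then show ?thesis
      by (rule has_field_derivative_transform_within_open[of _ _ _ "{0<..}"]) (use 2 in \<open>auto simp: flat_fun_def\<close>)
  next
    case 3
    \<comment> \<open>At 0 the left difference quotients vanish and the right ones are y p(y) / exp
      y with y = 1/h, which tends to 0.\<close>
    have "((\<lambda>h. (flat_fun p (0 + h) - flat_fun p 0) / h) \<longlongrightarrow> 0) (at (0::real))"
    proof (rule filterlim_split_at)
      show "((\<lambda>h. (flat_fun p (0 + h) - flat_fun p 0) / h) \<longlongrightarrow> 0) (at_left 0)"
      proof (rule tendsto_eventually)
        show "\<forall>\<^sub>F h in at_left 0. (flat_fun p (0 + h) - flat_fun p 0) / h = 0"
          by (rule eventually_at_leftI[of "-1"]) (auto simp: flat_fun_def)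
      qed
    next
      have "((\<lambda>h. poly ([:0, 1:] * p) (inverse h) / exp (inverse h)) \<longlongrightarrow> 0) (at_right (0::real))"
        by (rule filterlim_compose[OF poly_div_exp_tendsto_0 filterlim_inverse_at_top_right])
      then show "((\<lambda>h. (flat_fun p (0 + h) - flat_fun p 0) / h) \<longlongrightarrow> 0) (at_right 0)"
        by (rule Lim_transform_eventually)
          (auto simp: flat_fun_def field_simps intro!: eventually_at_rightI[of 0 1])
    qed
    then have "(flat_fun p has_real_derivative 0) (at 0)" unfolding DERIV_def .
    then show ?thesis using 3 by (simp add: flat_fun_def)
  qed
qed

lemma smooth_flat_fun: "smooth_on UNIV (flat_fun p)"
proof -
  have "ck_on k UNIV (flat_fun p)" for k
  proof (induction k arbitrary: p)
    case 0
    show ?case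
      using DERIV_isCont[OF flat_fun_deriv[of p]] by (simp add: continuous_at_imp_continuous_on)
  next
    case (Suc k)
    show ?case
    proof (rule ck_on_SucI[OF open_UNIV])
      show "(flat_fun p has_derivative (\<lambda>v. flat_fun ([:0, 0, 1:] * (p - pderiv p)) x * v)) (at x)" for x
        using flat_fun_deriv[of p x] by (simp add: has_field_derivative_def)
      show "ck_on k UNIV (\<lambda>x. flat_fun ([:0, 0, 1:] * (p - pderiv p)) x * v)" for v
        by (intro bounded_bilinear.ck_on_prod[OF bounded_bilinear_mult] Suc ck_on_const open_UNIV)
    qed
  qed
  then show ?thesis by (simp add: smooth_on_def)
qed

text \<open>The quotient f(2 - x) / (f(2 - x) + f(x - 1)), with f flat on the nonpositive numbers
  and positive elsewhere. The denominator never vanishes, because 2 - x and x - 1 add up to 1 and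
  cannot both be nonpositive.\<close>

lemma smooth_step:
  obtains h :: "real \<Rightarrow> real"
  where "smooth_on UNIV h" "\<And>x. x \<le> 1 \<Longrightarrow> h x = 1" "\<And>x. x \<ge> 2 \<Longrightarrow> h x = 0"
proof -
  define f where "f = flat_fun 1"
  have f: "f x = 0" if "x \<le> 0" for x using that by (simp add: f_def flat_fun_def)
  have f': "f x > 0" if "x > 0" for x using that by (simp add: f_def flat_fun_def)
  have f0: "f x \<ge> 0" for x by (simp add: f_def flat_fun_def)
  have nz: "f (2 - x) + f (x - 1) \<noteq> 0" for x
    using f'[of "2 - x"] f'[of "x - 1"] f0[of "2 - x"] f0[of "x - 1"] by linarith
  have sm: "smooth_on UNIV f" by (simp add: f_def smooth_flat_fun)
  have s1: "smooth_on UNIV (\<lambda>x. f (2 - x))" "smooth_on UNIV (\<lambda>x. f (x - 1))"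
    by (intro smooth_on_compose[OF finite_dim_real open_UNIV open_UNIV sm]
        smooth_on_diff smooth_on_const smooth_on_id; simp)+
  have "smooth_on UNIV (\<lambda>x. inverse (f (2 - x) + f (x - 1)))"
    by (rule smooth_on_compose[OF finite_dim_real open_UNIV _ smooth_on_inverse smooth_on_add[OF s1 open_UNIV]])
      (use nz in \<open>auto intro!: open_Collect_neq continuous_intros\<close>)
  then have "smooth_on UNIV (\<lambda>x. f (2 - x) * inverse (f (2 - x) + f (x - 1)))"
    by (intro smooth_on_mult s1 open_UNIV)
  moreover have "f (2 - x) * inverse (f (2 - x) + f (x - 1)) = 1" if "x \<le> 1" for x
    using nz[of x] f[of "x - 1"] that by simp
  moreover have "f (2 - x) * inverse (f (2 - x) + f (x - 1)) = 0" if "x \<ge> 2" for x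
    using f[of "2 - x"] that by simp
  ultimately show ?thesis using that by blast
qed

section \<open>Hadamard's lemma and mixed partial derivatives\<close>

text \<open>A Lebesgue number of the cover of \<open>K\<close> by the sets \<open>U x\<close> is a
  radius valid at all points of \<open>K\<close> at once, including for y outside \<open>K\<close>.
  The half of e is spent on comparing both points with the centre of a common member of the
  cover.\<close>

lemma compact_uniform_nhd:
  fixes H :: "'a::metric_space \<Rightarrow> real"
  assumes K: "compact K" "K \<subseteq> S" and S: "open S" and H: "continuous_on S H" and "e > 0"
  obtains d where "d > 0" "\<And>x y. x \<in> K \<Longrightarrow> dist x y < d \<Longrightarrow> y \<in> S \<and> \<bar>H y - H x\<bar> < e"
proof -
  define U where "U x = {y \<in> S. \<bar>H y - H x\<bar> < e / 2}" for x
  have op: "open (U x)" for x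
  proof -
    have "continuous_on S (\<lambda>y. \<bar>H y - H x\<bar>)" using H by (intro continuous_intros)
    then have "open (S \<inter> (\<lambda>y. \<bar>H y - H x\<bar>) -` {..<e / 2})"
      by (rule continuous_open_preimage[OF _ S open_lessThan])
    moreover have "S \<inter> (\<lambda>y. \<bar>H y - H x\<bar>) -` {..<e / 2} = U x" by (auto simp: U_def)
    ultimately show ?thesis by simp
  qed
  have "K \<subseteq> \<Union>(U ` K)" using K(2) \<open>e > 0\<close> by (auto simp: U_def)
  then obtain d where d: "0 < d" "\<And>x. x \<in> K \<Longrightarrow> \<exists>G\<in>U ` K. ball x d \<subseteq> G"
    using Heine_Borel_lemma[OF K(1), of "U ` K"] op by blast
  have "y \<in> S \<and> \<bar>H y - H x\<bar> < e" if xy: "x \<in> K" "dist x y < d" for x y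
  proof -
    obtain z where z: "ball x d \<subseteq> U z" using d(2)[OF xy(1)] by blast
    have "y \<in> U z" "x \<in> U z" using z xy(2) d(1) by auto
    then have "y \<in> S" "\<bar>H y - H z\<bar> < e / 2" "\<bar>H x - H z\<bar> < e / 2" by (auto simp: U_def)
    then show ?thesis by linarith
  qed
  then show ?thesis using that d(1) by blast
qed

lemma has_derivative_along_line:
  assumes "(G has_derivative G') (at (x + r *\<^sub>R w))"
  shows "((\<lambda>r. G (x + r *\<^sub>R w)) has_vector_derivative G' w) (at r)"
proof -
  have "((\<lambda>r. x + r *\<^sub>R w) has_derivative (\<lambda>h. h *\<^sub>R w)) (at r)"
    by (auto intro!: derivative_eq_intros)
  from has_derivative_compose[OF this assms] has_derivative_linear[OF assms] show ?thesis
    by (simp add: has_vector_derivative_def linear_scale)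
qed

definition star_about_0 :: "'a::real_vector set \<Rightarrow> bool" where
  "star_about_0 S \<longleftrightarrow> (\<forall>u\<in>S. \<forall>s\<in>{0..1}. s *\<^sub>R u \<in> S)"

lemma continuous_on_ray_weight:
  fixes G :: "'a::real_normed_vector \<Rightarrow> real"
  assumes "continuous_on S G" "star_about_0 S" "u \<in> S"
  shows "continuous_on {0..1} (\<lambda>s. s ^ m * G (s *\<^sub>R u))"
  using assms unfolding star_about_0_def
  by (intro continuous_intros continuous_on_compose2[OF assms(1)]) auto

text \<open>Differentiation under the integral sign. The mean value theorem on each segment from s u
  to s y bounds the remainder by a difference of derivatives of \<open>G\<close>, which is small
  uniformly in s because the segment from 0 to u is compact. The weight s^m is carried along because
  each differentiation contributes one more factor s, so an induction needs all m.\<close>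

lemma ray_integral_has_derivative:
  fixes G :: "'a::real_inner \<Rightarrow> real"
  assumes fd: "finite_dim TYPE('a)" and S: "open S" "star_about_0 S"
    and G: "ck_on (Suc 0) S G" and u: "u \<in> S"
  shows "((\<lambda>u. integral {0..1} (\<lambda>s. s ^ m * G (s *\<^sub>R u))) has_derivative
     (\<lambda>v. integral {0..1} (\<lambda>s. s ^ Suc m * frechet_derivative G (at (s *\<^sub>R u)) v))) (at u)"
proof -
  obtain B :: "'a set" where B: "parseval_frame B" using fd finite_dim_frame_iff by blast
  let ?D = "\<lambda>x. frechet_derivative G (at x)"
  let ?L = "\<lambda>v. integral {0..1} (\<lambda>s. s ^ Suc m * ?D (s *\<^sub>R u) v)"
  have der: "(G has_derivative ?D x) (at x)" if "x \<in> S" for x by (rule ck_on_SucD(1)[OF G that])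
  have lin: "linear (?D x)" if "x \<in> S" for x using der[OF that] has_derivative_linear by blast
  have contD: "continuous_on S (\<lambda>x. ?D x v)" for v using ck_on_SucD(2)[OF G] by simp
  have contG: "continuous_on S G" using ck_on_Suc_imp[OF G] by simp
  have intD: "(\<lambda>s. s ^ n * ?D (s *\<^sub>R u) v) integrable_on {0..1}" for n v
    by (rule integrable_continuous_real[OF continuous_on_ray_weight[OF contD S(2) u]])
  have intG: "(\<lambda>s. s ^ n * G (s *\<^sub>R y)) integrable_on {0..1}" if "y \<in> S" for n y
    by (rule integrable_continuous_real[OF continuous_on_ray_weight[OF contG S(2) that]])
  have su: "s *\<^sub>R u \<in> S" if "s \<in> {0..1}" for s using S(2) u that by (auto simp: star_about_0_def)
  have "linear ?L"
  proof (rule linearI)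
    fix v w :: 'a and c :: real
    have "?L (v + w) = integral {0..1} (\<lambda>s. s ^ Suc m * ?D (s *\<^sub>R u) v + s ^ Suc m * ?D (s *\<^sub>R u) w)"
      by (rule Henstock_Kurzweil_Integration.integral_cong)
        (simp add: linear_add[OF lin[OF su]] distrib_left)
    then show "?L (v + w) = ?L v + ?L w"
      by (simp only: Henstock_Kurzweil_Integration.integral_add[OF intD intD])
    have "?L (c *\<^sub>R v) = integral {0..1} (\<lambda>s. c * (s ^ Suc m * ?D (s *\<^sub>R u) v))"
      by (rule Henstock_Kurzweil_Integration.integral_cong)
        (simp add: linear_scale[OF lin[OF su]] algebra_simps)
    then show "?L (c *\<^sub>R v) = c *\<^sub>R ?L v" by (simp only: integral_mult_right real_scaleR_def)
  qed
  then have bl: "bounded_linear ?L" by (rule frame_bounded_linear[OF B])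
  \<comment> \<open>\<open>\<Phi>\<close> bounds the operator norm of the difference of the
    derivatives at two points; it is continuous and vanishes on the diagonal.\<close>
  define \<Phi> where "\<Phi> = (\<lambda>(x, y). \<Sum>b\<in>B. norm b * \<bar>?D y b - ?D x b\<bar>)"
  have cont\<Phi>: "continuous_on (S \<times> S) \<Phi>"
  proof -
    have "continuous_on (S \<times> S) (\<lambda>p. \<Sum>b\<in>B. norm b * \<bar>?D (snd p) b - ?D (fst p) b\<bar>)"
      by (intro continuous_intros continuous_on_compose2[OF contD, of _ snd]
          continuous_on_compose2[OF contD, of _ fst]) auto
    then show ?thesis by (simp add: \<Phi>_def case_prod_unfold)
  qed
  have "\<exists>d>0. \<forall>y. norm (y - u) < d \<longrightarrow>
      norm (integral {0..1} (\<lambda>s. s ^ m * G (s *\<^sub>R y)) - integral {0..1} (\<lambda>s. s ^ m * G (s *\<^sub>R u)) - ?L (y - u))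
        \<le> e * norm (y - u)" if e: "e > 0" for e
  proof -
    \<comment> \<open>The segment from 0 to u, embedded in the diagonal: near it
      \<open>\<Phi>\<close> stays below e, with a radius independent of s.\<close>
    define K where "K = (\<lambda>s. (s *\<^sub>R u, s *\<^sub>R u)) ` {0..1}"
    have K: "compact K" "K \<subseteq> S \<times> S" unfolding K_def using su
      by (auto intro!: compact_continuous_image continuous_intros)
    obtain d where d: "d > 0" "\<And>x y. x \<in> K \<Longrightarrow> dist x y < d \<Longrightarrow> y \<in> S \<times> S \<and> \<bar>\<Phi> y - \<Phi> x\<bar> < e"
      using compact_uniform_nhd[OF K open_Times[OF S(1) S(1)] cont\<Phi> e] by blast
    have near: "z \<in> S \<and> \<Phi> (s *\<^sub>R u, z) < e" if "s \<in> {0..1}" "norm (z - s *\<^sub>R u) < d" for s z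
    proof -
      have "dist (s *\<^sub>R u, s *\<^sub>R u) (s *\<^sub>R u, z) < d"
        using that(2) by (simp add: dist_Pair_Pair dist_norm norm_minus_commute)
      then have "(s *\<^sub>R u, z) \<in> S \<times> S \<and> \<bar>\<Phi> (s *\<^sub>R u, z) - \<Phi> (s *\<^sub>R u, s *\<^sub>R u)\<bar> < e"
        by (rule d(2)[rotated]) (unfold K_def, rule imageI[OF that(1)])
      moreover have "\<Phi> (s *\<^sub>R u, s *\<^sub>R u) = 0" by (simp add: \<Phi>_def)
      ultimately show ?thesis by (simp add: abs_less_iff)
    qed
    have "norm (integral {0..1} (\<lambda>s. s ^ m * G (s *\<^sub>R y)) - integral {0..1} (\<lambda>s. s ^ m * G (s *\<^sub>R u)) - ?L (y - u))
        \<le> e * norm (y - u)" if y: "norm (y - u) < d" for y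
    proof -
      define v where "v = y - u"
      have yS: "y \<in> S" using near[of 1 y] y by simp
      have est: "\<bar>s ^ m * G (s *\<^sub>R y) - s ^ m * G (s *\<^sub>R u) - s ^ Suc m * ?D (s *\<^sub>R u) v\<bar> \<le> e * norm v"
        if s: "s \<in> {0..1}" for s
      proof -
        have pt: "norm ((s *\<^sub>R u + r *\<^sub>R (s *\<^sub>R v)) - s *\<^sub>R u) < d" if "0 \<le> r" "r \<le> 1" for r
        proof -
          have "r * s * norm v \<le> 1 * norm v"
            using that s by (intro mult_right_mono mult_le_one) auto
          then show ?thesis using y that s by (simp add: v_def abs_mult)
        qed
        have "\<exists>z>0. z < 1 \<and> G (s *\<^sub>R u + 1 *\<^sub>R (s *\<^sub>R v)) - G (s *\<^sub>R u + 0 *\<^sub>R (s *\<^sub>R v))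
            = (1 - 0) * ?D (s *\<^sub>R u + z *\<^sub>R (s *\<^sub>R v)) (s *\<^sub>R v)"
        proof (rule MVT2)
          fix r :: real assume "0 \<le> r" "r \<le> 1"
          then have "s *\<^sub>R u + r *\<^sub>R (s *\<^sub>R v) \<in> S" using near[OF s pt] by blast
          from has_derivative_along_line[OF der[OF this]]
          show "((\<lambda>r. G (s *\<^sub>R u + r *\<^sub>R (s *\<^sub>R v))) has_real_derivative
            ?D (s *\<^sub>R u + r *\<^sub>R (s *\<^sub>R v)) (s *\<^sub>R v)) (at r)"
            by (simp add: has_real_derivative_iff_has_vector_derivative)
        qed simp
        then obtain r where r: "0 < r" "r < 1" "G (s *\<^sub>R y) - G (s *\<^sub>R u) = ?D (s *\<^sub>R u + r *\<^sub>R (s *\<^sub>R v)) (s *\<^sub>R v)"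
          by (auto simp: v_def scaleR_right_diff_distrib)
        define z where "z = s *\<^sub>R u + r *\<^sub>R (s *\<^sub>R v)"
        have z: "z \<in> S" "\<Phi> (s *\<^sub>R u, z) < e" using near[OF s pt[of r]] r by (auto simp: z_def)
        have "linear (\<lambda>w. ?D z w - ?D (s *\<^sub>R u) w)"
          by (intro linear_compose_sub lin z su s)
        from frame_linear_norm_le[OF B this, of "s *\<^sub>R v"]
        have "\<bar>?D z (s *\<^sub>R v) - ?D (s *\<^sub>R u) (s *\<^sub>R v)\<bar> \<le> norm (s *\<^sub>R v) * \<Phi> (s *\<^sub>R u, z)"
          by (simp add: \<Phi>_def)
        also have "\<dots> \<le> norm (s *\<^sub>R v) * e" using z by (intro mult_left_mono) auto
        also have "\<dots> \<le> norm v * e" using s that \<open>e > 0\<close>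
          by (intro mult_right_mono) (auto intro: mult_left_le_one_le)
        finally have 1: "\<bar>G (s *\<^sub>R y) - G (s *\<^sub>R u) - s * ?D (s *\<^sub>R u) v\<bar> \<le> norm v * e"
          by (simp add: r(3) z_def linear_scale[OF lin[OF su[OF s]]])
        have "s ^ m * \<bar>G (s *\<^sub>R y) - G (s *\<^sub>R u) - s * ?D (s *\<^sub>R u) v\<bar> \<le> 1 * (norm v * e)"
          using s 1 by (intro mult_mono power_le_one) auto
        moreover have "s ^ m * \<bar>G (s *\<^sub>R y) - G (s *\<^sub>R u) - s * ?D (s *\<^sub>R u) v\<bar>
          = \<bar>s ^ m * G (s *\<^sub>R y) - s ^ m * G (s *\<^sub>R u) - s ^ Suc m * ?D (s *\<^sub>R u) v\<bar>"
        proof -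
          have "s ^ m * \<bar>c\<bar> = \<bar>s ^ m * c\<bar>" for c using s by (simp add: abs_mult)
          moreover have "s ^ m * (G (s *\<^sub>R y) - G (s *\<^sub>R u) - s * ?D (s *\<^sub>R u) v)
            = s ^ m * G (s *\<^sub>R y) - s ^ m * G (s *\<^sub>R u) - s ^ Suc m * ?D (s *\<^sub>R u) v"
            by (simp add: algebra_simps)
          ultimately show ?thesis by (simp only:)
        qed
        ultimately show ?thesis by (simp add: mult.commute)
      qed
      have i1: "(\<lambda>s. s ^ m * G (s *\<^sub>R y) - s ^ m * G (s *\<^sub>R u)) integrable_on {0..1}"
        by (intro integrable_diff intG yS u)
      have "integral {0..1} (\<lambda>s. s ^ m * G (s *\<^sub>R y)) - integral {0..1} (\<lambda>s. s ^ m * G (s *\<^sub>R u)) - ?L v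
        = integral {0..1} (\<lambda>s. s ^ m * G (s *\<^sub>R y) - s ^ m * G (s *\<^sub>R u) - s ^ Suc m * ?D (s *\<^sub>R u) v)"
        by (simp only: Henstock_Kurzweil_Integration.integral_diff[OF i1 intD]
            Henstock_Kurzweil_Integration.integral_diff[OF intG[OF yS] intG[OF u]])
      moreover have "norm (integral {0..1} (\<lambda>s. s ^ m * G (s *\<^sub>R y) - s ^ m * G (s *\<^sub>R u) - s ^ Suc m * ?D (s *\<^sub>R u) v))
        \<le> integral {0..1} (\<lambda>s::real. e * norm v)"
        by (rule integral_norm_bound_integral[OF integrable_diff[OF i1 intD]]) (use est in auto)
      ultimately show ?thesis by (simp add: v_def)
    qed
    then show ?thesis using d(1) by blast
  qed
  then show ?thesis unfolding has_derivative_at_alt using bl by blast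
qed

lemma ck_on_ray_integral:
  fixes G :: "'a::real_inner \<Rightarrow> real"
  assumes fd: "finite_dim TYPE('a)" and S: "open S" "star_about_0 S" and "ck_on k S G"
  shows "ck_on k S (\<lambda>u. integral {0..1} (\<lambda>s. s ^ m * G (s *\<^sub>R u)))"
  using assms(4)
proof (induction k arbitrary: G m)
  case 0
  then have G: "continuous_on S G" by simp
  have "continuous_on (S \<times> cbox 0 1) (\<lambda>p. snd p ^ m * G (snd p *\<^sub>R fst p))"
    using S(2) by (intro continuous_intros continuous_on_compose2[OF G]) (auto simp: star_about_0_def)
  then have "continuous_on S (\<lambda>u. integral (cbox 0 1) (\<lambda>s. s ^ m * G (s *\<^sub>R u)))"
    by (intro integral_continuous_on_param) (simp add: case_prod_unfold)
  then show ?case by simp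
next
  case (Suc k)
  have "ck_on (Suc 0) S G"
    using Suc.prems by (induction k) (auto intro: ck_on_Suc_imp simp del: ck_on.simps)
  from ray_integral_has_derivative[OF fd S this]
  show ?case by (rule ck_on_SucI[OF S(1)]) (auto intro: Suc.IH ck_on_SucD(2)[OF Suc.prems] simp del: power_Suc)
qed

text \<open>Integrating the derivative of \<open>F\<close> along the segment from a to u, and
  expanding the direction u - a in the frame, exhibits \<open>g b\<close> as the ray integral of the
  partial derivative along b. The point is that \<open>g b\<close> is again smooth, so that a
  derivation may be applied to the products.\<close>

lemma hadamard:
  fixes F :: "'a::real_inner \<Rightarrow> real"
  assumes B: "parseval_frame (B :: 'a set)" and F: "smooth_on (ball a r) F" and r: "r > 0"
  obtains g where "\<And>b. smooth_on (ball a r) (g b)"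
    "\<And>u. u \<in> ball a r \<Longrightarrow> F u = F a + (\<Sum>b\<in>B. ((u - a) \<bullet> b) * g b u)"
    "\<And>b. g b a = frechet_derivative F (at a) b"
proof -
  have fd: "finite_dim TYPE('a)" using B finite_dim_frame_iff by blast
  define G where "G = (\<lambda>u. F (a + u))"
  let ?S = "ball 0 r :: 'a set"
  have star: "star_about_0 ?S"
    unfolding star_about_0_def
  proof (intro ballI)
    fix u :: 'a and s :: real assume us: "u \<in> ?S" "s \<in> {0..1}"
    then have "\<bar>s\<bar> * norm u \<le> 1 * norm u" by (intro mult_right_mono) auto
    then show "s *\<^sub>R u \<in> ?S" using us by simp
  qed
  have G: "smooth_on ?S G" unfolding G_def
    by (rule smooth_on_compose[OF fd _ _ F]) (auto intro!: smooth_on_add smooth_on_const smooth_on_id simp: dist_norm)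
  have derG: "(G has_derivative frechet_derivative F (at (a + x))) (at x)" if "x \<in> ?S" for x
  proof -
    have "a + x \<in> ball a r" using that by (simp add: dist_norm)
    then have "(F has_derivative frechet_derivative F (at (a + x))) (at (a + x))"
      using smooth_on_has_derivative[OF F] by blast
    moreover have "((\<lambda>u. a + u) has_derivative (\<lambda>v. v)) (at x)"
      by (auto intro!: derivative_eq_intros)
    ultimately show ?thesis
      using has_derivative_compose[of "\<lambda>u. a + u" "\<lambda>v. v" x UNIV F] by (simp add: G_def)
  qed
  \<comment> \<open>The trivial weight \<open>s ^ 0\<close> brings the integral into the form of
    \<open>ck_on_ray_integral\<close>.\<close>
  define h where "h b u = integral {0..1} (\<lambda>s. s ^ 0 * frechet_derivative G (at (s *\<^sub>R u)) b)" for b u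
  have h: "smooth_on ?S (h b)" for b
    using smooth_on_frechet_derivative[OF G, of b] ck_on_ray_integral[OF fd _ star, of _ _ 0]
    unfolding smooth_on_def h_def by blast
  have DG0: "(G has_derivative frechet_derivative G (at x)) (at x)" if "x \<in> ?S" for x
    by (rule smooth_on_has_derivative[OF G that])
  have exp0: "G u = G 0 + (\<Sum>b\<in>B. (u \<bullet> b) * h b u)" if u: "u \<in> ?S" for u
  proof -
    have su: "s *\<^sub>R u \<in> ?S" if "s \<in> {0..1}" for s using star u that unfolding star_about_0_def by blast
    have "((\<lambda>s. frechet_derivative G (at (s *\<^sub>R u)) u) has_integral (G (1 *\<^sub>R u) - G (0 *\<^sub>R u))) {0..1}"
    proof (rule fundamental_theorem_of_calculus)
      fix s :: real assume "s \<in> {0..1}"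
      then have "(G has_derivative frechet_derivative G (at (s *\<^sub>R u))) (at (0 + s *\<^sub>R u))" using DG0[OF su] by simp
      from has_derivative_along_line[OF this]
      show "((\<lambda>s. G (s *\<^sub>R u)) has_vector_derivative frechet_derivative G (at (s *\<^sub>R u)) u) (at s within {0..1})"
        by (simp add: has_vector_derivative_at_within)
    qed simp
    moreover have "((\<lambda>s. \<Sum>b\<in>B. (u \<bullet> b) * (s ^ 0 * frechet_derivative G (at (s *\<^sub>R u)) b)) has_integral
        (\<Sum>b\<in>B. (u \<bullet> b) * h b u)) {0..1}"
      unfolding h_def
      by (intro has_integral_sum frame_finite[OF B] has_integral_mult_right integrable_integral
          integrable_continuous_real continuous_on_ray_weight[OF _ star u]
          smooth_on_continuous_on smooth_on_frechet_derivative[OF G])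
    then have "((\<lambda>s. frechet_derivative G (at (s *\<^sub>R u)) u) has_integral
        (\<Sum>b\<in>B. (u \<bullet> b) * h b u)) {0..1}"
    proof (rule has_integral_eq[rotated])
      fix s :: real assume "s \<in> {0..1}"
      then have "linear (frechet_derivative G (at (s *\<^sub>R u)))" using DG0[OF su] has_derivative_linear by blast
      from frame_linear[OF B this, of u]
      show "(\<Sum>b\<in>B. (u \<bullet> b) * (s ^ 0 * frechet_derivative G (at (s *\<^sub>R u)) b)) = frechet_derivative G (at (s *\<^sub>R u)) u"
        by simp
    qed
    ultimately have "G (1 *\<^sub>R u) - G (0 *\<^sub>R u) = (\<Sum>b\<in>B. (u \<bullet> b) * h b u)"
      by (rule has_integral_unique)
    then show ?thesis by simp
  qed
  show ?thesis
  proof (rule that[of "\<lambda>b u. h b (u - a)"])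
    show "smooth_on (ball a r) (\<lambda>u. h b (u - a))" for b
      by (rule smooth_on_compose[OF fd _ _ h]) (auto intro!: smooth_on_diff smooth_on_const smooth_on_id simp: dist_norm norm_minus_commute)
    show "F u = F a + (\<Sum>b\<in>B. ((u - a) \<bullet> b) * h b (u - a))" if "u \<in> ball a r" for u
      using exp0[of "u - a"] that by (simp add: G_def dist_norm norm_minus_commute)
    show "h b (a - a) = frechet_derivative F (at a) b" for b
      using frechet_derivative_at[OF derG[of 0]] r by (simp add: h_def)
  qed
qed

text \<open>Integration avoids any second-order Taylor argument: the y-derivative of
  \<open>\<Phi>\<close> at (s, c) is a constant plus the integral over x, up to s, of the
  y-derivative of \<open>P\<close>. The fundamental theorem of calculus then differentiates in
  s.\<close>

lemma mixed_partials_plane: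
  fixes \<Phi> :: "real \<times> real \<Rightarrow> real"
  assumes S: "open S" and \<Phi>: "smooth_on S \<Phi>" and tc: "(t, c) \<in> S"
  defines "P \<equiv> \<lambda>z. frechet_derivative \<Phi> (at z) (1, 0)"
  shows "((\<lambda>s. frechet_derivative \<Phi> (at (s, c)) (0, 1)) has_real_derivative
      frechet_derivative P (at (t, c)) (0, 1)) (at t)"
proof -
  obtain I0 I1 where I: "open I0" "open I1" "t \<in> I0" "c \<in> I1" "I0 \<times> I1 \<subseteq> S"
    using open_prod_elim[OF S tc] by (metis mem_Sigma_iff)
  obtain e0 where e0: "e0 > 0" "cball t e0 \<subseteq> I0" using I open_contains_cball by blast
  obtain e1 where e1: "e1 > 0" "cball c e1 \<subseteq> I1" using I open_contains_cball by blast
  have inS: "(x, y) \<in> S" if "x \<in> {t - e0..t + e0}" "y \<in> {c - e1..c + e1}" for x y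
    by (rule subsetD[OF I(5)]) (use that e0(2) e1(2) in \<open>auto simp: cball_eq_atLeastAtMost\<close>)
  let ?D = "\<lambda>z. frechet_derivative \<Phi> (at z)"
  let ?Q = "\<lambda>z. frechet_derivative P (at z) (0, 1)"
  have P: "smooth_on S P" unfolding P_def by (rule smooth_on_frechet_derivative[OF \<Phi>])
  have Q: "continuous_on S ?Q"
    by (rule smooth_on_continuous_on[OF smooth_on_frechet_derivative[OF P]])
  have d1: "((\<lambda>x. \<Phi> (x, y)) has_real_derivative P (x, y)) (at x)" if "(x, y) \<in> S" for x y
    using has_derivative_along_line[of \<Phi> "?D (x, y)" "(0, y)" x "(1, 0)"] smooth_on_has_derivative[OF \<Phi> that]
    by (simp add: has_real_derivative_iff_has_vector_derivative P_def)
  have d2: "((\<lambda>y. \<Phi> (x, y)) has_real_derivative ?D (x, y) (0, 1)) (at y)" if "(x, y) \<in> S" for x y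
    using has_derivative_along_line[of \<Phi> "?D (x, y)" "(x, 0)" y "(0, 1)"] smooth_on_has_derivative[OF \<Phi> that]
    by (simp add: has_real_derivative_iff_has_vector_derivative)
  have d3: "((\<lambda>y. P (x, y)) has_real_derivative ?Q (x, y)) (at y)" if "(x, y) \<in> S" for x y
    using has_derivative_along_line[of P "frechet_derivative P (at (x, y))" "(x, 0)" y "(0, 1)"]
      smooth_on_has_derivative[OF P that]
    by (simp add: has_real_derivative_iff_has_vector_derivative)
  \<comment> \<open>Obtained by writing \<open>\<Phi>\<close> as the integral of its x-derivative
    \<open>P\<close> and differentiating under the integral in y at c.\<close>
  have eq: "?D (s, c) (0, 1) = ?D (t - e0, c) (0, 1) + integral {t - e0..s} (\<lambda>x. ?Q (x, c))"
    if s: "s \<in> {t - e0..t + e0}" for s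
  proof -
    have cl: "c \<in> {c - e1..c + e1}" using e1(1) by simp
    have L: "((\<lambda>y. integral (cbox (t - e0) s) (\<lambda>x. P (x, y))) has_field_derivative
        integral (cbox (t - e0) s) (\<lambda>x. ?Q (x, c))) (at c within {c - e1..c + e1})"
    proof (rule leibniz_rule_field_derivative)
      fix y x assume yx: "y \<in> {c - e1..c + e1}" "x \<in> cbox (t - e0) s"
      then have "(x, y) \<in> S" using s by (intro inS) auto
      then show "((\<lambda>y. P (x, y)) has_real_derivative ?Q (x, y)) (at y within {c - e1..c + e1})"
        by (rule has_field_derivative_at_within[OF d3])
    next
      fix y assume "y \<in> {c - e1..c + e1}"
      then show "(\<lambda>x. P (x, y)) integrable_on cbox (t - e0) s"
        using s by (intro integrable_continuous continuous_on_compose2[OF smooth_on_continuous_on[OF P]])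
          (auto intro!: continuous_intros inS)
    next
      have "continuous_on ({c - e1..c + e1} \<times> cbox (t - e0) s) (\<lambda>p. ?Q (snd p, fst p))"
        using s by (intro continuous_on_compose2[OF Q]) (auto intro!: continuous_intros inS)
      then show "continuous_on ({c - e1..c + e1} \<times> cbox (t - e0) s) (\<lambda>(y, x). ?Q (x, y))"
        by (simp add: case_prod_unfold)
    qed (use cl in auto)
    have FT: "\<Phi> (s, y) = \<Phi> (t - e0, y) + integral (cbox (t - e0) s) (\<lambda>x. P (x, y))"
      if y: "y \<in> {c - e1..c + e1}" for y
    proof -
      have "((\<lambda>x. P (x, y)) has_integral (\<Phi> (s, y) - \<Phi> (t - e0, y))) {t - e0..s}"
      proof (rule fundamental_theorem_of_calculus)
        fix x assume "x \<in> {t - e0..s}"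
        then have "(x, y) \<in> S" using s y by (intro inS) auto
        then show "((\<lambda>x. \<Phi> (x, y)) has_vector_derivative P (x, y)) (at x within {t - e0..s})"
          by (rule has_vector_derivative_at_within[OF d1[unfolded has_real_derivative_iff_has_vector_derivative]])
      qed (use s in auto)
      then show ?thesis by (simp add: integral_unique)
    qed
    have "(t - e0, c) \<in> S" using e0(1) cl by (intro inS) auto
    then have "((\<lambda>y. \<Phi> (t - e0, y) + integral (cbox (t - e0) s) (\<lambda>x. P (x, y))) has_real_derivative
        ?D (t - e0, c) (0, 1) + integral (cbox (t - e0) s) (\<lambda>x. ?Q (x, c))) (at c within {c - e1..c + e1})"
      by (intro DERIV_add L has_field_derivative_at_within[OF d2])
    then have "((\<lambda>y. \<Phi> (s, y)) has_real_derivative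
        ?D (t - e0, c) (0, 1) + integral (cbox (t - e0) s) (\<lambda>x. ?Q (x, c))) (at c within {c - e1..c + e1})"
      by (rule has_field_derivative_transform_within[where d = 1]) (use FT cl in auto)
    then have "((\<lambda>y. \<Phi> (s, y)) has_real_derivative
        ?D (t - e0, c) (0, 1) + integral (cbox (t - e0) s) (\<lambda>x. ?Q (x, c))) (at c)"
      using e1(1) by (simp add: at_within_Icc_at)
    moreover have "(s, c) \<in> S" using s cl by (rule inS)
    ultimately show ?thesis using DERIV_unique[OF d2] by simp
  qed
  have "((\<lambda>s. integral {t - e0..s} (\<lambda>x. ?Q (x, c))) has_real_derivative ?Q (t, c)) (at t within {t - e0..t + e0})"
  proof (rule integral_has_real_derivative)
    show "continuous_on {t - e0..t + e0} (\<lambda>x. ?Q (x, c))"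
      by (intro continuous_on_compose2[OF Q]) (use e1(1) in \<open>auto intro!: continuous_intros inS\<close>)
  qed (use e0(1) in simp)
  then have "((\<lambda>s. ?D (t - e0, c) (0, 1) + integral {t - e0..s} (\<lambda>x. ?Q (x, c))) has_real_derivative
      0 + ?Q (t, c)) (at t within {t - e0..t + e0})"
    by (intro DERIV_add DERIV_const)
  then have "((\<lambda>s. ?D (s, c) (0, 1)) has_real_derivative 0 + ?Q (t, c)) (at t within {t - e0..t + e0})"
    by (rule has_field_derivative_transform_within[where d = 1]) (use e0(1) in \<open>auto simp: eq[symmetric]\<close>)
  then show ?thesis using e0(1) by (simp add: at_within_Icc_at)
qed

text \<open>Only two directions matter, time and \<open>w\<close>; restricting \<open>F\<close> to
  the plane (s, a + r w) reduces the claim to functions of two real variables.\<close>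

lemma mixed_partials:
  fixes F :: "real \<times> 'a::real_inner \<Rightarrow> real"
  assumes fd: "finite_dim TYPE('a)" and I: "open I" "open U"
    and F: "smooth_on (I \<times> U) F" and ta: "t \<in> I" "a \<in> U"
  shows "((\<lambda>s. frechet_derivative (\<lambda>u. F (s, u)) (at a) w) has_real_derivative
    frechet_derivative (\<lambda>u. frechet_derivative F (at (t, u)) (1, 0)) (at a) w) (at t)"
proof -
  define \<Phi> where "\<Phi> = (\<lambda>(s, r). F (s, a + r *\<^sub>R w))"
  define S where "S = (\<lambda>p::real \<times> real. (fst p, a + snd p *\<^sub>R w)) -` (I \<times> U)"
  have S: "open S" unfolding S_def
    by (intro open_vimage open_Times I continuous_intros)
  have sm: "smooth_on S (\<lambda>p. (fst p, a + snd p *\<^sub>R w))"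
    by (intro smooth_on_Pair smooth_on_add smooth_on_const smooth_on_scaleR S
        smooth_on_bounded_linear bounded_linear_fst bounded_linear_snd)
  have "smooth_on S (\<lambda>p. F (fst p, a + snd p *\<^sub>R w))"
    by (rule smooth_on_compose[OF finite_dim_prod[OF finite_dim_real fd] S open_Times[OF I] F sm])
      (auto simp: S_def)
  then have \<Phi>: "smooth_on S \<Phi>" by (simp add: \<Phi>_def case_prod_unfold)
  have t0: "(t, 0) \<in> S" using ta by (simp add: S_def)
  let ?D = "\<lambda>z. frechet_derivative F (at z)"
  define P where "P z = ?D z (1, 0)" for z
  have P: "smooth_on (I \<times> U) P" unfolding P_def by (rule smooth_on_frechet_derivative[OF F])
  have inner: "((\<lambda>p. (fst p, a + snd p *\<^sub>R w)) has_derivative (\<lambda>h. (fst h, snd h *\<^sub>R w))) (at p)" for p :: "real \<times> real"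
    by (auto intro!: derivative_eq_intros)
  have comp: "((\<lambda>p. H (fst p, a + snd p *\<^sub>R w)) has_derivative
      (\<lambda>h. frechet_derivative H (at (x, a + r *\<^sub>R w)) (fst h, snd h *\<^sub>R w))) (at (x, r))"
    if H: "smooth_on (I \<times> U) H" and xr: "(x, r) \<in> S" for H :: "real \<times> 'a \<Rightarrow> real" and x r
  proof -
    have "(x, a + r *\<^sub>R w) \<in> I \<times> U" using xr by (simp add: S_def)
    from has_derivative_compose[OF inner[of "(x, r)"], simplified, OF smooth_on_has_derivative[OF H this]]
    show ?thesis .
  qed
  have D\<Phi>: "frechet_derivative \<Phi> (at (x, r)) (h, k) = ?D (x, a + r *\<^sub>R w) (h, k *\<^sub>R w)" if "(x, r) \<in> S" for x r h k
    using frechet_derivative_at[OF comp[OF F that]] by (auto simp: \<Phi>_def case_prod_unfold dest: fun_cong[of _ _ "(h, k)"])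
  let ?P' = "\<lambda>z. frechet_derivative \<Phi> (at z) (1, 0)"
  have "((\<lambda>p. P (fst p, a + snd p *\<^sub>R w)) has_derivative
      (\<lambda>h. frechet_derivative P (at (t, a)) (fst h, snd h *\<^sub>R w))) (at (t, 0))"
    using comp[OF P t0] by simp
  then have "(?P' has_derivative (\<lambda>h. frechet_derivative P (at (t, a)) (fst h, snd h *\<^sub>R w))) (at (t, 0))"
    by (rule has_derivative_transform_within_open[OF _ S t0]) (auto simp: D\<Phi> P_def)
  then have DP': "frechet_derivative ?P' (at (t, 0)) (0, 1) = frechet_derivative P (at (t, a)) (0, w)"
    using frechet_derivative_at by (metis (no_types, lifting) fst_conv scaleR_one snd_conv)
  have slice: "((\<lambda>u. H (x, u)) has_derivative (\<lambda>v. frechet_derivative H (at (x, a)) (0, v))) (at a)"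
    if H: "smooth_on (I \<times> U) H" and x: "x \<in> I" for H :: "real \<times> 'a \<Rightarrow> real" and x
  proof -
    have "((\<lambda>u. (x, u)) has_derivative (\<lambda>v. (0, v))) (at a)" by (auto intro!: derivative_eq_intros)
    from has_derivative_compose[OF this smooth_on_has_derivative[OF H, of "(x, a)"]] x ta(2)
    show ?thesis by simp
  qed
  have "frechet_derivative (\<lambda>u. P (t, u)) (at a) w = frechet_derivative P (at (t, a)) (0, w)"
    using frechet_derivative_at[OF slice[OF P ta(1)]] by metis
  then have "((\<lambda>s. frechet_derivative \<Phi> (at (s, 0)) (0, 1)) has_real_derivative
    frechet_derivative (\<lambda>u. P (t, u)) (at a) w) (at t)"
    using mixed_partials_plane[OF S \<Phi> t0] DP' by simp
  then have "((\<lambda>s. frechet_derivative (\<lambda>u. F (s, u)) (at a) w) has_real_derivative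
    frechet_derivative (\<lambda>u. P (t, u)) (at a) w) (at t)"
  proof (rule has_field_derivative_transform_within_open[OF _ I(1) ta(1)])
    fix s assume s: "s \<in> I"
    then have "(s, 0) \<in> S" using ta by (simp add: S_def)
    then have "frechet_derivative \<Phi> (at (s, 0)) (0, 1) = ?D (s, a) (0, w)" by (simp add: D\<Phi>)
    also have "\<dots> = frechet_derivative (\<lambda>u. F (s, u)) (at a) w"
      using frechet_derivative_at[OF slice[OF F s]] by metis
    finally show "frechet_derivative \<Phi> (at (s, 0)) (0, 1) = frechet_derivative (\<lambda>u. F (s, u)) (at a) w" .
  qed
  then show ?thesis by (simp add: P_def)
qed

section \<open>Smooth functions on a manifold\<close>

locale smooth_mfd =
  fixes A :: "('m::{t2_space,second_countable_topology}, 'n::real_inner) atlas"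
  assumes mfd: "smooth_manifold A"
begin

lemma fd_model: "finite_dim TYPE('n)"
  using mfd by (simp add: smooth_manifold_def)

lemma chart_cover: obtains U \<phi> where "(U, \<phi>) \<in> A" "p \<in> U"
proof -
  have "p \<in> (\<Union>(U, \<phi>)\<in>A. U)" using mfd by (simp add: smooth_manifold_def)
  then show ?thesis using that by auto
qed

lemma chart:
  assumes "(U, \<phi>) \<in> A"
  shows chart_open: "open U" and chart_image_open: "open (\<phi> ` U)"
    and chart_homeo: "homeomorphism U (\<phi> ` U) \<phi> (inv_into U \<phi>)"
  using mfd assms unfolding smooth_manifold_def by fast+

lemma chart_inv: "(U, \<phi>) \<in> A \<Longrightarrow> q \<in> U \<Longrightarrow> inv_into U \<phi> (\<phi> q) = q"
  using homeomorphism_apply1[OF chart_homeo] by blast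

lemma chart_continuous: "(U, \<phi>) \<in> A \<Longrightarrow> continuous_on U \<phi>"
  using chart_homeo homeomorphism_cont1 by blast

lemma chart_transition:
  assumes "(U, \<phi>) \<in> A" "(V, \<theta>) \<in> A"
  shows "smooth_on (\<phi> ` (U \<inter> V)) (\<theta> \<circ> inv_into U \<phi>)"
  using mfd assms unfolding smooth_manifold_def by fast

lemma chart_open_map:
  assumes c: "(U, \<phi>) \<in> A" and W: "open W"
  shows "open (\<phi> ` (U \<inter> W))"
proof -
  have "continuous_on (\<phi> ` U) (inv_into U \<phi>)" using chart_homeo[OF c] homeomorphism_cont2 by blast
  then have "open (\<phi> ` U \<inter> inv_into U \<phi> -` W)"
    by (rule continuous_open_preimage[OF _ chart_image_open[OF c] W])
  moreover have "\<phi> ` U \<inter> inv_into U \<phi> -` W = \<phi> ` (U \<inter> W)"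
    using chart_inv[OF c] by auto
  ultimately show ?thesis by simp
qed

lemma chart_preimage_open: "(U, \<phi>) \<in> A \<Longrightarrow> open S \<Longrightarrow> open (U \<inter> \<phi> -` S)"
  by (rule continuous_open_preimage[OF chart_continuous chart_open])

lemma msmooth_onD: "msmooth_on A W f \<Longrightarrow> (U, \<phi>) \<in> A \<Longrightarrow> smooth_on (\<phi> ` (U \<inter> W)) (f \<circ> inv_into U \<phi>)"
  unfolding msmooth_on_def by blast

lemma msmooth_onI:
  "(\<And>U \<phi>. (U, \<phi>) \<in> A \<Longrightarrow> smooth_on (\<phi> ` (U \<inter> W)) (\<lambda>x. f (inv_into U \<phi> x))) \<Longrightarrow> msmooth_on A W f"
  unfolding msmooth_on_def comp_def by auto

text \<open>Smoothness has to be tested in every chart; composing with the smooth transition maps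
  reduces this to the one chart in which the function is given.\<close>

lemma msmooth_on_chart_comp:
  assumes c: "(V, \<theta>) \<in> A" and W: "open W" "W \<subseteq> V" and F: "smooth_on S F" "open S" "\<theta> ` W \<subseteq> S"
  shows "msmooth_on A W (\<lambda>q. F (\<theta> q))"
proof (rule msmooth_onI)
  fix U \<phi> assume c': "(U, \<phi>) \<in> A"
  have "smooth_on (\<phi> ` (U \<inter> W)) (\<theta> \<circ> inv_into U \<phi>)"
    by (rule smooth_on_subset[OF chart_transition[OF c' c]]) (use W in auto)
  moreover have "(\<theta> \<circ> inv_into U \<phi>) ` (\<phi> ` (U \<inter> W)) \<subseteq> S"
    using F(3) chart_inv[OF c'] by auto
  ultimately show "smooth_on (\<phi> ` (U \<inter> W)) (\<lambda>x. F (\<theta> (inv_into U \<phi> x)))"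
    using smooth_on_compose[OF fd_model chart_open_map[OF c' W(1)] F(2,1)] by (simp add: comp_def)
qed

lemma msmooth_on_cong:
  assumes "open W" "msmooth_on A W f" "\<And>q. q \<in> W \<Longrightarrow> f q = g q"
  shows "msmooth_on A W g"
proof (rule msmooth_onI)
  fix U \<phi> assume c: "(U, \<phi>) \<in> A"
  show "smooth_on (\<phi> ` (U \<inter> W)) (\<lambda>x. g (inv_into U \<phi> x))"
    by (rule smooth_on_cong[OF chart_open_map[OF c assms(1)] msmooth_onD[OF assms(2) c]])
      (use assms(3) chart_inv[OF c] in auto)
qed

lemma msmooth_on_subset: "msmooth_on A W f \<Longrightarrow> W' \<subseteq> W \<Longrightarrow> msmooth_on A W' f"
  by (rule msmooth_onI, rule smooth_on_subset[OF msmooth_onD[unfolded comp_def]]) auto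

lemma msmooth_on_local:
  assumes "\<And>p. p \<in> W \<Longrightarrow> \<exists>N. open N \<and> p \<in> N \<and> msmooth_on A N f"
  shows "msmooth_on A W f"
proof (rule msmooth_onI)
  fix U \<phi> assume c: "(U, \<phi>) \<in> A"
  show "smooth_on (\<phi> ` (U \<inter> W)) (\<lambda>x. f (inv_into U \<phi> x))"
  proof (rule smooth_on_local)
    fix x assume "x \<in> \<phi> ` (U \<inter> W)"
    then obtain p where p: "x = \<phi> p" "p \<in> U" "p \<in> W" by blast
    obtain N where N: "open N" "p \<in> N" "msmooth_on A N f" using assms[OF p(3)] by blast
    show "\<exists>T. open T \<and> x \<in> T \<and> smooth_on T (\<lambda>x. f (inv_into U \<phi> x))"
      using chart_open_map[OF c N(1)] msmooth_onD[OF N(3) c] p N(2) unfolding comp_def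
      by (intro exI[of _ "\<phi> ` (U \<inter> N)"]) auto
  qed
qed

lemma msmooth_on_const: "msmooth_on A W (\<lambda>q. c)"
  by (rule msmooth_onI) (rule smooth_on_const)

lemma msmooth_on_add:
  "open W \<Longrightarrow> msmooth_on A W f \<Longrightarrow> msmooth_on A W g \<Longrightarrow> msmooth_on A W (\<lambda>q. f q + g q)"
  by (rule msmooth_onI) (auto intro!: smooth_on_add chart_open_map dest: msmooth_onD simp: comp_def)

lemma msmooth_on_scaleR:
  "open W \<Longrightarrow> msmooth_on A W f \<Longrightarrow> msmooth_on A W g \<Longrightarrow> msmooth_on A W (\<lambda>q. f q *\<^sub>R g q)"
  by (rule msmooth_onI) (auto intro!: smooth_on_scaleR chart_open_map dest: msmooth_onD simp: comp_def)

lemma msmooth_on_mult: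
  fixes f g :: "'m \<Rightarrow> real"
  shows "open W \<Longrightarrow> msmooth_on A W f \<Longrightarrow> msmooth_on A W g \<Longrightarrow> msmooth_on A W (\<lambda>q. f q * g q)"
  using msmooth_on_scaleR[of W f g] by simp

lemma msmooth_on_inner_const:
  fixes f :: "'m \<Rightarrow> 'b::real_inner"
  shows "open W \<Longrightarrow> msmooth_on A W f \<Longrightarrow> msmooth_on A W (\<lambda>q. f q \<bullet> y)"
  by (rule msmooth_onI) (auto intro!: smooth_on_inner smooth_on_const chart_open_map dest: msmooth_onD simp: comp_def)

lemma msmooth_on_sum:
  "open W \<Longrightarrow> (\<And>i. i \<in> K \<Longrightarrow> msmooth_on A W (f i)) \<Longrightarrow> msmooth_on A W (\<lambda>q. \<Sum>i\<in>K. f i q)"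
  by (induction K rule: infinite_finite_induct) (auto intro!: msmooth_on_const msmooth_on_add)

lemma msmooth_on_diff:
  fixes f g :: "'m \<Rightarrow> real"
  assumes "open W" "msmooth_on A W f" "msmooth_on A W g"
  shows "msmooth_on A W (\<lambda>q. f q - g q)"
  using msmooth_on_add[OF assms(1,2) msmooth_on_mult[OF assms(1) msmooth_on_const[of W "-1"] assms(3)]] by simp

lemma msmooth_on_Complex:
  assumes "open W" "msmooth_on A W f" "msmooth_on A W g"
  shows "msmooth_on A W (\<lambda>q. Complex (f q) (g q))"
  using msmooth_on_add[OF assms(1) msmooth_on_scaleR[OF assms(1,2) msmooth_on_const[of W 1]]
      msmooth_on_scaleR[OF assms(1,3) msmooth_on_const[of W \<i>]]]
  by (simp add: complex_eq_iff Complex_eq scaleR_conv_of_real mult.commute)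

section \<open>Extension by zero and bump functions\<close>

lemma msmooth_on_extend_zero:
  assumes "open W" "msmooth_on A W f" "closed K" "K \<subseteq> W" "\<And>q. q \<notin> K \<Longrightarrow> f q = 0"
  shows "msmooth_on A UNIV f"
proof (rule msmooth_on_local)
  fix p
  show "\<exists>N. open N \<and> p \<in> N \<and> msmooth_on A N f"
  proof (cases "p \<in> K")
    case True
    then show ?thesis using assms by blast
  next
    case False
    have "msmooth_on A (- K) f"
      by (rule msmooth_on_cong[OF _ msmooth_on_const[of _ 0]]) (use assms in auto)
    then show ?thesis using False assms(3) by (intro exI[of _ "- K"]) auto
  qed
qed

text \<open>A radial cut-off in a chart, extended by zero. The extension is smooth because
  \<open>K\<close>, the image of a compact ball, is compact and therefore closed in the Hausdorff
  space \<open>'m\<close>. Having the value 1 on a whole neighbourhood \<open>N\<close> makes all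
  derivatives at p vanish as well.\<close>

lemma bump_function:
  assumes W: "open W" "p \<in> W"
  obtains \<beta> :: "'m \<Rightarrow> real" and K N
  where "msmooth_on A UNIV \<beta>" "closed K" "K \<subseteq> W" "\<And>q. q \<notin> K \<Longrightarrow> \<beta> q = 0"
    "open N" "p \<in> N" "N \<subseteq> W" "\<And>q. q \<in> N \<Longrightarrow> \<beta> q = 1"
proof -
  obtain U \<phi> where c: "(U, \<phi>) \<in> A" "p \<in> U" by (rule chart_cover)
  have "open (\<phi> ` (U \<inter> W))" "\<phi> p \<in> \<phi> ` (U \<inter> W)" using chart_open_map[OF c(1) W(1)] c W by auto
  then obtain r where r: "r > 0" "cball (\<phi> p) r \<subseteq> \<phi> ` (U \<inter> W)"
    using open_contains_cball by blast
  obtain h :: "real \<Rightarrow> real" where h: "smooth_on UNIV h" "\<And>x. x \<le> 1 \<Longrightarrow> h x = 1" "\<And>x. x \<ge> 2 \<Longrightarrow> h x = 0"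
    using smooth_step by metis
  \<comment> \<open>The argument of \<open>h\<close> is 2 times the squared distance divided by r
    squared: at least 2 outside the ball of radius r, where \<open>h\<close> is 0, and at most 1/2
    on the ball of radius r/2, where \<open>h\<close> is 1.\<close>
  define F where "F x = h ((2 / r\<^sup>2) * ((x - \<phi> p) \<bullet> (x - \<phi> p)))" for x
  have F: "smooth_on UNIV F" unfolding F_def
    by (rule smooth_on_compose[OF finite_dim_real open_UNIV open_UNIV h(1) _ subset_UNIV])
      (intro smooth_on_mult smooth_on_const smooth_on_inner smooth_on_diff smooth_on_id open_UNIV)
  have F0: "F x = 0" if "x \<notin> cball (\<phi> p) r" for x
  proof -
    have "r \<le> norm (x - \<phi> p)" using that by (simp add: dist_norm norm_minus_commute)
    then have "r\<^sup>2 \<le> (norm (x - \<phi> p))\<^sup>2" using r(1) by (intro power_mono) auto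
    then have "2 \<le> (2 / r\<^sup>2) * ((x - \<phi> p) \<bullet> (x - \<phi> p))"
      using r(1) by (simp add: power2_norm_eq_inner field_simps)
    then show ?thesis unfolding F_def by (rule h(3))
  qed
  have F1: "F x = 1" if "x \<in> ball (\<phi> p) (r / 2)" for x
  proof -
    have "norm (x - \<phi> p) \<le> r / 2" using that by (simp add: dist_norm norm_minus_commute)
    then have "(norm (x - \<phi> p))\<^sup>2 \<le> (r / 2)\<^sup>2" by (intro power_mono) auto
    then have "4 * ((x - \<phi> p) \<bullet> (x - \<phi> p)) \<le> r\<^sup>2"
      by (simp add: power2_norm_eq_inner field_simps)
    then have "2 * ((x - \<phi> p) \<bullet> (x - \<phi> p)) \<le> r\<^sup>2"
      using inner_ge_zero[of "x - \<phi> p"] by linarith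
    then have "(2 / r\<^sup>2) * ((x - \<phi> p) \<bullet> (x - \<phi> p)) \<le> 1"
      using r(1) by (simp add: field_simps)
    then show ?thesis unfolding F_def by (rule h(2))
  qed
  define K where "K = inv_into U \<phi> ` cball (\<phi> p) r"
  define \<beta> where "\<beta> q = (if q \<in> U then F (\<phi> q) else 0)" for q
  define N where "N = (U \<inter> \<phi> -` ball (\<phi> p) (r / 2)) \<inter> W"
  obtain B :: "'n set" where B: "parseval_frame B" using fd_model finite_dim_frame_iff by blast
  have "continuous_on (\<phi> ` U) (inv_into U \<phi>)" using chart_homeo[OF c(1)] homeomorphism_cont2 by blast
  then have "continuous_on (cball (\<phi> p) r) (inv_into U \<phi>)"
    by (rule continuous_on_subset) (use r(2) in auto)
  then have "compact K" unfolding K_def by (rule compact_continuous_image[OF _ frame_compact_cball[OF B]])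
  then have K: "closed K" by (rule compact_imp_closed)
  have KW: "K \<subseteq> U \<inter> W" unfolding K_def using r(2) chart_inv[OF c(1)] by fastforce
  have \<beta>0: "\<beta> q = 0" if "q \<notin> K" for q
  proof (cases "q \<in> U")
    case True
    then have "\<phi> q \<notin> cball (\<phi> p) r"
      using that chart_inv[OF c(1) True] unfolding K_def by (metis imageI)
    then show ?thesis by (simp add: \<beta>_def F0)
  qed (simp add: \<beta>_def)
  have "msmooth_on A U (\<lambda>q. F (\<phi> q))"
    by (rule msmooth_on_chart_comp[OF c(1) chart_open[OF c(1)] _ F]) auto
  then have "msmooth_on A U \<beta>"
    by (rule msmooth_on_cong[OF chart_open[OF c(1)]]) (simp add: \<beta>_def)
  then have "msmooth_on A UNIV \<beta>"
    by (rule msmooth_on_extend_zero[OF chart_open[OF c(1)] _ K _ \<beta>0]) (use KW in auto)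
  moreover have "open N" unfolding N_def
    by (intro open_Int chart_preimage_open[OF c(1)] W(1) open_ball)
  moreover have "p \<in> N" "N \<subseteq> W" using c W r by (auto simp: N_def)
  moreover have "\<beta> q = 1" if "q \<in> N" for q using that by (auto simp: N_def \<beta>_def F1)
  ultimately show ?thesis using that K KW \<beta>0 by blast
qed

lemma msmooth_on_times_cutoff:
  assumes "open W" "msmooth_on A W f" "msmooth_on A UNIV \<beta>" "closed K" "K \<subseteq> W" "\<And>q. q \<notin> K \<Longrightarrow> \<beta> q = 0"
  shows "msmooth_on A UNIV (\<lambda>q. \<beta> q *\<^sub>R f q)"
proof (rule msmooth_on_extend_zero[OF assms(1) _ assms(4,5)])
  show "msmooth_on A W (\<lambda>q. \<beta> q *\<^sub>R f q)"
    by (rule msmooth_on_scaleR[OF assms(1) msmooth_on_subset[OF assms(3) subset_UNIV] assms(2)])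
qed (simp add: assms(6))

section \<open>Tangent vectors\<close>

lemma smooth_nearI: "open W \<Longrightarrow> p \<in> W \<Longrightarrow> msmooth_on A W f \<Longrightarrow> smooth_near A p f"
  unfolding smooth_near_def by blast

lemma smooth_near_const: "smooth_near A p (\<lambda>q. c)"
  by (rule smooth_nearI[OF open_UNIV UNIV_I msmooth_on_const])

lemma smooth_near_lin:
  assumes "smooth_near A p f" "smooth_near A p g"
  shows "smooth_near A p (\<lambda>q. c * f q + d * g q)" "smooth_near A p (\<lambda>q. f q * g q)"
proof -
  obtain V W where VW: "open V" "p \<in> V" "msmooth_on A V f" "open W" "p \<in> W" "msmooth_on A W g"
    using assms unfolding smooth_near_def by blast
  have o: "open (V \<inter> W)" "p \<in> V \<inter> W" using VW by auto
  have f: "msmooth_on A (V \<inter> W) f" by (rule msmooth_on_subset[OF VW(3)]) simp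
  have g: "msmooth_on A (V \<inter> W) g" by (rule msmooth_on_subset[OF VW(6)]) simp
  show "smooth_near A p (\<lambda>q. c * f q + d * g q)" "smooth_near A p (\<lambda>q. f q * g q)"
    by (rule smooth_nearI[OF o], intro msmooth_on_add msmooth_on_mult o(1) msmooth_on_const f g)+
qed

lemma smooth_near_add: "smooth_near A p f \<Longrightarrow> smooth_near A p g \<Longrightarrow> smooth_near A p (\<lambda>q. f q + g q)"
  using smooth_near_lin(1)[of p f g 1 1] by simp

lemma smooth_near_sum:
  "(\<And>i. i \<in> K \<Longrightarrow> smooth_near A p (f i)) \<Longrightarrow> smooth_near A p (\<lambda>q. \<Sum>i\<in>K. f i q)"
  by (induction K rule: infinite_finite_induct) (auto intro!: smooth_near_const smooth_near_add)

context
  fixes p X assumes X: "X \<in> tangent_space A p"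
begin

lemma tangent_lin:
  "smooth_near A p f \<Longrightarrow> smooth_near A p g \<Longrightarrow> X (\<lambda>q. c * f q + d * g q) = c * X f + d * X g"
  using X unfolding tangent_space_def by blast

lemma tangent_mult:
  "smooth_near A p f \<Longrightarrow> smooth_near A p g \<Longrightarrow> X (\<lambda>q. f q * g q) = f p * X g + g p * X f"
  using X unfolding tangent_space_def by blast

lemma tangent_cong_ev:
  "smooth_near A p f \<Longrightarrow> smooth_near A p g \<Longrightarrow> (\<forall>\<^sub>F q in nhds p. f q = g q) \<Longrightarrow> X f = X g"
  using X unfolding tangent_space_def by blast

lemma tangent_cong:
  assumes "msmooth_on A W f" "open W" "p \<in> W" "\<And>q. q \<in> W \<Longrightarrow> f q = g q"
  shows "X f = X g"
proof (rule tangent_cong_ev)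
  show "smooth_near A p f" by (rule smooth_nearI[OF assms(2,3,1)])
  show "smooth_near A p g" by (rule smooth_nearI[OF assms(2,3) msmooth_on_cong[OF assms(2,1,4)]])
  show "\<forall>\<^sub>F q in nhds p. f q = g q" using assms unfolding eventually_nhds by blast
qed

lemma tangent_const: "X (\<lambda>q. c) = 0"
proof -
  have "X (\<lambda>q. 1) = 0" using tangent_mult[OF smooth_near_const smooth_near_const, of 1 1] by simp
  then show ?thesis using tangent_lin[OF smooth_near_const smooth_near_const, of c 1 0 1] by simp
qed

lemma tangent_add: "smooth_near A p f \<Longrightarrow> smooth_near A p g \<Longrightarrow> X (\<lambda>q. f q + g q) = X f + X g"
  using tangent_lin[of f g 1 1] by simp

lemma tangent_diff: "smooth_near A p f \<Longrightarrow> smooth_near A p g \<Longrightarrow> X (\<lambda>q. f q - g q) = X f - X g"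
  using tangent_lin[of f g 1 "-1"] by simp

lemma tangent_sum:
  "(\<And>i. i \<in> K \<Longrightarrow> smooth_near A p (f i)) \<Longrightarrow> X (\<lambda>q. \<Sum>i\<in>K. f i q) = (\<Sum>i\<in>K. X (f i))"
  by (induction K rule: infinite_finite_induct) (simp_all add: tangent_const tangent_add smooth_near_sum)

text \<open>By Hadamard's lemma f is, near p, a constant plus a sum of products whose first factor,
  the b-component of \<phi> q - \<phi> p, vanishes at p. The product rule then leaves only the value
  of the second factor at p, a partial derivative, times the action of X on a coordinate. The
  abstract derivation thus becomes a fixed directional derivative.\<close>

lemma tangent_in_chart:
  assumes c: "(U, \<phi>) \<in> A" "p \<in> U" and f: "smooth_near A p f" and B: "parseval_frame B"
  shows "X f = (\<Sum>b\<in>B. frechet_derivative (\<lambda>x. f (inv_into U \<phi> x)) (at (\<phi> p)) b * X (\<lambda>q. \<phi> q \<bullet> b))"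
proof -
  obtain W where W: "open W" "p \<in> W" "msmooth_on A W f" using f unfolding smooth_near_def by blast
  define F where "F = (\<lambda>x. f (inv_into U \<phi> x))"
  have "open (\<phi> ` (U \<inter> W))" "\<phi> p \<in> \<phi> ` (U \<inter> W)" using chart_open_map[OF c(1) W(1)] c W by auto
  then obtain r where r: "r > 0" "ball (\<phi> p) r \<subseteq> \<phi> ` (U \<inter> W)" using open_contains_ball by blast
  have "smooth_on (\<phi> ` (U \<inter> W)) F" using msmooth_onD[OF W(3) c(1)] by (simp add: F_def comp_def)
  then have F: "smooth_on (ball (\<phi> p) r) F" by (rule smooth_on_subset[OF _ r(2)])
  obtain g where g: "\<And>b. smooth_on (ball (\<phi> p) r) (g b)"
    "\<And>u. u \<in> ball (\<phi> p) r \<Longrightarrow> F u = F (\<phi> p) + (\<Sum>b\<in>B. ((u - \<phi> p) \<bullet> b) * g b u)"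
    "\<And>b. g b (\<phi> p) = frechet_derivative F (at (\<phi> p)) b"
    using hadamard[OF B F r(1)] by blast
  \<comment> \<open>The chart is injective on \<open>U\<close>, so this preimage of the ball also
    lies in \<open>W\<close>, where f is smooth.\<close>
  define N where "N = U \<inter> \<phi> -` ball (\<phi> p) r"
  have N: "open N" "p \<in> N" "N \<subseteq> U" "\<phi> ` N \<subseteq> ball (\<phi> p) r" "N \<subseteq> W"
  proof -
    show "open N" unfolding N_def by (intro chart_preimage_open c open_ball)
    show "N \<subseteq> W"
    proof
      fix q assume q: "q \<in> N"
      then have "\<phi> q \<in> \<phi> ` (U \<inter> W)" using r(2) by (auto simp: N_def)
      then obtain q' where "q' \<in> U" "q' \<in> W" "\<phi> q = \<phi> q'" by auto
      then have "q = q'" using q chart_inv[OF c(1)] unfolding N_def by (metis IntD1)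
      then show "q \<in> W" using \<open>q' \<in> W\<close> by simp
    qed
  qed (use c r in \<open>auto simp: N_def\<close>)
  have sg: "smooth_near A p (\<lambda>q. g b (\<phi> q))" for b
    by (rule smooth_nearI[OF N(1,2) msmooth_on_chart_comp[OF c(1) N(1,3) g(1) open_ball N(4)]])
  have s\<phi>: "smooth_near A p (\<lambda>q. \<phi> q \<bullet> b)" for b
    by (rule smooth_nearI[OF N(1,2) msmooth_on_chart_comp[OF c(1) N(1,3) _ open_UNIV subset_UNIV]])
      (intro smooth_on_inner smooth_on_id smooth_on_const open_UNIV)
  have s\<phi>': "smooth_near A p (\<lambda>q. (\<phi> q - \<phi> p) \<bullet> b)" for b
    using smooth_near_lin(1)[OF s\<phi>[of b] smooth_near_const[of p "\<phi> p \<bullet> b"], of 1 "-1"]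
    by (simp add: inner_diff_left)
  have X\<phi>: "X (\<lambda>q. (\<phi> q - \<phi> p) \<bullet> b) = X (\<lambda>q. \<phi> q \<bullet> b)" for b
    using tangent_diff[OF s\<phi>[of b] smooth_near_const[of p "\<phi> p \<bullet> b"]]
    by (simp add: inner_diff_left tangent_const)
  have "X f = X (\<lambda>q. F (\<phi> p) + (\<Sum>b\<in>B. ((\<phi> q - \<phi> p) \<bullet> b) * g b (\<phi> q)))"
  proof (rule tangent_cong[OF msmooth_on_subset[OF W(3) N(5)] N(1,2)])
    fix q assume q: "q \<in> N"
    then have "f q = F (\<phi> q)" using chart_inv[OF c(1)] N(3) by (auto simp: F_def)
    then show "f q = F (\<phi> p) + (\<Sum>b\<in>B. ((\<phi> q - \<phi> p) \<bullet> b) * g b (\<phi> q))"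
      using g(2)[of "\<phi> q"] q by (simp add: N_def)
  qed
  also have "\<dots> = (\<Sum>b\<in>B. X (\<lambda>q. ((\<phi> q - \<phi> p) \<bullet> b) * g b (\<phi> q)))"
    by (simp add: tangent_add[OF smooth_near_const smooth_near_sum] tangent_sum tangent_const
        smooth_near_lin(2)[OF s\<phi>' sg])
  also have "\<dots> = (\<Sum>b\<in>B. frechet_derivative F (at (\<phi> p)) b * X (\<lambda>q. \<phi> q \<bullet> b))"
    by (rule sum.cong) (simp_all add: tangent_mult[OF s\<phi>' sg] g(3) X\<phi>)
  finally show ?thesis by (simp add: F_def)
qed

text \<open>In a chart \<open>X\<close> is a directional derivative, so this is the symmetry of mixed partial
  derivatives.\<close>

lemma tangent_param_derivative:
  assumes c: "(U, \<phi>) \<in> A" and I: "open I" "t \<in> I" and N: "open N" "p \<in> N" "N \<subseteq> U"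
    and F: "smooth_on (I \<times> \<phi> ` N) F"
    and f: "\<And>s q. s \<in> I \<Longrightarrow> q \<in> N \<Longrightarrow> f s q = F (s, \<phi> q)"
    and f': "\<And>q. q \<in> N \<Longrightarrow> f' q = frechet_derivative F (at (t, \<phi> q)) (1, 0)"
  shows "((\<lambda>s. X (f s)) has_real_derivative X f') (at t)"
proof -
  obtain B :: "'n set" where B: "parseval_frame B" using fd_model finite_dim_frame_iff by blast
  have NU: "U \<inter> N = N" using N by auto
  have op: "open (\<phi> ` N)" using chart_open_map[OF c N(1)] by (simp add: NU)
  have p: "p \<in> U" "\<phi> p \<in> \<phi> ` N" using N by auto
  have inv: "inv_into U \<phi> (\<phi> q) = q" if "q \<in> N" for q using chart_inv[OF c] that N by auto
  \<comment> \<open>A function \<open>h\<close> that equals \<open>H\<close> in chart coordinates on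
    \<open>N\<close> agrees with it only locally; this suffices both for smoothness near p and for
    the derivative at \<phi> p.\<close>
  have key: "smooth_near A p h \<and> frechet_derivative (\<lambda>x. h (inv_into U \<phi> x)) (at (\<phi> p)) = frechet_derivative H (at (\<phi> p))"
    if H: "smooth_on (\<phi> ` N) H" and h: "\<And>q. q \<in> N \<Longrightarrow> h q = H (\<phi> q)" for h H
  proof
    have "msmooth_on A N (\<lambda>q. H (\<phi> q))" by (rule msmooth_on_chart_comp[OF c N(1,3) H op subset_refl])
    then have "msmooth_on A N h" by (rule msmooth_on_cong[OF N(1)]) (simp add: h)
    then show "smooth_near A p h" by (rule smooth_nearI[OF N(1,2)])
    have "(H has_derivative frechet_derivative H (at (\<phi> p))) (at (\<phi> p))"
      by (rule smooth_on_has_derivative[OF H p(2)])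
    then have "((\<lambda>x. h (inv_into U \<phi> x)) has_derivative frechet_derivative H (at (\<phi> p))) (at (\<phi> p))"
      by (rule has_derivative_transform_within_open[OF _ op p(2)]) (auto simp: h inv)
    then show "frechet_derivative (\<lambda>x. h (inv_into U \<phi> x)) (at (\<phi> p)) = frechet_derivative H (at (\<phi> p))"
      using frechet_derivative_at by metis
  qed
  have Fs: "smooth_on (\<phi> ` N) (\<lambda>u. H (s, u))" if "smooth_on (I \<times> \<phi> ` N) H" "s \<in> I" for H :: "real \<times> 'n \<Rightarrow> real" and s
    by (rule smooth_on_compose[OF finite_dim_prod[OF finite_dim_real fd_model] op open_Times[OF I(1) op] that(1)])
      (use that(2) in \<open>auto intro!: smooth_on_Pair smooth_on_const smooth_on_id op\<close>)
  let ?F' = "\<lambda>u. frechet_derivative F (at (t, u)) (1, 0)"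
  have F': "smooth_on (\<phi> ` N) ?F'"
    by (rule Fs[OF smooth_on_frechet_derivative[OF F] I(2)])
  have "((\<lambda>s. \<Sum>b\<in>B. frechet_derivative (\<lambda>u. F (s, u)) (at (\<phi> p)) b * X (\<lambda>q. \<phi> q \<bullet> b)) has_real_derivative
      (\<Sum>b\<in>B. frechet_derivative ?F' (at (\<phi> p)) b * X (\<lambda>q. \<phi> q \<bullet> b))) (at t)"
    by (intro DERIV_sum DERIV_cmult_right mixed_partials[OF fd_model I(1) op F I(2) p(2)])
  moreover have "(\<Sum>b\<in>B. frechet_derivative ?F' (at (\<phi> p)) b * X (\<lambda>q. \<phi> q \<bullet> b)) = X f'"
    using key[OF F' f'] tangent_in_chart[OF c p(1) _ B, of f'] by simp
  ultimately have "((\<lambda>s. \<Sum>b\<in>B. frechet_derivative (\<lambda>u. F (s, u)) (at (\<phi> p)) b * X (\<lambda>q. \<phi> q \<bullet> b))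
      has_real_derivative X f') (at t)" by simp
  then show ?thesis
  proof (rule has_field_derivative_transform_within_open[OF _ I])
    fix s assume s: "s \<in> I"
    show "(\<Sum>b\<in>B. frechet_derivative (\<lambda>u. F (s, u)) (at (\<phi> p)) b * X (\<lambda>q. \<phi> q \<bullet> b)) = X (f s)"
      using key[OF Fs[OF F s] f[OF s]] tangent_in_chart[OF c p(1) _ B, of "f s"] by simp
  qed
qed

end

end

section \<open>Vector bundles\<close>

lemma linear_between_sum:
  assumes h: "linear_between S T h" and S: "subspace S" and f: "\<And>i. i \<in> K \<Longrightarrow> f i \<in> S" and K: "finite K"
  shows "h (\<Sum>i\<in>K. c i *\<^sub>R f i) = (\<Sum>i\<in>K. c i *\<^sub>R h (f i))"
proof -
  have lin: "h (c *\<^sub>R v + d *\<^sub>R w) = c *\<^sub>R h v + d *\<^sub>R h w" if "v \<in> S" "w \<in> S" for v w c d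
    using h that by (simp add: linear_between_def)
  have h0: "h 0 = 0" using lin[OF subspace_0[OF S] subspace_0[OF S], of 0 0] by simp
  show ?thesis
    using K f
  proof (induction K rule: finite_induct)
    case (insert i K)
    have "(\<Sum>i\<in>K. c i *\<^sub>R f i) \<in> S" using insert by (auto intro!: subspace_sum subspace_scale S)
    from lin[OF insert.prems[of i] this, of "c i" 1] show ?case using insert by simp
  qed (simp add: h0)
qed

lemma linear_between_simps:
  assumes h: "linear_between S T h" and S: "subspace S" and v: "v \<in> S" "w \<in> S"
  shows "h (v + w) = h v + h w" "h (v - w) = h v - h w" "h (- v) = - h v" "h (c *\<^sub>R v) = c *\<^sub>R h v"
    "h 0 = 0"
proof -
  have lin: "h (c *\<^sub>R v + d *\<^sub>R w) = c *\<^sub>R h v + d *\<^sub>R h w" if "v \<in> S" "w \<in> S" for v w c d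
    using h that by (simp add: linear_between_def)
  show "h (v + w) = h v + h w" "h (v - w) = h v - h w" "h (- v) = - h v" "h (c *\<^sub>R v) = c *\<^sub>R h v" "h 0 = 0"
    using lin[OF v, of 1 1] lin[OF v, of 1 "-1"] lin[OF v, of "-1" 0] lin[OF v, of c 0] lin[OF v, of 0 0]
    by simp_all
qed

lemma linear_between_mem: "linear_between S T h \<Longrightarrow> v \<in> S \<Longrightarrow> h v \<in> T"
  unfolding linear_between_def by blast

locale vec_bundle = smooth_mfd A
  for A :: "('m::{t2_space,second_countable_topology}, 'n::real_inner) atlas" +
  fixes F :: "('m, 'v::real_vector, 'k::real_inner, 'z) vbundle_scheme"
  assumes vb: "vector_bundle A F"
begin

lemma fd_fibre: "finite_dim TYPE('k)"
  using vb by (simp add: vector_bundle_def)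

lemma fibre_subspace: "subspace (fibre F p)"
  using vb by (simp add: vector_bundle_def)

lemma triv_cover: obtains U \<psi> where "(U, \<psi>) \<in> trivs F" "p \<in> U"
proof -
  have "p \<in> (\<Union>(U, \<psi>)\<in>trivs F. U)" using vb by (simp add: vector_bundle_def)
  then show ?thesis using that by auto
qed

lemma triv_open: "(U, \<psi>) \<in> trivs F \<Longrightarrow> open U"
  using vb unfolding vector_bundle_def by fast

lemma triv_linear: "(U, \<psi>) \<in> trivs F \<Longrightarrow> p \<in> U \<Longrightarrow> linear_between (fibre F p) UNIV (\<psi> p)"
  using vb unfolding vector_bundle_def by fast

lemma triv_bij: "(U, \<psi>) \<in> trivs F \<Longrightarrow> p \<in> U \<Longrightarrow> bij_betw (\<psi> p) (fibre F p) UNIV"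
  using vb unfolding vector_bundle_def by fast

lemma triv_transition:
  "(U, \<psi>) \<in> trivs F \<Longrightarrow> (V, \<theta>) \<in> trivs F \<Longrightarrow> msmooth_on A (U \<inter> V) (\<lambda>p. \<theta> p (triv_inv F \<psi> p x))"
  using vb unfolding vector_bundle_def by fast

context
  fixes U \<psi> p assumes tr: "(U, \<psi>) \<in> trivs F" "p \<in> U"
begin

lemma triv_inv_mem: "triv_inv F \<psi> p x \<in> fibre F p"
  using triv_bij[OF tr] by (metis UNIV_I bij_betw_imp_surj_on inv_into_into)

lemma triv_triv_inv: "\<psi> p (triv_inv F \<psi> p x) = x"
  using triv_bij[OF tr] by (metis UNIV_I bij_betw_imp_surj_on f_inv_into_f)

lemma triv_inv_triv: "v \<in> fibre F p \<Longrightarrow> triv_inv F \<psi> p (\<psi> p v) = v"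
  using triv_bij[OF tr] by (simp add: bij_betw_def inv_into_f_f)

lemma triv_inj: "v \<in> fibre F p \<Longrightarrow> w \<in> fibre F p \<Longrightarrow> \<psi> p v = \<psi> p w \<Longrightarrow> v = w"
  using triv_inv_triv by metis

lemma linear_triv_inv: "linear (triv_inv F \<psi> p)"
proof -
  note ls = linear_between_simps[OF triv_linear[OF tr] fibre_subspace]
  note ss = subspace_add[OF fibre_subspace] subspace_scale[OF fibre_subspace]
  show ?thesis
  proof (rule linearI)
    show "triv_inv F \<psi> p (x + y) = triv_inv F \<psi> p x + triv_inv F \<psi> p y" for x y
      by (rule triv_inj) (simp_all add: triv_inv_mem ss ls(1) triv_triv_inv)
    show "triv_inv F \<psi> p (c *\<^sub>R x) = c *\<^sub>R triv_inv F \<psi> p x" for x c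
      by (rule triv_inj) (simp_all add: triv_inv_mem ss ls(4)[OF triv_inv_mem triv_inv_mem] triv_triv_inv)
  qed
qed

lemma triv_expand:
  assumes "parseval_frame B" "v \<in> fibre F p"
  shows "v = (\<Sum>b\<in>B. (\<psi> p v \<bullet> b) *\<^sub>R triv_inv F \<psi> p b)"
  using frame_linear[OF assms(1) linear_triv_inv, of "\<psi> p v"] triv_inv_triv[OF assms(2)] by simp

text \<open>This turns smooth matrix entries into smooth values: the smoothness proofs for sections,
  bundle maps, metrics and families rewrite a fibrewise linear map applied to a section as this
  finite sum.\<close>

lemma linear_between_triv_expand:
  assumes "parseval_frame B" "v \<in> fibre F p" "linear_between (fibre F p) T h"
  shows "h v = (\<Sum>b\<in>B. (\<psi> p v \<bullet> b) *\<^sub>R h (triv_inv F \<psi> p b))"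
  using linear_between_sum[OF assms(3) fibre_subspace triv_inv_mem frame_finite[OF assms(1)], of "\<lambda>b. \<psi> p v \<bullet> b" "\<lambda>b. b"]
    triv_expand[OF assms(1,2)] by simp

end

section \<open>Smooth sections\<close>

lemma section_mem: "s \<in> sections A F \<Longrightarrow> s p \<in> fibre F p"
  unfolding sections_def by blast

lemma section_smooth: "s \<in> sections A F \<Longrightarrow> (U, \<psi>) \<in> trivs F \<Longrightarrow> msmooth_on A U (\<lambda>p. \<psi> p (s p))"
  unfolding sections_def by blast

text \<open>Membership in \<open>sections\<close> asks for smoothness in all trivialisations; since
  the transition functions are smooth, one trivialisation near each point is enough.\<close>

lemma sectionI:
  assumes mem: "\<And>p. s p \<in> fibre F p"
    and loc: "\<And>p. \<exists>U \<psi> N. (U, \<psi>) \<in> trivs F \<and> open N \<and> p \<in> N \<and> N \<subseteq> U \<and> msmooth_on A N (\<lambda>q. \<psi> q (s q))"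
  shows "s \<in> sections A F"
proof -
  obtain B :: "'k set" where B: "parseval_frame B" using fd_fibre finite_dim_frame_iff by blast
  have "msmooth_on A V (\<lambda>p. \<theta> p (s p))" if V: "(V, \<theta>) \<in> trivs F" for V \<theta>
  proof (rule msmooth_on_local)
    fix p assume p: "p \<in> V"
    obtain U \<psi> N where N: "(U, \<psi>) \<in> trivs F" "open N" "p \<in> N" "N \<subseteq> U" "msmooth_on A N (\<lambda>q. \<psi> q (s q))"
      using loc by blast
    have o: "open (N \<inter> V)" using N(2) triv_open[OF V] by blast
    have "msmooth_on A (N \<inter> V) (\<lambda>q. \<Sum>b\<in>B. (\<psi> q (s q) \<bullet> b) *\<^sub>R \<theta> q (triv_inv F \<psi> q b))"
      by (intro msmooth_on_sum msmooth_on_scaleR msmooth_on_inner_const o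
          msmooth_on_subset[OF N(5)] msmooth_on_subset[OF triv_transition[OF N(1) V]]) (use N(4) in auto)
    then have "msmooth_on A (N \<inter> V) (\<lambda>q. \<theta> q (s q))"
    proof (rule msmooth_on_cong[OF o])
      fix q assume q: "q \<in> N \<inter> V"
      then have "q \<in> U" "q \<in> V" using N(4) by auto
      from linear_between_triv_expand[OF N(1) this(1) B mem triv_linear[OF V this(2)]]
      show "(\<Sum>b\<in>B. (\<psi> q (s q) \<bullet> b) *\<^sub>R \<theta> q (triv_inv F \<psi> q b)) = \<theta> q (s q)" by simp
    qed
    then show "\<exists>N. open N \<and> p \<in> N \<and> msmooth_on A N (\<lambda>p. \<theta> p (s p))" using o N(3) p by blast
  qed
  then show ?thesis using mem unfolding sections_def by blast
qed

lemma section_add: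
  assumes "s \<in> sections A F" "s' \<in> sections A F"
  shows "(\<lambda>p. s p + s' p) \<in> sections A F"
proof (rule sectionI)
  note m = section_mem[OF assms(1)] section_mem[OF assms(2)]
  fix p
  show "s p + s' p \<in> fibre F p" by (intro subspace_add fibre_subspace m)
  obtain U \<psi> where U: "(U, \<psi>) \<in> trivs F" "p \<in> U" by (rule triv_cover)
  have "msmooth_on A U (\<lambda>q. \<psi> q (s q) + \<psi> q (s' q))"
    by (intro msmooth_on_add triv_open[OF U(1)] section_smooth[OF _ U(1)] assms)
  then have "msmooth_on A U (\<lambda>q. \<psi> q (s q + s' q))"
    by (rule msmooth_on_cong[OF triv_open[OF U(1)]])
      (simp add: linear_between_simps(1)[OF triv_linear[OF U(1)] fibre_subspace m])
  then show "\<exists>U \<psi> N. (U, \<psi>) \<in> trivs F \<and> open N \<and> p \<in> N \<and> N \<subseteq> U \<and> msmooth_on A N (\<lambda>q. \<psi> q (s q + s' q))"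
    using U triv_open[OF U(1)] by blast
qed

lemma section_scale:
  assumes f: "msmooth_on A UNIV f" and s: "s \<in> sections A F"
  shows "(\<lambda>p. f p *\<^sub>R s p) \<in> sections A F"
proof (rule sectionI)
  note m = section_mem[OF s]
  fix p
  show "f p *\<^sub>R s p \<in> fibre F p" by (intro subspace_scale fibre_subspace m)
  obtain U \<psi> where U: "(U, \<psi>) \<in> trivs F" "p \<in> U" by (rule triv_cover)
  have "msmooth_on A U (\<lambda>q. f q *\<^sub>R \<psi> q (s q))"
    by (intro msmooth_on_scaleR triv_open[OF U(1)] section_smooth[OF s U(1)] msmooth_on_subset[OF f]) simp
  then have "msmooth_on A U (\<lambda>q. \<psi> q (f q *\<^sub>R s q))"
    by (rule msmooth_on_cong[OF triv_open[OF U(1)]])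
      (simp add: linear_between_simps(4)[OF triv_linear[OF U(1)] fibre_subspace m m])
  then show "\<exists>U \<psi> N. (U, \<psi>) \<in> trivs F \<and> open N \<and> p \<in> N \<and> N \<subseteq> U \<and> msmooth_on A N (\<lambda>q. \<psi> q (f q *\<^sub>R s q))"
    using U triv_open[OF U(1)] by blast
qed

lemma section_const_scale: "s \<in> sections A F \<Longrightarrow> (\<lambda>p. c *\<^sub>R s p) \<in> sections A F"
  by (rule section_scale[OF msmooth_on_const])

lemma section_zero: "(\<lambda>p. 0) \<in> sections A F"
proof (rule sectionI)
  fix p
  show "0 \<in> fibre F p" by (rule subspace_0[OF fibre_subspace])
  obtain U \<psi> where U: "(U, \<psi>) \<in> trivs F" "p \<in> U" by (rule triv_cover)
  have "msmooth_on A U (\<lambda>q. \<psi> q 0)"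
    by (rule msmooth_on_cong[OF triv_open[OF U(1)] msmooth_on_const[of U 0]])
      (simp add: linear_between_simps(5)[OF triv_linear[OF U(1)] fibre_subspace triv_inv_mem[OF U(1)] triv_inv_mem[OF U(1)]])
  then show "\<exists>U \<psi> N. (U, \<psi>) \<in> trivs F \<and> open N \<and> p \<in> N \<and> N \<subseteq> U \<and> msmooth_on A N (\<lambda>q. \<psi> q 0)"
    using U triv_open[OF U(1)] by blast
qed

lemma section_sum:
  "(\<And>i. i \<in> K \<Longrightarrow> s i \<in> sections A F) \<Longrightarrow> (\<lambda>p. \<Sum>i\<in>K. s i p) \<in> sections A F"
  by (induction K rule: infinite_finite_induct) (auto intro!: section_zero section_add)

lemma bundle_map_section:
  assumes H: "bundle_map A F F H" and s: "s \<in> sections A F"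
  shows "(\<lambda>p. H p (s p)) \<in> sections A F"
proof (rule sectionI)
  note m = section_mem[OF s]
  have lin: "linear_between (fibre F p) (fibre F p) (H p)" for p using H by (simp add: bundle_map_def)
  fix p
  show mem: "H p (s p) \<in> fibre F p" for p by (rule linear_between_mem[OF lin m])
  obtain U \<psi> where U: "(U, \<psi>) \<in> trivs F" "p \<in> U" by (rule triv_cover)
  obtain B :: "'k set" where B: "parseval_frame B" using fd_fibre finite_dim_frame_iff by blast
  have Hs: "msmooth_on A U (\<lambda>q. \<psi> q (H q (triv_inv F \<psi> q b)))" for b
    using H U(1) unfolding bundle_map_def by fastforce
  have "msmooth_on A U (\<lambda>q. \<Sum>b\<in>B. (\<psi> q (s q) \<bullet> b) *\<^sub>R \<psi> q (H q (triv_inv F \<psi> q b)))"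
    by (intro msmooth_on_sum msmooth_on_scaleR msmooth_on_inner_const triv_open[OF U(1)] section_smooth[OF s U(1)] Hs)
  then have "msmooth_on A U (\<lambda>q. \<psi> q (H q (s q)))"
  proof (rule msmooth_on_cong[OF triv_open[OF U(1)]])
    fix q assume q: "q \<in> U"
    have "linear_between (fibre F q) UNIV (\<lambda>v. \<psi> q (H q v))"
      using lin[of q] triv_linear[OF U(1) q] unfolding linear_between_def by (auto simp: image_subset_iff)
    from linear_between_triv_expand[OF U(1) q B m this]
    show "(\<Sum>b\<in>B. (\<psi> q (s q) \<bullet> b) *\<^sub>R \<psi> q (H q (triv_inv F \<psi> q b))) = \<psi> q (H q (s q))" by simp
  qed
  then show "\<exists>U \<psi> N. (U, \<psi>) \<in> trivs F \<and> open N \<and> p \<in> N \<and> N \<subseteq> U \<and> msmooth_on A N (\<lambda>q. \<psi> q (H q (s q)))"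
    using U triv_open[OF U(1)] by blast
qed

text \<open>Turns a local frame vector into a global section, as the bracket demands. The case
  distinction is essential: \<open>triv_inv\<close> has no meaning outside \<open>U\<close>, while
  \<beta> vanishes off the closed set \<open>K\<close> inside \<open>U\<close>.\<close>

lemma local_frame_section:
  assumes U: "(U, \<psi>) \<in> trivs F" and \<beta>: "msmooth_on A UNIV \<beta>" and K: "closed K" "K \<subseteq> U" "\<And>q. q \<notin> K \<Longrightarrow> \<beta> q = 0"
  shows "(\<lambda>q. \<beta> q *\<^sub>R (if q \<in> U then triv_inv F \<psi> q x else 0)) \<in> sections A F"
proof (rule sectionI)
  let ?s = "\<lambda>q. \<beta> q *\<^sub>R (if q \<in> U then triv_inv F \<psi> q x else 0)"
  fix p
  show "?s p \<in> fibre F p"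
    by (auto intro!: subspace_scale fibre_subspace triv_inv_mem[OF U] subspace_0)
  show "\<exists>U \<psi> N. (U, \<psi>) \<in> trivs F \<and> open N \<and> p \<in> N \<and> N \<subseteq> U \<and> msmooth_on A N (\<lambda>q. \<psi> q (?s q))"
  proof (cases "p \<in> U")
    case True
    have "msmooth_on A U (\<lambda>q. \<beta> q *\<^sub>R x)"
      by (intro msmooth_on_scaleR triv_open[OF U] msmooth_on_subset[OF \<beta>] msmooth_on_const) simp
    then have "msmooth_on A U (\<lambda>q. \<psi> q (?s q))"
      by (rule msmooth_on_cong[OF triv_open[OF U]])
        (simp add: triv_triv_inv[OF U] linear_between_simps(4)[OF triv_linear[OF U] fibre_subspace triv_inv_mem[OF U] triv_inv_mem[OF U]])
    then show ?thesis using True U triv_open[OF U] by blast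
  next
    case False
    obtain V \<theta> where V: "(V, \<theta>) \<in> trivs F" "p \<in> V" by (rule triv_cover)
    have o: "open (V \<inter> - K)" using triv_open[OF V(1)] K(1) by blast
    have "msmooth_on A (V \<inter> - K) (\<lambda>q. \<theta> q (?s q))"
      by (rule msmooth_on_cong[OF o msmooth_on_const[of _ 0]])
        (auto simp: K(3) linear_between_simps(5)[OF triv_linear[OF V(1)] fibre_subspace triv_inv_mem[OF V(1)] triv_inv_mem[OF V(1)]])
    then show ?thesis using V o False K(2) by (intro exI[of _ V] exI[of _ \<theta>] exI[of _ "V \<inter> - K"]) auto
  qed
qed

section \<open>Bundle metrics and Riesz representation\<close>

context
  fixes g assumes g: "bundle_metric A F g"
begin

lemma metric_sym: "v \<in> fibre F p \<Longrightarrow> w \<in> fibre F p \<Longrightarrow> g p v w = g p w v"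
  using conjunct1[OF conjunct2[OF g[unfolded bundle_metric_def]]] by simp

lemma metric_linear: "v \<in> fibre F p \<Longrightarrow> linear_between (fibre F p) UNIV (g p v)"
  using conjunct1[OF g[unfolded bundle_metric_def]] by simp

lemma metric_linear_left: "w \<in> fibre F p \<Longrightarrow> linear_between (fibre F p) UNIV (\<lambda>v. g p v w)"
  using metric_linear[of w p] subspace_add[OF fibre_subspace] subspace_scale[OF fibre_subspace]
  unfolding linear_between_def by (simp add: metric_sym[of _ p w])

lemma metric_nondegenerate: "v \<in> fibre F p \<Longrightarrow> (\<And>w. w \<in> fibre F p \<Longrightarrow> g p v w = 0) \<Longrightarrow> v = 0"
  using conjunct1[OF conjunct2[OF conjunct2[OF g[unfolded bundle_metric_def]]]] by simp

lemma metric_smooth: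
  assumes s: "s \<in> sections A F" and s': "s' \<in> sections A F"
  shows "msmooth_on A UNIV (\<lambda>p. g p (s p) (s' p))"
proof (rule msmooth_on_local)
  fix p
  note m = section_mem[OF s] section_mem[OF s']
  obtain U \<psi> where U: "(U, \<psi>) \<in> trivs F" "p \<in> U" by (rule triv_cover)
  obtain B :: "'k set" where B: "parseval_frame B" using fd_fibre finite_dim_frame_iff by blast
  have gs: "msmooth_on A U (\<lambda>q. g q (triv_inv F \<psi> q b) (triv_inv F \<psi> q c))" for b c
    using bspec[OF conjunct2[OF conjunct2[OF conjunct2[OF g[unfolded bundle_metric_def]]]] U(1)] by simp
  have "msmooth_on A U (\<lambda>q. \<Sum>b\<in>B. (\<psi> q (s q) \<bullet> b) *\<^sub>R (\<Sum>c\<in>B. (\<psi> q (s' q) \<bullet> c) *\<^sub>R g q (triv_inv F \<psi> q b) (triv_inv F \<psi> q c)))"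
    by (intro msmooth_on_sum msmooth_on_scaleR msmooth_on_inner_const triv_open[OF U(1)] section_smooth[OF _ U(1)] s s' gs)
  then have "msmooth_on A U (\<lambda>q. g q (s q) (s' q))"
  proof (rule msmooth_on_cong[OF triv_open[OF U(1)]])
    fix q assume q: "q \<in> U"
    have "g q (s q) (s' q) = (\<Sum>b\<in>B. (\<psi> q (s q) \<bullet> b) *\<^sub>R g q (triv_inv F \<psi> q b) (s' q))"
      by (rule linear_between_triv_expand[OF U(1) q B m(1) metric_linear_left[OF m(2)]])
    also have "\<dots> = (\<Sum>b\<in>B. (\<psi> q (s q) \<bullet> b) *\<^sub>R (\<Sum>c\<in>B. (\<psi> q (s' q) \<bullet> c) *\<^sub>R g q (triv_inv F \<psi> q b) (triv_inv F \<psi> q c)))"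
      by (simp only: linear_between_triv_expand[OF U(1) q B m(2) metric_linear[OF triv_inv_mem[OF U(1) q]]])
    finally show "(\<Sum>b\<in>B. (\<psi> q (s q) \<bullet> b) *\<^sub>R (\<Sum>c\<in>B. (\<psi> q (s' q) \<bullet> c) *\<^sub>R g q (triv_inv F \<psi> q b) (triv_inv F \<psi> q c))) = g q (s q) (s' q)"
      by simp
  qed
  then show "\<exists>N. open N \<and> p \<in> N \<and> msmooth_on A N (\<lambda>p. g p (s p) (s' p))"
    using U triv_open[OF U(1)] by blast
qed

text \<open>The metric may be indefinite, so there is no projection argument: nondegeneracy makes
  the Gram operator of the metric injective, and finite dimension makes it surjective. This gives
  meaning to the definite description in \<open>courant_D\<close>.\<close>

lemma metric_riesz:
  assumes l: "linear_between (fibre F p) UNIV (l :: 'v \<Rightarrow> real)"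
  shows "\<exists>!d. d \<in> fibre F p \<and> (\<forall>a\<in>fibre F p. g p d a = l a)"
proof (rule ex_ex1I)
  obtain U \<psi> where U: "(U, \<psi>) \<in> trivs F" "p \<in> U" by (rule triv_cover)
  obtain B :: "'k set" where B: "parseval_frame B" using fd_fibre finite_dim_frame_iff by blast
  note mem = triv_inv_mem[OF U]
  \<comment> \<open>The Gram operator: the metric at p, transported by the trivialisation, is M v
    \<bullet> w for the auxiliary inner product of the typical fibre.\<close>
  define M where "M v = (\<Sum>b\<in>B. g p (triv_inv F \<psi> p v) (triv_inv F \<psi> p b) *\<^sub>R b)" for v
  have M: "M v \<bullet> w = g p (triv_inv F \<psi> p v) (triv_inv F \<psi> p w)" for v w
    using linear_between_triv_expand[OF U B mem[of w] metric_linear[OF mem[of v]]]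
    by (simp add: M_def inner_sum_left triv_triv_inv[OF U] inner_commute[of w] mult.commute)
  note gl = linear_between_simps[OF metric_linear_left[OF mem] fibre_subspace mem mem]
  note til = linear_triv_inv[OF U]
  have "linear M"
    by (rule linearI)
      (simp_all add: M_def linear_add[OF til] linear_scale[OF til] gl(1) gl(4) scaleR_left_distrib
        sum.distrib scaleR_sum_right)
  moreover have "inj M"
  proof (rule injI)
    fix v w assume "M v = M w"
    then have "M (v - w) = 0" using linear_diff[OF \<open>linear M\<close>] by simp
    then have 0: "g p (triv_inv F \<psi> p (v - w)) (triv_inv F \<psi> p u) = 0" for u using M[of "v - w" u] by simp
    have "triv_inv F \<psi> p (v - w) = 0"
      by (rule metric_nondegenerate[OF mem]) (metis 0 triv_inv_triv[OF U])
    then show "v = w" using triv_triv_inv[OF U, of "v - w"] triv_triv_inv[OF U, of 0] linear_0[OF til] by simp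
  qed
  ultimately have "surj M" by (rule finite_dim_linear_inj_surj[OF fd_fibre])
  then obtain v where v: "M v = (\<Sum>b\<in>B. l (triv_inv F \<psi> p b) *\<^sub>R b)" by (metis surjD)
  have "g p (triv_inv F \<psi> p v) a = l a" if a: "a \<in> fibre F p" for a
  proof -
    have "g p (triv_inv F \<psi> p v) a = M v \<bullet> \<psi> p a" by (simp add: M triv_inv_triv[OF U a])
    also have "\<dots> = (\<Sum>b\<in>B. (\<psi> p a \<bullet> b) *\<^sub>R l (triv_inv F \<psi> p b))"
      by (simp add: v inner_sum_left inner_commute[of "\<psi> p a"] mult.commute)
    also have "\<dots> = l a" by (rule linear_between_triv_expand[OF U B a l, symmetric])
    finally show ?thesis .
  qed
  then show "\<exists>d. d \<in> fibre F p \<and> (\<forall>a\<in>fibre F p. g p d a = l a)" using mem by blast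
next
  fix d e assume de: "d \<in> fibre F p \<and> (\<forall>a\<in>fibre F p. g p d a = l a)" "e \<in> fibre F p \<and> (\<forall>a\<in>fibre F p. g p e a = l a)"
  have "d - e = 0"
  proof (rule metric_nondegenerate)
    show "d - e \<in> fibre F p" using de by (intro subspace_diff fibre_subspace) auto
    fix w assume w: "w \<in> fibre F p"
    show "g p (d - e) w = 0"
      using linear_between_simps(2)[OF metric_linear_left[OF w] fibre_subspace, of d e] de w by simp
  qed
  then show "d = e" by simp
qed

end

section \<open>The derivative of a family of endomorphisms\<close>

context
  fixes I :: "real set" and J :: "real \<Rightarrow> 'm \<Rightarrow> 'v \<Rightarrow> 'v"
  assumes I: "open I" and fam: "smooth_endo_family A F I J"
begin

lemma family_bundle_map: "t \<in> I \<Longrightarrow> bundle_map A F F (J t)"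
  using fam unfolding smooth_endo_family_def by blast

lemma family_linear: "t \<in> I \<Longrightarrow> linear_between (fibre F p) (fibre F p) (J t p)"
  using family_bundle_map unfolding bundle_map_def by blast

lemma family_matrix_smooth:
  assumes "(W, \<phi>) \<in> A" "(U, \<psi>) \<in> trivs F" "(V, \<theta>) \<in> trivs F"
  shows "smooth_on (I \<times> \<phi> ` (W \<inter> U \<inter> V))
    (\<lambda>z. \<theta> (inv_into W \<phi> (snd z)) (J (fst z) (inv_into W \<phi> (snd z)) (triv_inv F \<psi> (inv_into W \<phi> (snd z)) x)))"
  using fam assms unfolding smooth_endo_family_def Let_def case_prod_unfold by fastforce

lemma family_section_smooth:
  assumes c: "(W, \<phi>) \<in> A" and U: "(U, \<psi>) \<in> trivs F" and s: "s \<in> sections A F"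
  shows "smooth_on (I \<times> \<phi> ` (W \<inter> U))
    (\<lambda>z. \<psi> (inv_into W \<phi> (snd z)) (J (fst z) (inv_into W \<phi> (snd z)) (s (inv_into W \<phi> (snd z)))))"
proof -
  obtain B :: "'k set" where B: "parseval_frame B" using fd_fibre finite_dim_frame_iff by blast
  have op: "open (\<phi> ` (W \<inter> U))" by (rule chart_open_map[OF c triv_open[OF U]])
  then have oI: "open (I \<times> \<phi> ` (W \<inter> U))" by (rule open_Times[OF I])
  let ?i = "inv_into W \<phi>"
  have 1: "smooth_on (I \<times> \<phi> ` (W \<inter> U)) (\<lambda>z. \<psi> (?i (snd z)) (s (?i (snd z))))"
    by (rule smooth_on_compose[OF fd_model oI op, where g = snd])
      (use msmooth_onD[OF section_smooth[OF s U] c] in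
        \<open>auto intro!: smooth_on_bounded_linear bounded_linear_snd oI simp: comp_def\<close>)
  have 2: "smooth_on (I \<times> \<phi> ` (W \<inter> U)) (\<lambda>z. \<psi> (?i (snd z)) (J (fst z) (?i (snd z)) (triv_inv F \<psi> (?i (snd z)) b)))" for b
    using family_matrix_smooth[OF c U U] by (simp add: Int_assoc)
  have "smooth_on (I \<times> \<phi> ` (W \<inter> U)) (\<lambda>z. \<Sum>b\<in>B. (\<psi> (?i (snd z)) (s (?i (snd z))) \<bullet> b) *\<^sub>R
      \<psi> (?i (snd z)) (J (fst z) (?i (snd z)) (triv_inv F \<psi> (?i (snd z)) b)))"
    by (intro smooth_on_sum smooth_on_scaleR smooth_on_inner smooth_on_const oI 1 2)
  then show ?thesis
  proof (rule smooth_on_cong[OF oI])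
    fix z assume z: "z \<in> I \<times> \<phi> ` (W \<inter> U)"
    let ?q = "?i (snd z)"
    have q: "?q \<in> U" using z chart_inv[OF c] by auto
    have "linear_between (fibre F ?q) UNIV (\<lambda>v. \<psi> ?q (J (fst z) ?q v))"
      using family_linear[of "fst z" ?q] triv_linear[OF U q] z unfolding linear_between_def
      by (auto simp: image_subset_iff)
    from linear_between_triv_expand[OF U q B section_mem[OF s] this]
    show "(\<Sum>b\<in>B. (\<psi> ?q (s ?q) \<bullet> b) *\<^sub>R \<psi> ?q (J (fst z) ?q (triv_inv F \<psi> ?q b))) = \<psi> ?q (J (fst z) ?q (s ?q))"
      by simp
  qed
qed

context
  fixes t assumes t: "t \<in> I"
begin

text \<open>\<open>fibre_deriv\<close> asks for one vector that is the derivative in all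
  trivialisations at once. The derivative exists in one of them by joint smoothness, and the change
  of trivialisation at the fixed point p is a constant linear map, which preserves
  derivatives.\<close>

lemma J_dot_char:
  assumes v: "v \<in> fibre F p"
  shows "J_dot F J t p v \<in> fibre F p"
    and "(U, \<psi>) \<in> trivs F \<Longrightarrow> p \<in> U \<Longrightarrow>
      ((\<lambda>s. \<psi> p (J s p v)) has_vector_derivative \<psi> p (J_dot F J t p v)) (at t)"
proof -
  obtain W \<phi> where c: "(W, \<phi>) \<in> A" "p \<in> W" by (rule chart_cover)
  obtain V \<theta> where V: "(V, \<theta>) \<in> trivs F" "p \<in> V" by (rule triv_cover)
  obtain B :: "'k set" where B: "parseval_frame B" using fd_fibre finite_dim_frame_iff by blast
  let ?i = "inv_into W \<phi>"
  \<comment> \<open>Joint smoothness concerns matrix columns over varying base points; with the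
    column \<theta> p v, the slice over \<phi> p is exactly the curve \<open>J s p v\<close> read in
    the trivialisation \<theta>.\<close>
  define H where "H z = \<theta> (?i (snd z)) (J (fst z) (?i (snd z)) (triv_inv F \<theta> (?i (snd z)) (\<theta> p v)))" for z
  have "smooth_on (I \<times> \<phi> ` (W \<inter> V \<inter> V)) H"
    unfolding H_def by (rule family_matrix_smooth[OF c(1) V(1) V(1)])
  then have "(H has_derivative frechet_derivative H (at (t, \<phi> p))) (at (t, \<phi> p))"
    by (rule smooth_on_has_derivative) (use t c V in auto)
  then have "((\<lambda>r. H ((0, \<phi> p) + r *\<^sub>R (1, 0))) has_vector_derivative frechet_derivative H (at (t, \<phi> p)) (1, 0)) (at t)"
    by (intro has_derivative_along_line) simp
  then have d: "((\<lambda>s. \<theta> p (J s p v)) has_vector_derivative frechet_derivative H (at (t, \<phi> p)) (1, 0)) (at t)"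
    by (simp add: H_def chart_inv[OF c] triv_inv_triv[OF V v])
  define w where "w = triv_inv F \<theta> p (frechet_derivative H (at (t, \<phi> p)) (1, 0))"
  have w: "w \<in> fibre F p" unfolding w_def by (rule triv_inv_mem[OF V])
  have der: "((\<lambda>s. \<psi> p (J s p v)) has_vector_derivative \<psi> p w) (at t)"
    if U: "(U, \<psi>) \<in> trivs F" "p \<in> U" for U \<psi>
  proof -
    have "linear (\<lambda>x. \<psi> p (triv_inv F \<theta> p x))"
      using linear_triv_inv[OF V] linear_between_simps[OF triv_linear[OF U] fibre_subspace triv_inv_mem[OF V] triv_inv_mem[OF V]]
      by (intro linearI) (simp_all add: linear_add linear_scale)
    then have "bounded_linear (\<lambda>x. \<psi> p (triv_inv F \<theta> p x))" by (rule frame_bounded_linear[OF B])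
    from bounded_linear.has_vector_derivative[OF this d]
    have "((\<lambda>s. \<psi> p (triv_inv F \<theta> p (\<theta> p (J s p v)))) has_vector_derivative \<psi> p w) (at t)" by (simp add: w_def)
    then show ?thesis
    proof (rule has_vector_derivative_transform_within_open[OF _ I t])
      fix s assume "s \<in> I"
      then have "J s p v \<in> fibre F p" using family_linear linear_between_mem v by blast
      then show "\<psi> p (triv_inv F \<theta> p (\<theta> p (J s p v))) = \<psi> p (J s p v)" by (simp add: triv_inv_triv[OF V])
    qed
  qed
  have "J_dot F J t p v = w"
    unfolding J_dot_def fibre_deriv_def
  proof (rule the_equality)
    show "w \<in> fibre F p \<and> (\<forall>(U, \<psi>)\<in>trivs F. p \<in> U \<longrightarrow> ((\<lambda>s. \<psi> p (J s p v)) has_vector_derivative \<psi> p w) (at t))"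
      using w der by auto
    fix w' assume w': "w' \<in> fibre F p \<and> (\<forall>(U, \<psi>)\<in>trivs F. p \<in> U \<longrightarrow> ((\<lambda>s. \<psi> p (J s p v)) has_vector_derivative \<psi> p w') (at t))"
    then have "((\<lambda>s. \<theta> p (J s p v)) has_vector_derivative \<theta> p w') (at t)" using V by auto
    then have "\<theta> p w' = \<theta> p w" using der[OF V] vector_derivative_unique_at by blast
    then show "w' = w" using triv_inj[OF V] w' w by blast
  qed
  then show "J_dot F J t p v \<in> fibre F p"
    and "(U, \<psi>) \<in> trivs F \<Longrightarrow> p \<in> U \<Longrightarrow> ((\<lambda>s. \<psi> p (J s p v)) has_vector_derivative \<psi> p (J_dot F J t p v)) (at t)"
    using w der by auto
qed

lemma J_dot_eqI:
  assumes v: "v \<in> fibre F p" and w: "w \<in> fibre F p" and U: "(U, \<psi>) \<in> trivs F" "p \<in> U"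
    and d: "((\<lambda>s. \<psi> p (J s p v)) has_vector_derivative \<psi> p w) (at t)"
  shows "J_dot F J t p v = w"
  using triv_inj[OF U J_dot_char(1)[OF v] w] vector_derivative_unique_at[OF J_dot_char(2)[OF v U] d] by blast

lemma J_dot_linear: "linear_between (fibre F p) (fibre F p) (J_dot F J t p)"
  unfolding linear_between_def
proof (intro conjI ballI allI)
  show "J_dot F J t p ` fibre F p \<subseteq> fibre F p" using J_dot_char(1) by blast
  fix v w c d assume v: "v \<in> fibre F p" and w: "w \<in> fibre F p"
  obtain U \<psi> where U: "(U, \<psi>) \<in> trivs F" "p \<in> U" by (rule triv_cover)
  have lin: "\<psi> p (c *\<^sub>R x + d *\<^sub>R y) = c *\<^sub>R \<psi> p x + d *\<^sub>R \<psi> p y" if "x \<in> fibre F p" "y \<in> fibre F p" for x y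
    using triv_linear[OF U] that unfolding linear_between_def by blast
  show "J_dot F J t p (c *\<^sub>R v + d *\<^sub>R w) = c *\<^sub>R J_dot F J t p v + d *\<^sub>R J_dot F J t p w"
  proof (rule J_dot_eqI[OF _ _ U])
    show "c *\<^sub>R v + d *\<^sub>R w \<in> fibre F p" "c *\<^sub>R J_dot F J t p v + d *\<^sub>R J_dot F J t p w \<in> fibre F p"
      by (intro subspace_add subspace_scale fibre_subspace v w J_dot_char(1))+
    have "((\<lambda>s. c *\<^sub>R \<psi> p (J s p v) + d *\<^sub>R \<psi> p (J s p w)) has_vector_derivative
        c *\<^sub>R \<psi> p (J_dot F J t p v) + d *\<^sub>R \<psi> p (J_dot F J t p w)) (at t)"
      by (intro has_vector_derivative_add bounded_linear.has_vector_derivative[OF bounded_linear_scaleR_right]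
          J_dot_char(2)[OF v U] J_dot_char(2)[OF w U])
    then have "((\<lambda>s. \<psi> p (J s p (c *\<^sub>R v + d *\<^sub>R w))) has_vector_derivative
        c *\<^sub>R \<psi> p (J_dot F J t p v) + d *\<^sub>R \<psi> p (J_dot F J t p w)) (at t)"
    proof (rule has_vector_derivative_transform_within_open[OF _ I t])
      fix s assume s: "s \<in> I"
      have "J s p (c *\<^sub>R v + d *\<^sub>R w) = c *\<^sub>R J s p v + d *\<^sub>R J s p w"
        using family_linear[OF s, of p] v w unfolding linear_between_def by blast
      then show "c *\<^sub>R \<psi> p (J s p v) + d *\<^sub>R \<psi> p (J s p w) = \<psi> p (J s p (c *\<^sub>R v + d *\<^sub>R w))"
        using lin[OF linear_between_mem[OF family_linear[OF s] v] linear_between_mem[OF family_linear[OF s] w]] by simp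
    qed
    then show "((\<lambda>s. \<psi> p (J s p (c *\<^sub>R v + d *\<^sub>R w))) has_vector_derivative
        \<psi> p (c *\<^sub>R J_dot F J t p v + d *\<^sub>R J_dot F J t p w)) (at t)"
      by (simp add: lin[OF J_dot_char(1)[OF v] J_dot_char(1)[OF w]])
  qed
qed

text \<open>The matrix entries of \<open>J_dot\<close> are time derivatives of jointly smooth
  functions; the derivative is again jointly smooth, hence smooth in the base point at time
  t.\<close>

lemma J_dot_bundle_map: "bundle_map A F F (J_dot F J t)"
proof -
  have "msmooth_on A (U \<inter> V) (\<lambda>p. \<theta> p (J_dot F J t p (triv_inv F \<psi> p x)))"
    if U: "(U, \<psi>) \<in> trivs F" and V: "(V, \<theta>) \<in> trivs F" for U \<psi> V \<theta> x
  proof (rule msmooth_onI)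
    fix W \<phi> assume c: "(W, \<phi>) \<in> A"
    let ?i = "inv_into W \<phi>"
    let ?S = "\<phi> ` (W \<inter> (U \<inter> V))"
    have op: "open ?S" by (intro chart_open_map[OF c] open_Int triv_open[OF U] triv_open[OF V])
    define H where "H z = \<theta> (?i (snd z)) (J (fst z) (?i (snd z)) (triv_inv F \<psi> (?i (snd z)) x))" for z
    have H: "smooth_on (I \<times> ?S) H"
      unfolding H_def using family_matrix_smooth[OF c U V] by (simp add: Int_assoc)
    have "smooth_on ?S (\<lambda>u. frechet_derivative H (at (t, u)) (1, 0))"
      by (rule smooth_on_compose[OF finite_dim_prod[OF finite_dim_real fd_model] op open_Times[OF I op]
            smooth_on_frechet_derivative[OF H]])
        (use t in \<open>auto intro!: smooth_on_Pair smooth_on_const smooth_on_id op\<close>)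
    then show "smooth_on ?S (\<lambda>u. \<theta> (?i u) (J_dot F J t (?i u) (triv_inv F \<psi> (?i u) x)))"
    proof (rule smooth_on_cong[OF op])
      fix u assume u: "u \<in> ?S"
      then have q: "?i u \<in> U" "?i u \<in> V" using chart_inv[OF c] by auto
      have "(H has_derivative frechet_derivative H (at (t, u))) (at (t, u))"
        by (rule smooth_on_has_derivative[OF H]) (use u t in auto)
      then have "((\<lambda>r. H ((0, u) + r *\<^sub>R (1, 0))) has_vector_derivative frechet_derivative H (at (t, u)) (1, 0)) (at t)"
        by (intro has_derivative_along_line) simp
      then have "((\<lambda>s. \<theta> (?i u) (J s (?i u) (triv_inv F \<psi> (?i u) x))) has_vector_derivative frechet_derivative H (at (t, u)) (1, 0)) (at t)"
        by (simp add: H_def)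
      from vector_derivative_unique_at[OF this J_dot_char(2)[OF triv_inv_mem[OF U q(1)] V q(2)]]
      show "frechet_derivative H (at (t, u)) (1, 0) = \<theta> (?i u) (J_dot F J t (?i u) (triv_inv F \<psi> (?i u) x))" .
    qed
  qed
  then show ?thesis unfolding bundle_map_def using J_dot_linear by blast
qed

end

end

end

section \<open>Courant algebroids\<close>

locale courant_mfd = smooth_mfd A
  for A :: "('m::{t2_space,second_countable_topology}, 'n::real_inner) atlas" +
  fixes E :: "('m, 'v::real_vector, 'k::real_inner) courant"
  assumes ca: "courant_algebroid A E"
begin

sublocale vec_bundle A E
  by unfold_locales (use ca in \<open>simp add: courant_algebroid_def\<close>)

abbreviation \<Gamma> where "\<Gamma> \<equiv> sections A E"

lemma ca_metric: "bundle_metric A E (pairing E)"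
  and ca_anchor: "bundle_map A E (tangent_bundle A) (anchor E)"
  using ca by (simp_all add: courant_algebroid_def)

lemmas pairing_sym = metric_sym[OF ca_metric]
  and pairing_linear = metric_linear[OF ca_metric]
  and pairing_linear_left = metric_linear_left[OF ca_metric]
  and pairing_smooth = metric_smooth[OF ca_metric]

lemmas pairing_simps = linear_between_simps[OF pairing_linear fibre_subspace]
  and pairing_simps_left = linear_between_simps[OF pairing_linear_left fibre_subspace]

lemma anchor_linear: "linear_between (fibre E p) (tangent_space A p) (anchor E p)"
  using ca_anchor unfolding bundle_map_def tangent_bundle_def by simp

lemma anchor_tangent: "v \<in> fibre E p \<Longrightarrow> anchor E p v \<in> tangent_space A p"
  by (rule linear_between_mem[OF anchor_linear])

lemma anchor_linear_fun: "linear_between (fibre E p) UNIV (\<lambda>v. anchor E p v f)"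
  using anchor_linear[of p] unfolding linear_between_def by (simp add: scaleR_fun_def plus_fun_def)

lemmas anchor_simps = linear_between_simps[OF anchor_linear_fun fibre_subspace]

context
  notes ca' = ca[unfolded courant_algebroid_def Let_def]
begin

lemma bracket_section: "a \<in> \<Gamma> \<Longrightarrow> b \<in> \<Gamma> \<Longrightarrow> bracket E a b \<in> \<Gamma>"
  using conjunct1[OF conjunct2[OF conjunct2[OF conjunct2[OF ca']]]] by blast

lemma bracket_skew: "a \<in> \<Gamma> \<Longrightarrow> b \<in> \<Gamma> \<Longrightarrow> bracket E a b p = - bracket E b a p"
  using conjunct1[OF conjunct2[OF conjunct2[OF conjunct2[OF conjunct2[OF ca']]]]] by blast

lemma bracket_lin:
  "a \<in> \<Gamma> \<Longrightarrow> b \<in> \<Gamma> \<Longrightarrow> c \<in> \<Gamma> \<Longrightarrow>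
    bracket E a (\<lambda>q. r *\<^sub>R b q + s *\<^sub>R c q) p = r *\<^sub>R bracket E a b p + s *\<^sub>R bracket E a c p"
  using conjunct1[OF conjunct2[OF conjunct2[OF conjunct2[OF conjunct2[OF conjunct2[OF ca']]]]]] by blast

lemma bracket_leibniz:
  "a \<in> \<Gamma> \<Longrightarrow> b \<in> \<Gamma> \<Longrightarrow> msmooth_on A UNIV f \<Longrightarrow>
    bracket E a (\<lambda>q. f q *\<^sub>R b q) p =
      f p *\<^sub>R bracket E a b p + anchor E p (a p) f *\<^sub>R b p - pairing E p (a p) (b p) *\<^sub>R courant_D E f p"
  using conjunct1[OF conjunct2[OF conjunct2[OF conjunct2[OF conjunct2[OF conjunct2[OF conjunct2[OF conjunct2[OF conjunct2[OF ca']]]]]]]]] by blast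

lemma bracket_pairing:
  "a \<in> \<Gamma> \<Longrightarrow> b \<in> \<Gamma> \<Longrightarrow> c \<in> \<Gamma> \<Longrightarrow>
    anchor E p (a p) (spairing E b c) =
      pairing E p (bracket E a b p + courant_D E (spairing E a b) p) (c p)
      + pairing E p (b p) (bracket E a c p + courant_D E (spairing E a c) p)"
  using conjunct2[OF conjunct2[OF conjunct2[OF conjunct2[OF conjunct2[OF conjunct2[OF conjunct2[OF conjunct2[OF conjunct2[OF conjunct2[OF ca']]]]]]]]]] by blast

end

text \<open>For every f, smooth or not, half the anchor applied to f is linear in the vector, so
  Riesz representation supplies existence and uniqueness of the described vector.\<close>

lemma courant_D:
  shows courant_D_mem: "courant_D E f p \<in> fibre E p"
    and courant_D_pairing: "a \<in> fibre E p \<Longrightarrow> pairing E p (courant_D E f p) a = 1 / 2 * anchor E p a f"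
proof -
  have "linear_between (fibre E p) UNIV (\<lambda>a. 1 / 2 * anchor E p a f)"
    using anchor_linear_fun[of p f] unfolding linear_between_def by (simp add: algebra_simps)
  from theI'[OF metric_riesz[OF ca_metric this]]
  have *: "courant_D E f p \<in> fibre E p \<and> (\<forall>a\<in>fibre E p. pairing E p (courant_D E f p) a = 1 / 2 * anchor E p a f)"
    unfolding courant_D_def .
  show "courant_D E f p \<in> fibre E p" using * by simp
  show "a \<in> fibre E p \<Longrightarrow> pairing E p (courant_D E f p) a = 1 / 2 * anchor E p a f" using * by simp
qed

text \<open>Pairing with a fixed vector makes the bracket real valued, so ordinary derivatives in s
  apply, and replaces \<open>courant_D\<close> by the anchor of \<open>z\<close>. By nondegeneracy
  of the pairing nothing is lost.\<close>

definition bracket_form :: "('m \<Rightarrow> 'v) \<Rightarrow> ('m \<Rightarrow> 'v) \<Rightarrow> 'm \<Rightarrow> 'v \<Rightarrow> real" where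
  "bracket_form a b p z = pairing E p (bracket E a b p) z"

lemma bracket_mem: "a \<in> \<Gamma> \<Longrightarrow> b \<in> \<Gamma> \<Longrightarrow> bracket E a b p \<in> fibre E p"
  by (rule section_mem[OF bracket_section])

lemma bracket_form_linear:
  "a \<in> \<Gamma> \<Longrightarrow> b \<in> \<Gamma> \<Longrightarrow> linear_between (fibre E p) UNIV (bracket_form a b p)"
  unfolding bracket_form_def using pairing_linear[OF bracket_mem] by simp

lemma bracket_form_skew:
  "a \<in> \<Gamma> \<Longrightarrow> b \<in> \<Gamma> \<Longrightarrow> z \<in> fibre E p \<Longrightarrow> bracket_form a b p z = - bracket_form b a p z"
  unfolding bracket_form_def
  by (simp add: bracket_skew[of a b] pairing_simps_left(3)[OF _ bracket_mem bracket_mem])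

lemma bracket_form_add:
  assumes "a \<in> \<Gamma>" "b \<in> \<Gamma>" "c \<in> \<Gamma>" "z \<in> fibre E p"
  shows "bracket_form a (\<lambda>q. b q + c q) p z = bracket_form a b p z + bracket_form a c p z"
  using bracket_lin[OF assms(1-3), of 1 1 p] unfolding bracket_form_def
  by (simp add: pairing_simps_left(1)[OF assms(4) bracket_mem[OF assms(1,2)] bracket_mem[OF assms(1,3)]])

lemma bracket_form_scale:
  assumes "a \<in> \<Gamma>" "b \<in> \<Gamma>" "z \<in> fibre E p"
  shows "bracket_form a (\<lambda>q. r *\<^sub>R b q) p z = r * bracket_form a b p z"
    and "bracket_form (\<lambda>q. r *\<^sub>R a q) b p z = r * bracket_form a b p z"
proof -
  have *: "bracket_form a (\<lambda>q. r *\<^sub>R b q) p z = r * bracket_form a b p z" if "a \<in> \<Gamma>" "b \<in> \<Gamma>" for a b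
    using bracket_lin[OF that that(2), of r 0 p] unfolding bracket_form_def
    by (simp add: pairing_simps_left(4)[OF assms(3) bracket_mem[OF that] bracket_mem[OF that]])
  show "bracket_form a (\<lambda>q. r *\<^sub>R b q) p z = r * bracket_form a b p z" by (rule *[OF assms(1,2)])
  show "bracket_form (\<lambda>q. r *\<^sub>R a q) b p z = r * bracket_form a b p z"
    using *[OF assms(2,1)] by (simp add: bracket_form_skew[OF _ assms(2,3)] section_const_scale assms)
qed

lemma bracket_form_zero: "a \<in> \<Gamma> \<Longrightarrow> z \<in> fibre E p \<Longrightarrow> bracket_form a (\<lambda>q. 0) p z = 0"
  using bracket_form_scale(1)[of a a z p 0] by simp

lemma bracket_form_zero_left: "a \<in> \<Gamma> \<Longrightarrow> z \<in> fibre E p \<Longrightarrow> bracket_form (\<lambda>q. 0) a p z = 0"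
  using bracket_form_scale(2)[of a a z p 0] by simp

lemma bracket_form_sum:
  assumes "a \<in> \<Gamma>" "z \<in> fibre E p" "\<And>i. i \<in> K \<Longrightarrow> b i \<in> \<Gamma>"
  shows "bracket_form a (\<lambda>q. \<Sum>i\<in>K. b i q) p z = (\<Sum>i\<in>K. bracket_form a (b i) p z)"
  using assms(3)
  by (induction K rule: infinite_finite_induct)
    (simp_all add: bracket_form_zero assms(1,2) bracket_form_add section_sum)

lemma bracket_form_sum_left:
  assumes a: "a \<in> \<Gamma>" and z: "z \<in> fibre E p" and b: "\<And>i. i \<in> K \<Longrightarrow> b i \<in> \<Gamma>"
  shows "bracket_form (\<lambda>q. \<Sum>i\<in>K. b i q) a p z = (\<Sum>i\<in>K. bracket_form (b i) a p z)"
proof -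
  have "bracket_form a (\<lambda>q. \<Sum>i\<in>K. b i q) p z = (\<Sum>i\<in>K. bracket_form a (b i) p z)"
    by (rule bracket_form_sum[OF a z b])
  moreover have "(\<lambda>q. \<Sum>i\<in>K. b i q) \<in> \<Gamma>" by (rule section_sum[OF b])
  ultimately have "bracket_form (\<lambda>q. \<Sum>i\<in>K. b i q) a p z = - (\<Sum>i\<in>K. bracket_form a (b i) p z)"
    using bracket_form_skew[OF _ a z] by simp
  also have "\<dots> = (\<Sum>i\<in>K. bracket_form (b i) a p z)"
    unfolding sum_negf[symmetric] by (rule sum.cong) (simp_all add: bracket_form_skew[OF b a z])
  finally show ?thesis .
qed

lemma bracket_form_leibniz:
  assumes a: "a \<in> \<Gamma>" and b: "b \<in> \<Gamma>" and f: "msmooth_on A UNIV f" and z: "z \<in> fibre E p"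
  shows "bracket_form a (\<lambda>q. f q *\<^sub>R b q) p z =
    f p * bracket_form a b p z + anchor E p (a p) f * pairing E p (b p) z
    - pairing E p (a p) (b p) * (1 / 2 * anchor E p z f)"
proof -
  note m = section_mem[OF a] section_mem[OF b] bracket_mem[OF a b] courant_D_mem
  note s = subspace_scale[OF fibre_subspace] subspace_add[OF fibre_subspace]
  show ?thesis
    unfolding bracket_form_def bracket_leibniz[OF a b f]
    by (simp add: pairing_simps_left(1,2)[OF z] s m pairing_simps_left(4)[OF z m(1)] pairing_simps_left(4)[OF z _ m(1)]
        courant_D_pairing[OF z])
qed

text \<open>The formula isolates all dependence on the coefficients: f and g enter only through
  their values at p and their derivatives along the anchors of \<open>a p\<close>,
  \<open>b p\<close> and \<open>z\<close>. The left slot is reached from the right one by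
  skew-symmetry.\<close>

lemma bracket_form_leibniz_both:
  assumes a: "a \<in> \<Gamma>" and b: "b \<in> \<Gamma>" and f: "msmooth_on A UNIV f" and g: "msmooth_on A UNIV g"
    and z: "z \<in> fibre E p"
  shows "bracket_form (\<lambda>q. f q *\<^sub>R a q) (\<lambda>q. g q *\<^sub>R b q) p z =
    f p * g p * bracket_form a b p z
    + f p * anchor E p (a p) g * pairing E p (b p) z - g p * anchor E p (b p) f * pairing E p (a p) z
    + pairing E p (a p) (b p) * (g p * (1 / 2 * anchor E p z f) - f p * (1 / 2 * anchor E p z g))"
proof -
  note m = section_mem[OF a] section_mem[OF b]
  have fa: "(\<lambda>q. f q *\<^sub>R a q) \<in> \<Gamma>" by (rule section_scale[OF f a])
  have 1: "bracket_form (\<lambda>q. f q *\<^sub>R a q) b p z = f p * bracket_form a b p z - anchor E p (b p) f * pairing E p (a p) z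
    + pairing E p (a p) (b p) * (1 / 2 * anchor E p z f)"
    using bracket_form_skew[OF fa b z] bracket_form_leibniz[OF b a f z] bracket_form_skew[OF b a z]
      pairing_sym[OF m] by (simp add: algebra_simps)
  show ?thesis
    unfolding bracket_form_leibniz[OF fa b g z] 1
    by (simp add: pairing_simps_left(4)[OF m(2) m(1) m(1)] anchor_simps(4)[OF m(1) m(1)] algebra_simps)
qed

text \<open>Locality of the bracket: tangent vectors kill a function that is constant near p, so
  every derivative term of the Leibniz formula drops out and the values f p = g p = 1
  remain.\<close>

lemma bracket_form_cutoff:
  assumes a: "a \<in> \<Gamma>" and b: "b \<in> \<Gamma>" and f: "msmooth_on A UNIV f" and g: "msmooth_on A UNIV g"
    and z: "z \<in> fibre E p"
    and one: "open N" "p \<in> N" "\<And>q. q \<in> N \<Longrightarrow> f q = 1" "\<And>q. q \<in> N \<Longrightarrow> g q = 1"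
  shows "bracket_form (\<lambda>q. f q *\<^sub>R a q) (\<lambda>q. g q *\<^sub>R b q) p z = bracket_form a b p z"
proof -
  have "anchor E p v h = 0" if "v \<in> fibre E p" "\<And>q. q \<in> N \<Longrightarrow> h q = 1" for v h
    using tangent_cong[OF anchor_tangent[OF that(1)] msmooth_on_const[of N 1] one(1,2), of h]
      tangent_const[OF anchor_tangent[OF that(1)], of 1] that(2) by simp
  then show ?thesis
    using bracket_form_leibniz_both[OF a b f g z] section_mem[OF a] section_mem[OF b] z one by simp
qed

section \<open>Differentiating the bracket along families of sections\<close>

context
  fixes I :: "real set" and t :: real and p :: 'm
  assumes I: "open I" "t \<in> I"
begin

text \<open>Records precisely what the Leibniz formula reads off from a coefficient: its value at p
  and its derivatives along tangent vectors at p, all differentiable in s with the derivatives given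
  by \<open>f'\<close>.\<close>

definition function_family :: "(real \<Rightarrow> 'm \<Rightarrow> real) \<Rightarrow> ('m \<Rightarrow> real) \<Rightarrow> bool" where
  "function_family f f' \<longleftrightarrow>
     (\<forall>s\<in>I. msmooth_on A UNIV (f s)) \<and> msmooth_on A UNIV f' \<and>
     ((\<lambda>s. f s p) has_real_derivative f' p) (at t) \<and>
     (\<forall>X\<in>tangent_space A p. ((\<lambda>s. X (f s)) has_real_derivative X f') (at t))"

lemma bracket_form_function_families:
  assumes a: "a \<in> \<Gamma>" and b: "b \<in> \<Gamma>" and z: "z \<in> fibre E p"
    and f: "function_family f f'" and g: "function_family g g'"
  shows "((\<lambda>s. bracket_form (\<lambda>q. f s q *\<^sub>R a q) (\<lambda>q. g s q *\<^sub>R b q) p z) has_real_derivative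
    bracket_form (\<lambda>q. f' q *\<^sub>R a q) (\<lambda>q. g t q *\<^sub>R b q) p z
    + bracket_form (\<lambda>q. f t q *\<^sub>R a q) (\<lambda>q. g' q *\<^sub>R b q) p z) (at t)"
proof -
  have sm: "msmooth_on A UNIV (f s)" "msmooth_on A UNIV (g s)" if "s \<in> I" for s
    using f g that unfolding function_family_def by auto
  have sm': "msmooth_on A UNIV f'" "msmooth_on A UNIV g'"
    and d: "((\<lambda>s. f s p) has_real_derivative f' p) (at t)" "((\<lambda>s. g s p) has_real_derivative g' p) (at t)"
    using f g unfolding function_family_def by auto
  have D: "((\<lambda>s. anchor E p v (f s)) has_real_derivative anchor E p v f') (at t)"
    "((\<lambda>s. anchor E p v (g s)) has_real_derivative anchor E p v g') (at t)" if "v \<in> fibre E p" for v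
    using f g anchor_tangent[OF that] unfolding function_family_def by auto
  note m = section_mem[OF a] section_mem[OF b]
  let ?e = "\<lambda>s. f s p * g s p * bracket_form a b p z
    + f s p * anchor E p (a p) (g s) * pairing E p (b p) z - g s p * anchor E p (b p) (f s) * pairing E p (a p) z
    + pairing E p (a p) (b p) * (g s p * (1 / 2 * anchor E p z (f s)) - f s p * (1 / 2 * anchor E p z (g s)))"
  have "(?e has_real_derivative
    bracket_form (\<lambda>q. f' q *\<^sub>R a q) (\<lambda>q. g t q *\<^sub>R b q) p z
    + bracket_form (\<lambda>q. f t q *\<^sub>R a q) (\<lambda>q. g' q *\<^sub>R b q) p z) (at t)"
    unfolding bracket_form_leibniz_both[OF a b sm'(1) sm(2)[OF I(2)] z]
      bracket_form_leibniz_both[OF a b sm(1)[OF I(2)] sm'(2) z]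
    by (rule derivative_eq_intros d D[OF m(1)] D[OF m(2)] D[OF z] refl)+ (simp add: algebra_simps)
  then show ?thesis
    by (rule has_field_derivative_transform_within_open[OF _ I])
      (simp add: bracket_form_leibniz_both[OF a b sm z])
qed

text \<open>The expansion has to hold at all q, not only near p, because the bracket takes global
  sections; this is achieved by the factor \<beta>, which is harmless at p by locality. The sections
  \<open>e b\<close> do not depend on s, so all of the motion is in scalar coefficients.\<close>

definition section_family :: "(real \<Rightarrow> 'm \<Rightarrow> 'v) \<Rightarrow> ('m \<Rightarrow> 'v) \<Rightarrow> bool" where
  "section_family \<sigma> \<sigma>' \<longleftrightarrow>
     (\<forall>s\<in>I. \<sigma> s \<in> \<Gamma>) \<and> \<sigma>' \<in> \<Gamma> \<and>
     (\<exists>\<beta> N (B :: 'k set) e f f'. msmooth_on A UNIV \<beta> \<and> open N \<and> p \<in> N \<and> (\<forall>q\<in>N. \<beta> q = 1) \<and>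
        (\<forall>b\<in>B. e b \<in> \<Gamma> \<and> function_family (f b) (f' b)) \<and>
        (\<forall>s\<in>I. \<forall>q. \<beta> q *\<^sub>R \<sigma> s q = (\<Sum>b\<in>B. f b s q *\<^sub>R e b q)) \<and>
        (\<forall>q. \<beta> q *\<^sub>R \<sigma>' q = (\<Sum>b\<in>B. f' b q *\<^sub>R e b q)))"

lemma section_familyI:
  fixes B :: "'k set"
  assumes "\<And>s. s \<in> I \<Longrightarrow> \<sigma> s \<in> \<Gamma>" "\<sigma>' \<in> \<Gamma>"
    and "msmooth_on A UNIV \<beta>" "open N" "p \<in> N" "\<And>q. q \<in> N \<Longrightarrow> \<beta> q = 1"
    and "\<And>b. b \<in> B \<Longrightarrow> e b \<in> \<Gamma>" "\<And>b. b \<in> B \<Longrightarrow> function_family (f b) (f' b)"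
    and "\<And>s q. s \<in> I \<Longrightarrow> \<beta> q *\<^sub>R \<sigma> s q = (\<Sum>b\<in>B. f b s q *\<^sub>R e b q)"
    and "\<And>q. \<beta> q *\<^sub>R \<sigma>' q = (\<Sum>b\<in>B. f' b q *\<^sub>R e b q)"
  shows "section_family \<sigma> \<sigma>'"
  unfolding section_family_def
  by (intro conjI ballI allI exI[of _ \<beta>], (rule assms; assumption)+,
      rule exI[of _ N], rule exI[of _ B], rule exI[of _ e], rule exI[of _ f], rule exI[of _ f'])
    (intro conjI ballI allI; rule assms; assumption)

text \<open>A section that does not move counts as a family with derivative zero, so the product
  rule for two moving slots also covers the brackets with one fixed slot. The index 0 is an
  arbitrary element of the type.\<close>

lemma section_family_const:
  assumes a: "a \<in> \<Gamma>"
  shows "section_family (\<lambda>s. a) (\<lambda>q. 0)"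
proof (rule section_familyI[where \<beta> = "\<lambda>q. 1" and N = UNIV and B = "{0}" and e = "\<lambda>b. a"
      and f = "\<lambda>b s q. 1" and f' = "\<lambda>b q. 0"])
  show "function_family (\<lambda>s q. 1) (\<lambda>q. 0)"
    unfolding function_family_def by (auto simp: msmooth_on_const tangent_const)
qed (use a section_zero in \<open>auto simp: msmooth_on_const\<close>)

text \<open>The product rule for the bracket: locality inserts the two cut-offs, bilinearity spreads
  the expansions, and each summand is covered by the case of scalar coefficients.\<close>

lemma bracket_form_section_families:
  assumes \<sigma>: "section_family \<sigma> \<sigma>'" and \<tau>: "section_family \<tau> \<tau>'" and z: "z \<in> fibre E p"
  shows "((\<lambda>s. bracket_form (\<sigma> s) (\<tau> s) p z) has_real_derivative
    bracket_form \<sigma>' (\<tau> t) p z + bracket_form (\<sigma> t) \<tau>' p z) (at t)"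
proof -
  have \<sigma>0: "\<sigma> s \<in> \<Gamma>" "\<tau> s \<in> \<Gamma>" if "s \<in> I" for s using \<sigma> \<tau> that unfolding section_family_def by auto
  have \<sigma>0': "\<sigma>' \<in> \<Gamma>" "\<tau>' \<in> \<Gamma>" using \<sigma> \<tau> unfolding section_family_def by auto
  obtain \<beta> N B e f f' where 1: "msmooth_on A UNIV \<beta>" "open N" "p \<in> N" "\<forall>q\<in>N. \<beta> q = 1"
    "\<forall>b\<in>B. e b \<in> \<Gamma> \<and> function_family (f b) (f' b)"
    "\<forall>s\<in>I. \<forall>q. \<beta> q *\<^sub>R \<sigma> s q = (\<Sum>b\<in>(B :: 'k set). f b s q *\<^sub>R e b q)"
    "\<forall>q. \<beta> q *\<^sub>R \<sigma>' q = (\<Sum>b\<in>B. f' b q *\<^sub>R e b q)"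
    using \<sigma> unfolding section_family_def by (elim conjE exE) (rule that)
  obtain \<gamma> M C h g g' where 2: "msmooth_on A UNIV \<gamma>" "open M" "p \<in> M" "\<forall>q\<in>M. \<gamma> q = 1"
    "\<forall>b\<in>C. h b \<in> \<Gamma> \<and> function_family (g b) (g' b)"
    "\<forall>s\<in>I. \<forall>q. \<gamma> q *\<^sub>R \<tau> s q = (\<Sum>b\<in>(C :: 'k set). g b s q *\<^sub>R h b q)"
    "\<forall>q. \<gamma> q *\<^sub>R \<tau>' q = (\<Sum>b\<in>C. g' b q *\<^sub>R h b q)"
    using \<tau> unfolding section_family_def by (elim conjE exE) (rule that)
  have fs: "msmooth_on A UNIV (f b s)" if "b \<in> B" "s \<in> I" for b s
    using 1(5) that unfolding function_family_def by blast
  have fs': "msmooth_on A UNIV (f' b)" if "b \<in> B" for b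
    using 1(5) that unfolding function_family_def by blast
  have gs: "msmooth_on A UNIV (g c s)" if "c \<in> C" "s \<in> I" for c s
    using 2(5) that unfolding function_family_def by blast
  have gs': "msmooth_on A UNIV (g' c)" if "c \<in> C" for c
    using 2(5) that unfolding function_family_def by blast
  \<comment> \<open>Stated for arbitrary coefficients because it is needed for three pairs: both
    families at time s, and each derivative with the other family at t.\<close>
  have expand: "bracket_form a a' p z = (\<Sum>b\<in>B. \<Sum>c\<in>C. bracket_form (\<lambda>q. k b q *\<^sub>R e b q) (\<lambda>q. l c q *\<^sub>R h c q) p z)"
    if a: "a \<in> \<Gamma>" "a' \<in> \<Gamma>" and k: "\<And>b. b \<in> B \<Longrightarrow> msmooth_on A UNIV (k b)" and l: "\<And>c. c \<in> C \<Longrightarrow> msmooth_on A UNIV (l c)"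
      and ex: "\<And>q. \<beta> q *\<^sub>R a q = (\<Sum>b\<in>B. k b q *\<^sub>R e b q)" "\<And>q. \<gamma> q *\<^sub>R a' q = (\<Sum>b\<in>C. l b q *\<^sub>R h b q)"
    for a a' k l
  proof -
    have ke: "(\<lambda>q. k b q *\<^sub>R e b q) \<in> \<Gamma>" if "b \<in> B" for b using section_scale[OF k[OF that]] 1(5) that by blast
    have lh: "(\<lambda>q. l c q *\<^sub>R h c q) \<in> \<Gamma>" if "c \<in> C" for c using section_scale[OF l[OF that]] 2(5) that by blast
    have "bracket_form a a' p z = bracket_form (\<lambda>q. \<beta> q *\<^sub>R a q) (\<lambda>q. \<gamma> q *\<^sub>R a' q) p z"
      by (rule bracket_form_cutoff[OF a 1(1) 2(1) z, of "N \<inter> M", symmetric]) (use 1 2 in auto)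
    also have "\<dots> = (\<Sum>b\<in>B. bracket_form (\<lambda>q. k b q *\<^sub>R e b q) (\<lambda>q. \<Sum>c\<in>C. l c q *\<^sub>R h c q) p z)"
      unfolding ex by (rule bracket_form_sum_left[OF section_sum[OF lh] z ke])
    also have "\<dots> = (\<Sum>b\<in>B. \<Sum>c\<in>C. bracket_form (\<lambda>q. k b q *\<^sub>R e b q) (\<lambda>q. l c q *\<^sub>R h c q) p z)"
      by (intro sum.cong refl bracket_form_sum ke lh z)
    finally show ?thesis .
  qed
  have "((\<lambda>s. \<Sum>b\<in>B. \<Sum>c\<in>C. bracket_form (\<lambda>q. f b s q *\<^sub>R e b q) (\<lambda>q. g c s q *\<^sub>R h c q) p z) has_real_derivative
    (\<Sum>b\<in>B. \<Sum>c\<in>C. bracket_form (\<lambda>q. f' b q *\<^sub>R e b q) (\<lambda>q. g c t q *\<^sub>R h c q) p z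
      + bracket_form (\<lambda>q. f b t q *\<^sub>R e b q) (\<lambda>q. g' c q *\<^sub>R h c q) p z)) (at t)"
    using 1(5) 2(5) by (intro DERIV_sum bracket_form_function_families z) auto
  also have "(\<Sum>b\<in>B. \<Sum>c\<in>C. bracket_form (\<lambda>q. f' b q *\<^sub>R e b q) (\<lambda>q. g c t q *\<^sub>R h c q) p z
      + bracket_form (\<lambda>q. f b t q *\<^sub>R e b q) (\<lambda>q. g' c q *\<^sub>R h c q) p z)
      = bracket_form \<sigma>' (\<tau> t) p z + bracket_form (\<sigma> t) \<tau>' p z"
    unfolding sum.distrib
    by (intro arg_cong2[of _ _ _ _ "(+)"] expand[symmetric] \<sigma>0' \<sigma>0 I(2) fs fs' gs gs')
      (use 1(6,7) 2(6,7) I(2) in auto)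
  finally show ?thesis
  proof (rule has_field_derivative_transform_within_open[OF _ I])
    fix s assume s: "s \<in> I"
    show "(\<Sum>b\<in>B. \<Sum>c\<in>C. bracket_form (\<lambda>q. f b s q *\<^sub>R e b q) (\<lambda>q. g c s q *\<^sub>R h c q) p z) = bracket_form (\<sigma> s) (\<tau> s) p z"
      by (rule expand[symmetric]) (use s 1(6) 2(6) in \<open>auto intro!: \<sigma>0 fs gs\<close>)
  qed
qed

lemma endo_family_section_family:
  assumes fam: "smooth_endo_family A E I J" and a: "a \<in> \<Gamma>"
  shows "section_family (\<lambda>s q. J s q (a q)) (\<lambda>q. J_dot E J t q (a q))"
proof -
  note m = section_mem[OF a]
  obtain W \<phi> where c: "(W, \<phi>) \<in> A" "p \<in> W" by (rule chart_cover)
  obtain U \<psi> where U: "(U, \<psi>) \<in> trivs E" "p \<in> U" by (rule triv_cover)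
  obtain B :: "'k set" where B: "parseval_frame B" using fd_fibre finite_dim_frame_iff by blast
  have "open (W \<inter> U)" "p \<in> W \<inter> U" using chart_open[OF c(1)] triv_open[OF U(1)] c U by auto
  then obtain \<beta> :: "'m \<Rightarrow> real" and K N where \<beta>: "msmooth_on A UNIV \<beta>" "closed K" "K \<subseteq> W \<inter> U" "\<And>q. q \<notin> K \<Longrightarrow> \<beta> q = 0"
    and N: "open N" "p \<in> N" "N \<subseteq> W \<inter> U" "\<And>q. q \<in> N \<Longrightarrow> \<beta> q = 1"
    by (rule bump_function) blast
  have Js: "(\<lambda>q. J s q (a q)) \<in> \<Gamma>" if "s \<in> I" for s
    by (rule bundle_map_section[OF family_bundle_map[OF I(1) fam that] a])
  have Jd: "(\<lambda>q. J_dot E J t q (a q)) \<in> \<Gamma>"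
    by (rule bundle_map_section[OF J_dot_bundle_map[OF I(1) fam I(2)] a])
  define e where "e b = (\<lambda>q. \<beta> q *\<^sub>R (if q \<in> U then triv_inv E \<psi> q b else 0))" for b
  define f where "f b s q = \<beta> q *\<^sub>R (\<psi> q (J s q (a q)) \<bullet> b)" for b s q
  define f' where "f' b q = \<beta> q *\<^sub>R (\<psi> q (J_dot E J t q (a q)) \<bullet> b)" for b q
  have KU: "K \<subseteq> U" using \<beta>(3) by blast
  have e: "e b \<in> \<Gamma>" for b unfolding e_def by (rule local_frame_section[OF U(1) \<beta>(1,2) KU \<beta>(4)])
  \<comment> \<open>The cut-off enters squared: one factor extends the coefficient function by zero,
    the other extends the frame section.\<close>
  have ex: "(\<beta> q * \<beta> q) *\<^sub>R s q = (\<Sum>b\<in>B. (\<beta> q *\<^sub>R (\<psi> q (s q) \<bullet> b)) *\<^sub>R e b q)" if s: "s \<in> \<Gamma>" for s q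
  proof (cases "q \<in> U")
    case True
    have "(\<beta> q * \<beta> q) *\<^sub>R s q = (\<beta> q * \<beta> q) *\<^sub>R (\<Sum>b\<in>B. (\<psi> q (s q) \<bullet> b) *\<^sub>R triv_inv E \<psi> q b)"
      by (simp only: triv_expand[OF U(1) True B section_mem[OF s], symmetric])
    also have "\<dots> = (\<Sum>b\<in>B. (\<beta> q *\<^sub>R (\<psi> q (s q) \<bullet> b)) *\<^sub>R e b q)"
      unfolding scaleR_sum_right using True by (intro sum.cong refl) (simp add: e_def mult_ac)
    finally show ?thesis .
  next
    case False
    then have "\<beta> q = 0" using \<beta>(4) KU by blast
    then show ?thesis by simp
  qed
  have "function_family (f b) (f' b)" for b
  proof -
    have "msmooth_on A UNIV (f b s)" if "s \<in> I" for s
      unfolding f_def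
      by (rule msmooth_on_times_cutoff[OF triv_open[OF U(1)] _ \<beta>(1,2) KU \<beta>(4)],
          rule msmooth_on_inner_const[OF triv_open[OF U(1)] section_smooth[OF Js[OF that] U(1)]])
    moreover have "msmooth_on A UNIV (f' b)"
      unfolding f'_def
      by (rule msmooth_on_times_cutoff[OF triv_open[OF U(1)] _ \<beta>(1,2) KU \<beta>(4)],
          rule msmooth_on_inner_const[OF triv_open[OF U(1)] section_smooth[OF Jd U(1)]])
    moreover have inner: "((\<lambda>s. \<psi> q (J s q (a q)) \<bullet> b) has_real_derivative \<psi> q (J_dot E J t q (a q)) \<bullet> b) (at t)" if "q \<in> U" for q
      unfolding has_real_derivative_iff_has_vector_derivative
      by (rule bounded_linear.has_vector_derivative[OF bounded_linear_inner_left J_dot_char(2)[OF I(1) fam I(2) m U(1) that]])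
    then have "((\<lambda>s. f b s p) has_real_derivative f' b p) (at t)"
      unfolding f_def f'_def using U(2) N(2,4) by simp
    moreover have "((\<lambda>s. X (f b s)) has_real_derivative X (f' b)) (at t)" if X: "X \<in> tangent_space A p" for X
    proof -
      let ?i = "inv_into W \<phi>"
      \<comment> \<open>The coefficient without its cut-off, in chart coordinates. On
        \<open>N\<close>, where \<beta> is 1, it agrees with \<open>f b\<close>, and only the germ
        at p is seen by a tangent vector.\<close>
      define H where "H z = \<psi> (?i (snd z)) (J (fst z) (?i (snd z)) (a (?i (snd z)))) \<bullet> b" for z
      have op: "open (\<phi> ` N)" using chart_open_map[OF c(1) N(1)] N(3) by (simp add: Int_absorb1)
      have sub: "I \<times> \<phi> ` N \<subseteq> I \<times> \<phi> ` (W \<inter> U)" using N(3) by auto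
      have H: "smooth_on (I \<times> \<phi> ` N) H"
        unfolding H_def
        by (intro smooth_on_inner smooth_on_const open_Times I(1) op
            smooth_on_subset[OF family_section_smooth[OF I(1) fam c(1) U(1) a] sub])
      have inv: "?i (\<phi> q) = q" if "q \<in> N" for q using chart_inv[OF c(1)] N(3) that by blast
      show ?thesis
      proof (rule tangent_param_derivative[OF X c(1) I N(1,2) _ H])
        show "N \<subseteq> W" using N(3) by blast
        show "f b s q = H (s, \<phi> q)" if "s \<in> I" "q \<in> N" for s q
          using that by (simp add: f_def H_def inv N(4))
        fix q assume q: "q \<in> N"
        have "(H has_derivative frechet_derivative H (at (t, \<phi> q))) (at (t, \<phi> q))"
          by (rule smooth_on_has_derivative[OF H]) (use q I(2) in auto)
        then have "((\<lambda>r. H ((0, \<phi> q) + r *\<^sub>R (1, 0))) has_vector_derivative frechet_derivative H (at (t, \<phi> q)) (1, 0)) (at t)"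
          by (intro has_derivative_along_line) simp
        then have "((\<lambda>s. \<psi> q (J s q (a q)) \<bullet> b) has_real_derivative frechet_derivative H (at (t, \<phi> q)) (1, 0)) (at t)"
          by (simp add: H_def inv[OF q] has_real_derivative_iff_has_vector_derivative)
        moreover have "q \<in> U" using q N(3) by blast
        ultimately have "\<psi> q (J_dot E J t q (a q)) \<bullet> b = frechet_derivative H (at (t, \<phi> q)) (1, 0)"
          using DERIV_unique[OF inner] by blast
        then show "f' b q = frechet_derivative H (at (t, \<phi> q)) (1, 0)" by (simp add: f'_def N(4)[OF q])
      qed
    qed
    ultimately show ?thesis unfolding function_family_def by blast
  qed
  then show ?thesis
    by (intro section_familyI[where \<beta> = "\<lambda>q. \<beta> q * \<beta> q" and N = N and B = B and e = e and f = f and f' = f']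
        Js Jd msmooth_on_mult open_UNIV \<beta>(1) N(1,2) e)
      (simp_all add: N(4) ex[OF Js, folded f_def] ex[OF Jd, folded f'_def])
qed

text \<open>A product rule for a moving functional on a moving vector. The functional is
  differentiable only on fixed vectors, so the moving vector is expanded in a frame of the fibre at
  p.\<close>

lemma moving_argument_derivative:
  assumes fam: "smooth_endo_family A E I J" and z: "z \<in> fibre E p"
    and lin: "\<And>s. s \<in> I \<Longrightarrow> linear_between (fibre E p) UNIV (\<tau> s :: 'v \<Rightarrow> real)"
    and lin': "linear_between (fibre E p) UNIV (\<tau>' :: 'v \<Rightarrow> real)"
    and d: "\<And>w. w \<in> fibre E p \<Longrightarrow> ((\<lambda>s. \<tau> s w) has_real_derivative \<tau>' w) (at t)"
  shows "((\<lambda>s. \<tau> s (J s p z)) has_real_derivative \<tau>' (J t p z) + \<tau> t (J_dot E J t p z)) (at t)"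
proof -
  obtain U \<psi> where U: "(U, \<psi>) \<in> trivs E" "p \<in> U" by (rule triv_cover)
  obtain B :: "'k set" where B: "parseval_frame B" using fd_fibre finite_dim_frame_iff by blast
  have Jm: "J s p z \<in> fibre E p" if "s \<in> I" for s
    by (rule linear_between_mem[OF family_linear[OF I(1) fam that] z])
  have c: "((\<lambda>s. \<psi> p (J s p z) \<bullet> b) has_real_derivative \<psi> p (J_dot E J t p z) \<bullet> b) (at t)" for b
    unfolding has_real_derivative_iff_has_vector_derivative
    by (rule bounded_linear.has_vector_derivative[OF bounded_linear_inner_left J_dot_char(2)[OF I(1) fam I(2) z U]])
  have "((\<lambda>s. \<Sum>b\<in>B. (\<psi> p (J s p z) \<bullet> b) * \<tau> s (triv_inv E \<psi> p b)) has_real_derivative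
     (\<Sum>b\<in>B. (\<psi> p (J_dot E J t p z) \<bullet> b) * \<tau> t (triv_inv E \<psi> p b) + \<tau>' (triv_inv E \<psi> p b) * (\<psi> p (J t p z) \<bullet> b))) (at t)"
    by (intro DERIV_sum DERIV_mult c d triv_inv_mem[OF U])
  also have "(\<Sum>b\<in>B. (\<psi> p (J_dot E J t p z) \<bullet> b) * \<tau> t (triv_inv E \<psi> p b) + \<tau>' (triv_inv E \<psi> p b) * (\<psi> p (J t p z) \<bullet> b))
    = \<tau>' (J t p z) + \<tau> t (J_dot E J t p z)"
    unfolding linear_between_triv_expand[OF U B Jm[OF I(2)] lin']
      linear_between_triv_expand[OF U B J_dot_char(1)[OF I(1) fam I(2) z] lin[OF I(2)]]
    by (simp add: sum.distrib mult.commute)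
  finally show ?thesis
  proof (rule has_field_derivative_transform_within_open[OF _ I])
    fix s assume "s \<in> I"
    from linear_between_triv_expand[OF U B Jm[OF this] lin[OF this]]
    show "(\<Sum>b\<in>B. (\<psi> p (J s p z) \<bullet> b) * \<tau> s (triv_inv E \<psi> p b)) = \<tau> s (J s p z)" by simp
  qed
qed

end

end

section \<open>Families of generalized complex structures\<close>

locale gc_family = courant_mfd A E
  for A :: "('m::{t2_space,second_countable_topology}, 'n::real_inner) atlas"
    and E :: "('m, 'v::real_vector, 'k::real_inner) courant" +
  fixes J :: "real \<Rightarrow> 'm \<Rightarrow> 'v \<Rightarrow> 'v" and I :: "real set" and t :: real
  assumes I: "open I" and fam: "smooth_endo_family A E I J"
    and gcs: "\<And>s. s \<in> I \<Longrightarrow> gen_complex_structure A E (J s)" and t: "t \<in> I"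
begin

abbreviation J' where "J' \<equiv> J_dot E J t"

lemma J_mem: "s \<in> I \<Longrightarrow> v \<in> fibre E p \<Longrightarrow> J s p v \<in> fibre E p"
  by (rule linear_between_mem[OF family_linear[OF I fam]])

lemma J'_mem: "v \<in> fibre E p \<Longrightarrow> J' p v \<in> fibre E p"
  by (rule J_dot_char(1)[OF I fam t])

lemmas J'_simps = linear_between_simps[OF J_dot_linear[OF I fam t] fibre_subspace]

lemma J_section: "s \<in> I \<Longrightarrow> a \<in> \<Gamma> \<Longrightarrow> (\<lambda>q. J s q (a q)) \<in> \<Gamma>"
  by (rule bundle_map_section[OF family_bundle_map[OF I fam]])

lemma J'_section: "a \<in> \<Gamma> \<Longrightarrow> (\<lambda>q. J' q (a q)) \<in> \<Gamma>"
  by (rule bundle_map_section[OF J_dot_bundle_map[OF I fam t]])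

lemma J_square: "s \<in> I \<Longrightarrow> v \<in> fibre E p \<Longrightarrow> J s p (J s p v) = - v"
  using gcs unfolding gen_complex_structure_def by blast

lemma J_orthogonal:
  "s \<in> I \<Longrightarrow> v \<in> fibre E p \<Longrightarrow> w \<in> fibre E p \<Longrightarrow> pairing E p (J s p v) (J s p w) = pairing E p v w"
  using gcs unfolding gen_complex_structure_def by blast

lemma J_integrable:
  assumes "s \<in> I" "x \<in> \<Gamma>" "y \<in> \<Gamma>"
  shows "bracket E (\<lambda>q. J s q (x q)) (\<lambda>q. J s q (y q)) p - bracket E x y p
    - J s p (bracket E (\<lambda>q. J s q (x q)) y p + bracket E x (\<lambda>q. J s q (y q)) p) = 0"
  using gcs[OF assms(1)] assms(2,3) unfolding gen_complex_structure_def Let_def by blast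

section \<open>Skewness and the derivative of the integrability condition\<close>

lemma J_skew:
  assumes "s \<in> I" "v \<in> fibre E p" "w \<in> fibre E p"
  shows "pairing E p (J s p v) w = - pairing E p v (J s p w)"
proof -
  have "pairing E p (J s p v) w = pairing E p (J s p (J s p v)) (J s p w)"
    using J_orthogonal[OF assms(1) J_mem[OF assms(1,2)] assms(3)] by simp
  also have "\<dots> = - pairing E p v (J s p w)"
    by (simp add: J_square[OF assms(1,2)] pairing_simps_left(3)[OF J_mem[OF assms(1,3)] assms(2,2)])
  finally show ?thesis .
qed

lemma J'_skew:
  assumes v: "v \<in> fibre E p" and w: "w \<in> fibre E p"
  shows "pairing E p (J' p v) w = - pairing E p v (J' p w)"
proof -
  have const: "((\<lambda>s. pairing E p z (J s p u)) has_real_derivative pairing E p z (J' p u)) (at t)"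
    if "z \<in> fibre E p" "u \<in> fibre E p" for z u
  proof -
    \<comment> \<open>The functional, pairing with a fixed vector, does not move here; its
      derivative is the zero functional.\<close>
    have "linear_between (fibre E p) UNIV (\<lambda>u. 0 :: real)" by (simp add: linear_between_def)
    from moving_argument_derivative[OF I t fam that(2) pairing_linear[OF that(1)] this DERIV_const]
    show ?thesis by simp
  qed
  have "((\<lambda>s. pairing E p w (J s p v) + pairing E p v (J s p w)) has_real_derivative
      pairing E p w (J' p v) + pairing E p v (J' p w)) (at t)"
    by (intro DERIV_add const v w)
  moreover have "((\<lambda>s. pairing E p w (J s p v) + pairing E p v (J s p w)) has_real_derivative 0) (at t)"
  proof (rule has_field_derivative_transform_within_open[OF DERIV_const I t])
    show "0 = pairing E p w (J s p v) + pairing E p v (J s p w)" if "s \<in> I" for s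
      using J_skew[OF that v w] pairing_sym[OF w J_mem[OF that v]] by simp
  qed
  ultimately have "pairing E p w (J' p v) + pairing E p v (J' p w) = 0" by (rule DERIV_unique)
  then show ?thesis using pairing_sym[OF w J'_mem[OF v]] by simp
qed

text \<open>The integrability condition paired with z, with the outer J moved onto z by skewness, is
  a sum of scalar functions of s that vanishes identically. Its derivative at t consists of these
  six terms: J' falls on x, on y or on z.\<close>

lemma integrability_derivative:
  assumes x: "x \<in> \<Gamma>" and y: "y \<in> \<Gamma>" and z: "z \<in> fibre E p"
  defines "Jx \<equiv> \<lambda>q. J t q (x q)" and "Jy \<equiv> \<lambda>q. J t q (y q)"
    and "J'x \<equiv> \<lambda>q. J' q (x q)" and "J'y \<equiv> \<lambda>q. J' q (y q)"
  shows "bracket_form J'x Jy p z + bracket_form Jx J'y p z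
    + bracket_form J'x y p (J t p z) + bracket_form x J'y p (J t p z)
    + bracket_form Jx y p (J' p z) + bracket_form x Jy p (J' p z) = 0"
proof -
  note fx = endo_family_section_family[OF I t fam x, of p]
    and fy = endo_family_section_family[OF I t fam y, of p]
    and cx = section_family_const[OF I t x, of p] and cy = section_family_const[OF I t y, of p]
  let ?S = "\<lambda>a s q. J s q (a q)"
  note Jt = J_section[OF t] and J'm = J'_section and bfl = bracket_form_linear
  have zero: "bracket_form (?S x t) (\<lambda>q. 0) p w = 0" "bracket_form (\<lambda>q. 0) (?S y t) p w = 0" if "w \<in> fibre E p" for w
    using bracket_form_zero[OF Jt[OF x] that] bracket_form_zero_left[OF Jt[OF y] that] by auto
  have 1: "((\<lambda>s. bracket_form (?S x s) (?S y s) p z) has_real_derivative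
      bracket_form J'x Jy p z + bracket_form Jx J'y p z) (at t)"
    unfolding Jx_def Jy_def J'x_def J'y_def by (rule bracket_form_section_families[OF I t fx fy z])
  have 2: "((\<lambda>s. bracket_form (?S x s) y p w) has_real_derivative bracket_form J'x y p w) (at t)"
    if "w \<in> fibre E p" for w
    using bracket_form_section_families[OF I t fx cy that] zero[OF that] by (simp add: J'x_def)
  have 3: "((\<lambda>s. bracket_form x (?S y s) p w) has_real_derivative bracket_form x J'y p w) (at t)"
    if "w \<in> fibre E p" for w
    using bracket_form_section_families[OF I t cx fy that] zero[OF that] by (simp add: J'y_def)
  have 4: "((\<lambda>s. bracket_form (?S x s) y p (J s p z)) has_real_derivative
      bracket_form J'x y p (J t p z) + bracket_form Jx y p (J' p z)) (at t)"
    using moving_argument_derivative[where \<tau> = "\<lambda>s. bracket_form (?S x s) y p" and \<tau>' = "bracket_form J'x y p",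
        OF I t fam z bfl[OF J_section[OF _ x] y] _ 2] bfl[OF J'm[OF x] y]
    by (simp add: Jx_def J'x_def)
  have 5: "((\<lambda>s. bracket_form x (?S y s) p (J s p z)) has_real_derivative
      bracket_form x J'y p (J t p z) + bracket_form x Jy p (J' p z)) (at t)"
    using moving_argument_derivative[where \<tau> = "\<lambda>s. bracket_form x (?S y s) p" and \<tau>' = "bracket_form x J'y p",
        OF I t fam z bfl[OF x J_section[OF _ y]] _ 3] bfl[OF x J'm[OF y]]
    by (simp add: Jy_def J'y_def)
  \<comment> \<open>The last bracket carries a plus sign because \<open>J_skew\<close> contributes a
    second minus when J passes to z; the term with x and y alone is constant in s.\<close>
  let ?h = "\<lambda>s. bracket_form (?S x s) (?S y s) p z - bracket_form x y p z
    + (bracket_form (?S x s) y p (J s p z) + bracket_form x (?S y s) p (J s p z))"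
  have "(?h has_real_derivative
     (bracket_form J'x Jy p z + bracket_form Jx J'y p z) - 0
     + ((bracket_form J'x y p (J t p z) + bracket_form Jx y p (J' p z))
       + (bracket_form x J'y p (J t p z) + bracket_form x Jy p (J' p z)))) (at t)"
    by (intro DERIV_add DERIV_diff DERIV_const 1 4 5)
  moreover have "(?h has_real_derivative 0) (at t)"
  proof (rule has_field_derivative_transform_within_open[OF DERIV_const I t])
    fix s assume s: "s \<in> I"
    note Js = J_section[OF s]
    let ?u = "bracket E (?S x s) y p + bracket E x (?S y s) p"
    have m: "bracket E (?S x s) (?S y s) p \<in> fibre E p" "bracket E x y p \<in> fibre E p"
      "bracket E (?S x s) y p \<in> fibre E p" "bracket E x (?S y s) p \<in> fibre E p"
      by (intro bracket_mem Js x y)+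
    have u: "?u \<in> fibre E p" by (intro subspace_add[OF fibre_subspace] m)
    have eq: "bracket E (?S x s) (?S y s) p - bracket E x y p = J s p ?u"
      using J_integrable[OF s x y, of p] by simp
    have "pairing E p (bracket E (?S x s) (?S y s) p) z - pairing E p (bracket E x y p) z
        = pairing E p (J s p ?u) z"
      unfolding eq[symmetric] by (rule pairing_simps_left(2)[OF z m(1,2), symmetric])
    also have "\<dots> = - pairing E p ?u (J s p z)" by (rule J_skew[OF s u z])
    also have "\<dots> = - (pairing E p (bracket E (?S x s) y p) (J s p z) + pairing E p (bracket E x (?S y s) p) (J s p z))"
      by (simp only: pairing_simps_left(1)[OF J_mem[OF s z] m(3,4)])
    finally show "0 = ?h s" by (simp add: bracket_form_def)
  qed
  ultimately show ?thesis using DERIV_unique by fastforce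
qed

text \<open>The values at \<open>p\<close> of \<open>\<rho>(a)\<omega>(b,c)\<close>, \<open>\<omega>([a,b],c)\<close> and of the anisotropy term
  \<open>\<rho>(J' a)\<langle>b,c\<rangle>/2\<close>, for real sections.\<close>

definition d_anchor :: "'m \<Rightarrow> ('m \<Rightarrow> 'v) \<Rightarrow> ('m \<Rightarrow> 'v) \<Rightarrow> ('m \<Rightarrow> 'v) \<Rightarrow> real" where
  "d_anchor p a b c = anchor E p (a p) (\<lambda>q. pairing E q (b q) (J' q (c q)))"

definition d_bracket :: "'m \<Rightarrow> ('m \<Rightarrow> 'v) \<Rightarrow> ('m \<Rightarrow> 'v) \<Rightarrow> ('m \<Rightarrow> 'v) \<Rightarrow> real" where
  "d_bracket p a b c = pairing E p (bracket E a b p) (J' p (c p))"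

definition d_aniso :: "'m \<Rightarrow> ('m \<Rightarrow> 'v) \<Rightarrow> ('m \<Rightarrow> 'v) \<Rightarrow> ('m \<Rightarrow> 'v) \<Rightarrow> real" where
  "d_aniso p a b c = 1 / 2 * anchor E p (J' p (a p)) (\<lambda>q. pairing E q (b q) (c q))"

text \<open>Axiom (v) for a, J' b and c, solved for the pairing of [a, J' b] with c. Each of its two
  terms with \<open>courant_D\<close> contributes a derivative with the factor 1/2: one along the
  anchor of c, the other the anisotropy term.\<close>

lemma bracket_form_J'_right:
  assumes a: "a \<in> \<Gamma>" and b: "b \<in> \<Gamma>" and c: "c \<in> \<Gamma>"
  shows "bracket_form a (\<lambda>q. J' q (b q)) p (c p) =
    d_anchor p a c b - 1 / 2 * d_anchor p c a b - d_bracket p a c b - d_aniso p b a c"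
proof -
  let ?b = "\<lambda>q. J' q (b q)"
  note J'b = J'_section[OF b]
  note m = section_mem[OF a] section_mem[OF b] section_mem[OF c] section_mem[OF J'b]
  have "anchor E p (a p) (\<lambda>q. pairing E q (?b q) (c q)) =
      bracket_form a ?b p (c p) + 1 / 2 * anchor E p (c p) (\<lambda>q. pairing E q (a q) (?b q))
      + (pairing E p (?b p) (bracket E a c p) + 1 / 2 * anchor E p (?b p) (\<lambda>q. pairing E q (a q) (c q)))"
    unfolding bracket_pairing[OF a J'b c] bracket_form_def
    by (simp add: pairing_simps_left(1)[OF m(3) bracket_mem[OF a J'b] courant_D_mem] courant_D_pairing[OF m(3)]
        pairing_simps(1)[OF m(4) bracket_mem[OF a c] courant_D_mem]
        pairing_sym[OF m(4) courant_D_mem] courant_D_pairing[OF m(4)])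
  moreover have "(\<lambda>q. pairing E q (?b q) (c q)) = (\<lambda>q. pairing E q (c q) (?b q))"
    by (rule ext) (rule pairing_sym[OF section_mem[OF J'b] section_mem[OF c]])
  moreover have "pairing E p (?b p) (bracket E a c p) = pairing E p (bracket E a c p) (?b p)"
    by (rule pairing_sym[OF m(4) bracket_mem[OF a c]])
  ultimately show ?thesis by (simp add: d_anchor_def d_bracket_def d_aniso_def)
qed

lemma bracket_form_J'_left:
  assumes a: "a \<in> \<Gamma>" and b: "b \<in> \<Gamma>" and c: "c \<in> \<Gamma>"
  shows "bracket_form (\<lambda>q. J' q (a q)) b p (c p) =
    - (d_anchor p b c a - 1 / 2 * d_anchor p c b a - d_bracket p b c a - d_aniso p a b c)"
  using bracket_form_skew[OF J'_section[OF a] b section_mem[OF c]] bracket_form_J'_right[OF b a c] by simp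

lemma d_anchor_skew:
  assumes a: "a \<in> \<Gamma>" and b: "b \<in> \<Gamma>" and c: "c \<in> \<Gamma>"
  shows "d_anchor p a b c = - d_anchor p a c b"
proof -
  have "(\<lambda>q. pairing E q (b q) (J' q (c q))) = (\<lambda>q. 0 - pairing E q (c q) (J' q (b q)))"
  proof
    fix q
    show "pairing E q (b q) (J' q (c q)) = 0 - pairing E q (c q) (J' q (b q))"
      using J'_skew[OF section_mem[OF b] section_mem[OF c], of q]
        pairing_sym[OF J'_mem[OF section_mem[OF b]] section_mem[OF c], of q] by simp
  qed
  moreover have "smooth_near A p (\<lambda>q. pairing E q (c q) (J' q (b q)))"
    by (rule smooth_nearI[OF open_UNIV UNIV_I pairing_smooth[OF c J'_section[OF b]]])
  ultimately show ?thesis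
    unfolding d_anchor_def
    using tangent_diff[OF anchor_tangent[OF section_mem[OF a]] smooth_near_const, of p _ 0]
      tangent_const[OF anchor_tangent[OF section_mem[OF a]]] by simp
qed

text \<open>The formula for the Lie algebroid differential of a 2-form, evaluated on real sections
  of E instead of sections of L; the actual differential is recovered as its complex trilinear
  extension.\<close>

definition d_omega :: "'m \<Rightarrow> ('m \<Rightarrow> 'v) \<Rightarrow> ('m \<Rightarrow> 'v) \<Rightarrow> ('m \<Rightarrow> 'v) \<Rightarrow> real" where
  "d_omega p a b c = d_anchor p a b c - d_anchor p b a c + d_anchor p c a b
     - d_bracket p a b c + d_bracket p a c b - d_bracket p b c a"

text \<open>The two brackets containing J' each contribute half of the derivative along the anchor
  of c; by skewness of the form they add up to the full term, and only the anisotropy terms are left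
  over.\<close>

lemma d_omega_eq:
  assumes a: "a \<in> \<Gamma>" and b: "b \<in> \<Gamma>" and c: "c \<in> \<Gamma>"
  shows "d_omega p a b c = d_aniso p a b c - d_aniso p b a c
    - (bracket_form (\<lambda>q. J' q (a q)) b p (c p) + bracket_form a (\<lambda>q. J' q (b q)) p (c p) + d_bracket p a b c)"
  unfolding d_omega_def bracket_form_J'_left[OF a b c] bracket_form_J'_right[OF a b c]
  using d_anchor_skew[OF a b c, of p] d_anchor_skew[OF b a c, of p] d_anchor_skew[OF c a b, of p]
  by simp

text \<open>For a section of L, J exchanges real and imaginary parts up to sign. Here a', b', c' are
  the partners of a, b, c and the scalars are those signs, so that the eight choices of parts become
  instances of a single identity.\<close>

lemma integrability_derivative_real:
  fixes p
  assumes ab: "a \<in> \<Gamma>" "b \<in> \<Gamma>" "c \<in> \<Gamma>" "a' \<in> \<Gamma>" "b' \<in> \<Gamma>" "c' \<in> \<Gamma>"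
    and J: "\<And>q. J t q (a q) = \<alpha> *\<^sub>R a' q" "\<And>q. J t q (b q) = \<beta> *\<^sub>R b' q" "\<And>q. J t q (c q) = \<gamma> *\<^sub>R c' q"
  defines "P \<equiv> \<lambda>a b c. bracket_form (\<lambda>q. J' q (a q)) b p (c p)"
    and "Q \<equiv> \<lambda>a b c. bracket_form a (\<lambda>q. J' q (b q)) p (c p)"
  shows "\<beta> * P a b' c + \<alpha> * Q a' b c + \<gamma> * (P a b c' + Q a b c')
    + \<alpha> * d_bracket p a' b c + \<beta> * d_bracket p a b' c = 0"
proof -
  note m = section_mem[OF ab(3), of p] section_mem[OF ab(6), of p]
  note J'a = J'_section[OF ab(1)] and J'b = J'_section[OF ab(2)]
  note s = bracket_form_scale
  have "bracket_form (\<lambda>q. J' q (a q)) (\<lambda>q. \<beta> *\<^sub>R b' q) p (c p) = \<beta> * P a b' c"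
    unfolding P_def by (rule s(1)[OF J'a ab(5) m(1)])
  moreover have "bracket_form (\<lambda>q. \<alpha> *\<^sub>R a' q) (\<lambda>q. J' q (b q)) p (c p) = \<alpha> * Q a' b c"
    unfolding Q_def by (rule s(2)[OF ab(4) J'b m(1)])
  moreover have "bracket_form (\<lambda>q. J' q (a q)) b p (\<gamma> *\<^sub>R c' p) = \<gamma> * P a b c'"
    unfolding P_def using linear_between_simps(4)[OF bracket_form_linear[OF J'a ab(2)] fibre_subspace m(2,2)] by simp
  moreover have "bracket_form a (\<lambda>q. J' q (b q)) p (\<gamma> *\<^sub>R c' p) = \<gamma> * Q a b c'"
    unfolding Q_def using linear_between_simps(4)[OF bracket_form_linear[OF ab(1) J'b] fibre_subspace m(2,2)] by simp
  moreover have "bracket_form (\<lambda>q. \<alpha> *\<^sub>R a' q) b p (J' p (c p)) = \<alpha> * d_bracket p a' b c"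
    unfolding d_bracket_def using s(2)[OF ab(4,2) J'_mem[OF m(1)]] by (simp add: bracket_form_def)
  moreover have "bracket_form a (\<lambda>q. \<beta> *\<^sub>R b' q) p (J' p (c p)) = \<beta> * d_bracket p a b' c"
    unfolding d_bracket_def using s(1)[OF ab(1,5) J'_mem[OF m(1)]] by (simp add: bracket_form_def)
  ultimately show ?thesis
    using integrability_derivative[OF ab(1,2) m(1)] by (simp add: J distrib_left)
qed

section \<open>Complexification\<close>

abbreviation L where "L \<equiv> eigenbundle E (J t)"

lemma eigenbundle_iff: "z \<in> L p \<longleftrightarrow> fst z \<in> fibre E p \<and> snd z \<in> fibre E p \<and>
    J t p (fst z) = - snd z \<and> J t p (snd z) = fst z"
  by (cases z) (auto simp: eigenbundle_def cscale_def)

lemma cpairing_J'_lin: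
  assumes "z \<in> L p" "w \<in> L p" "u \<in> L p"
  shows "cpairing E p (cscale c z + cscale d w) (map_prod (J' p) (J' p) u) =
      c * cpairing E p z (map_prod (J' p) (J' p) u) + d * cpairing E p w (map_prod (J' p) (J' p) u)"
    and "cpairing E p u (map_prod (J' p) (J' p) (cscale c z + cscale d w)) =
      c * cpairing E p u (map_prod (J' p) (J' p) z) + d * cpairing E p u (map_prod (J' p) (J' p) w)"
proof -
  note m = assms[unfolded eigenbundle_iff]
  have f: "fst z \<in> fibre E p" "snd z \<in> fibre E p" "fst w \<in> fibre E p" "snd w \<in> fibre E p"
    "fst u \<in> fibre E p" "snd u \<in> fibre E p" using m by auto
  note mem = f subspace_add[OF fibre_subspace] subspace_diff[OF fibre_subspace] subspace_scale[OF fibre_subspace] J'_mem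
  have pl: "pairing E p (r *\<^sub>R x) y = r * pairing E p x y" "pairing E p y (r *\<^sub>R x) = r * pairing E p y x"
    "J' p (r *\<^sub>R x) = r *\<^sub>R J' p x"
    if "x \<in> fibre E p" "y \<in> fibre E p" for x y r
    using pairing_simps_left(4)[OF that(2,1,1)] pairing_simps(4)[OF that(2,1,1)] J'_simps(4)[OF that(1,1)] by simp_all
  show "cpairing E p (cscale c z + cscale d w) (map_prod (J' p) (J' p) u) =
      c * cpairing E p z (map_prod (J' p) (J' p) u) + d * cpairing E p w (map_prod (J' p) (J' p) u)"
    by (simp add: cpairing_def cscale_def complex_eq_iff pairing_simps_left(1,2) pl mem) (simp add: algebra_simps)
  show "cpairing E p u (map_prod (J' p) (J' p) (cscale c z + cscale d w)) =
      c * cpairing E p u (map_prod (J' p) (J' p) z) + d * cpairing E p u (map_prod (J' p) (J' p) w)"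
    by (simp add: cpairing_def cscale_def complex_eq_iff map_prod_def case_prod_unfold pairing_simps(1,2) J'_simps(1,2) pl(2) pl(3)[OF _ f(1)] mem)
      (simp add: algebra_simps)
qed

lemma cpairing_J'_self:
  assumes "z \<in> L p"
  shows "cpairing E p z (map_prod (J' p) (J' p) z) = 0"
proof -
  have f: "fst z \<in> fibre E p" "snd z \<in> fibre E p" using assms by (auto simp: eigenbundle_iff)
  have sk: "pairing E p v (J' p w) = - pairing E p w (J' p v)" if "v \<in> fibre E p" "w \<in> fibre E p" for v w
    using J'_skew[OF that] pairing_sym[OF J'_mem[OF that(1)] that(2)] by simp
  show ?thesis
    using sk[OF f(1) f(1)] sk[OF f(2) f(2)] sk[OF f]
    by (simp add: cpairing_def map_prod_def case_prod_unfold complex_eq_iff)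
qed

lemma csections_iff: "x \<in> csections A E L \<longleftrightarrow>
    (\<lambda>q. fst (x q)) \<in> \<Gamma> \<and> (\<lambda>q. snd (x q)) \<in> \<Gamma> \<and> (\<forall>p. x p \<in> L p)"
  by (auto simp: csections_def comp_def)

lemma form_section_omega_dot: "form_section A E L 2 (omega_dot E J t)"
  unfolding form_section_def
proof (intro conjI allI impI)
  fix p vs and i :: nat and z w c d
  assume a: "length vs = 2 \<and> set vs \<subseteq> L p \<and> i < 2 \<and> z \<in> L p \<and> w \<in> L p"
  then obtain u v where vs: "vs = [u, v]" by (auto simp: numeral_2_eq_2 length_Suc_conv)
  have "i = 0 \<or> i = 1" using a by auto
  then show "omega_dot E J t p (vs[i := cscale c z + cscale d w])
      = c * omega_dot E J t p (vs[i := z]) + d * omega_dot E J t p (vs[i := w])"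
    using a by (auto simp: vs omega_dot_def cpairing_J'_lin)
next
  fix p vs and i j :: nat
  assume a: "length vs = 2 \<and> set vs \<subseteq> L p \<and> i < j \<and> j < 2 \<and> vs ! i = vs ! j"
  then obtain u v where vs: "vs = [u, v]" by (auto simp: numeral_2_eq_2 length_Suc_conv)
  have "i = 0 \<and> j = 1" using a by auto
  then have "[u, v] ! 0 = [u, v] ! 1" using a unfolding vs by metis
  then have "u = v" by simp
  then show "omega_dot E J t p vs = 0" using a by (simp add: vs omega_dot_def cpairing_J'_self)
next
  fix xs assume a: "length xs = 2 \<and> set xs \<subseteq> csections A E L"
  then obtain x y where xs: "xs = [x, y]" by (auto simp: numeral_2_eq_2 length_Suc_conv)
  then have "x \<in> csections A E L" "y \<in> csections A E L" using a by auto
  then have m: "(\<lambda>q. fst (x q)) \<in> \<Gamma>" "(\<lambda>q. snd (x q)) \<in> \<Gamma>" "(\<lambda>q. fst (y q)) \<in> \<Gamma>" "(\<lambda>q. snd (y q)) \<in> \<Gamma>"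
    by (auto simp: csections_iff)
  have "msmooth_on A UNIV (\<lambda>p. Complex
      (pairing E p (fst (x p)) (J' p (fst (y p))) - pairing E p (snd (x p)) (J' p (snd (y p))))
      (pairing E p (fst (x p)) (J' p (snd (y p))) + pairing E p (snd (x p)) (J' p (fst (y p)))))"
    by (intro msmooth_on_Complex msmooth_on_diff msmooth_on_add open_UNIV pairing_smooth J'_section m)
  then show "msmooth_on A UNIV (\<lambda>p. omega_dot E J t p (map (\<lambda>x. x p) xs))"
    by (simp add: xs omega_dot_def cpairing_def map_prod_def case_prod_unfold)
qed

text \<open>On L the real part is J of the imaginary part; the vanishing of the real part of the
  pairing is then orthogonality of J, and that of the imaginary part its skewness.\<close>

lemma isotropic:
  assumes "y \<in> csections A E L" "z \<in> csections A E L"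
  shows "pairing E q (fst (y q)) (fst (z q)) - pairing E q (snd (y q)) (snd (z q)) = 0"
    and "pairing E q (fst (y q)) (snd (z q)) + pairing E q (snd (y q)) (fst (z q)) = 0"
proof -
  have y: "fst (y q) \<in> fibre E q" "snd (y q) \<in> fibre E q" "J t q (snd (y q)) = fst (y q)"
    and z: "fst (z q) \<in> fibre E q" "snd (z q) \<in> fibre E q" "J t q (snd (z q)) = fst (z q)"
    using assms by (auto simp: csections_iff eigenbundle_iff)
  show "pairing E q (fst (y q)) (fst (z q)) - pairing E q (snd (y q)) (snd (z q)) = 0"
    using J_orthogonal[OF t y(2) z(2)] by (simp add: y(3) z(3))
  show "pairing E q (fst (y q)) (snd (z q)) + pairing E q (snd (y q)) (fst (z q)) = 0"
    using J_skew[OF t y(2) z(2)] by (simp add: y(3) z(3))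
qed

text \<open>Isotropy holds at every point, so the real and imaginary parts of the pairing are
  constant functions and any tangent vector annihilates them.\<close>

lemma d_aniso_isotropic:
  assumes a: "a \<in> \<Gamma>" and yz: "y \<in> csections A E L" "z \<in> csections A E L"
  shows "d_aniso p a (\<lambda>q. fst (y q)) (\<lambda>q. fst (z q)) = d_aniso p a (\<lambda>q. snd (y q)) (\<lambda>q. snd (z q))"
    and "d_aniso p a (\<lambda>q. fst (y q)) (\<lambda>q. snd (z q)) = - d_aniso p a (\<lambda>q. snd (y q)) (\<lambda>q. fst (z q))"
proof -
  have m: "(\<lambda>q. fst (y q)) \<in> \<Gamma>" "(\<lambda>q. snd (y q)) \<in> \<Gamma>" "(\<lambda>q. fst (z q)) \<in> \<Gamma>" "(\<lambda>q. snd (z q)) \<in> \<Gamma>"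
    using yz by (auto simp: csections_iff)
  note X = anchor_tangent[OF J'_mem[OF section_mem[OF a]]]
  have sm: "smooth_near A p (\<lambda>q. pairing E q (b q) (c q))" if "b \<in> \<Gamma>" "c \<in> \<Gamma>" for b c
    by (rule smooth_nearI[OF open_UNIV UNIV_I pairing_smooth[OF that]])
  show "d_aniso p a (\<lambda>q. fst (y q)) (\<lambda>q. fst (z q)) = d_aniso p a (\<lambda>q. snd (y q)) (\<lambda>q. snd (z q))"
    using tangent_diff[OF X sm[OF m(1,3)] sm[OF m(2,4)]] tangent_const[OF X, of p 0] isotropic(1)[OF yz]
    by (simp add: d_aniso_def)
  show "d_aniso p a (\<lambda>q. fst (y q)) (\<lambda>q. snd (z q)) = - d_aniso p a (\<lambda>q. snd (y q)) (\<lambda>q. fst (z q))"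
    using tangent_add[OF X sm[OF m(1,4)] sm[OF m(2,3)]] tangent_const[OF X, of p 0] isotropic(2)[OF yz]
    by (simp add: d_aniso_def)
qed

text \<open>The right-hand side is the product (x1 + i x2)(y1 + i y2)(z1 + i z2) separated into real
  and imaginary parts. The bracket terms have the same sign pattern, so that both assemble into
  \<open>d_omega\<close>.\<close>

lemma canchor_omega_dot:
  assumes "x \<in> csections A E L" "y \<in> csections A E L" "z \<in> csections A E L"
  shows "canchor E p (x p) (\<lambda>q. omega_dot E J t q [y q, z q]) = (
    let x1 = \<lambda>q. fst (x q); x2 = \<lambda>q. snd (x q); y1 = \<lambda>q. fst (y q); y2 = \<lambda>q. snd (y q);
      z1 = \<lambda>q. fst (z q); z2 = \<lambda>q. snd (z q); W = d_anchor p
    in Complex (W x1 y1 z1 - W x1 y2 z2 - W x2 y1 z2 - W x2 y2 z1)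
      (W x1 y1 z2 + W x1 y2 z1 + W x2 y1 z1 - W x2 y2 z2))"
proof -
  have m: "(\<lambda>q. fst (x q)) \<in> \<Gamma>" "(\<lambda>q. snd (x q)) \<in> \<Gamma>"
    "(\<lambda>q. fst (y q)) \<in> \<Gamma>" "(\<lambda>q. snd (y q)) \<in> \<Gamma>" "(\<lambda>q. fst (z q)) \<in> \<Gamma>" "(\<lambda>q. snd (z q)) \<in> \<Gamma>"
    using assms by (auto simp: csections_iff)
  have sm: "smooth_near A p (\<lambda>q. pairing E q (b q) (J' q (c q)))" if "b \<in> \<Gamma>" "c \<in> \<Gamma>" for b c
    by (rule smooth_nearI[OF open_UNIV UNIV_I pairing_smooth[OF that(1) J'_section[OF that(2)]]])
  note X1 = anchor_tangent[OF section_mem[OF m(1)]] and X2 = anchor_tangent[OF section_mem[OF m(2)]]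
  note sms = sm[OF m(3,5)] sm[OF m(3,6)] sm[OF m(4,5)] sm[OF m(4,6)]
  show ?thesis
    unfolding Let_def canchor_def omega_dot_def cpairing_def d_anchor_def
    by (simp add: map_prod_def case_prod_unfold complex_eq_iff
        tangent_diff[OF X1 sms(1) sms(4)] tangent_diff[OF X2 sms(1) sms(4)]
        tangent_add[OF X1 sms(2) sms(3)] tangent_add[OF X2 sms(2) sms(3)])
qed

lemma omega_dot_cbracket:
  assumes "x \<in> csections A E L" "y \<in> csections A E L" "z \<in> csections A E L"
  shows "omega_dot E J t p [cbracket E x y p, z p] = (
    let x1 = \<lambda>q. fst (x q); x2 = \<lambda>q. snd (x q); y1 = \<lambda>q. fst (y q); y2 = \<lambda>q. snd (y q);
      z1 = \<lambda>q. fst (z q); z2 = \<lambda>q. snd (z q); V = d_bracket p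
    in Complex (V x1 y1 z1 - V x1 y2 z2 - V x2 y1 z2 - V x2 y2 z1)
      (V x1 y1 z2 + V x1 y2 z1 + V x2 y1 z1 - V x2 y2 z2))"
proof -
  have m: "(\<lambda>q. fst (x q)) \<in> \<Gamma>" "(\<lambda>q. snd (x q)) \<in> \<Gamma>"
    "(\<lambda>q. fst (y q)) \<in> \<Gamma>" "(\<lambda>q. snd (y q)) \<in> \<Gamma>" "(\<lambda>q. fst (z q)) \<in> \<Gamma>" "(\<lambda>q. snd (z q)) \<in> \<Gamma>"
    using assms by (auto simp: csections_iff)
  note J'z = J'_mem[OF section_mem[OF m(5)], of p] J'_mem[OF section_mem[OF m(6)], of p]
  note b = bracket_mem[OF m(1,3), of p] bracket_mem[OF m(1,4), of p] bracket_mem[OF m(2,3), of p] bracket_mem[OF m(2,4), of p]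
  show ?thesis
    unfolding Let_def omega_dot_def cpairing_def cbracket_def d_bracket_def
    by (simp add: map_prod_def case_prod_unfold complex_eq_iff comp_def
        pairing_simps_left(1)[OF J'z(1) b(2,3)] pairing_simps_left(1)[OF J'z(2) b(2,3)]
        pairing_simps_left(2)[OF J'z(1) b(1,4)] pairing_simps_left(2)[OF J'z(2) b(1,4)])
qed

lemma omega_dot_closed:
  assumes x: "x \<in> csections A E L" and y: "y \<in> csections A E L" and z: "z \<in> csections A E L"
  shows "lie_algebroid_d E (omega_dot E J t) [x, y, z] p = 0"
proof -
  define x1 x2 y1 y2 z1 z2 where "x1 = (\<lambda>q. fst (x q))" "x2 = (\<lambda>q. snd (x q))"
    "y1 = (\<lambda>q. fst (y q))" "y2 = (\<lambda>q. snd (y q))" "z1 = (\<lambda>q. fst (z q))" "z2 = (\<lambda>q. snd (z q))"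
  note defs = this
  have m: "x1 \<in> \<Gamma>" "x2 \<in> \<Gamma>" "y1 \<in> \<Gamma>" "y2 \<in> \<Gamma>" "z1 \<in> \<Gamma>" "z2 \<in> \<Gamma>"
    using x y z by (auto simp: csections_iff defs)
  have J1: "J t q (x1 q) = (-1) *\<^sub>R x2 q" "J t q (y1 q) = (-1) *\<^sub>R y2 q" "J t q (z1 q) = (-1) *\<^sub>R z2 q" for q
    using x y z by (auto simp: csections_iff eigenbundle_iff defs)
  have J2: "J t q (x2 q) = 1 *\<^sub>R x1 q" "J t q (y2 q) = 1 *\<^sub>R y1 q" "J t q (z2 q) = 1 *\<^sub>R z1 q" for q
    using x y z by (auto simp: csections_iff eigenbundle_iff defs)
  let ?T = "d_omega p"
  have d: "lie_algebroid_d E (omega_dot E J t) [x, y, z] p =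
    Complex (?T x1 y1 z1 - ?T x1 y2 z2 - ?T x2 y1 z2 - ?T x2 y2 z1)
      (?T x1 y1 z2 + ?T x1 y2 z1 + ?T x2 y1 z1 - ?T x2 y2 z2)"
  proof -
    have "lie_algebroid_d E (omega_dot E J t) [x, y, z] p =
      canchor E p (x p) (\<lambda>q. omega_dot E J t q [y q, z q])
      - canchor E p (y p) (\<lambda>q. omega_dot E J t q [x q, z q])
      + canchor E p (z p) (\<lambda>q. omega_dot E J t q [x q, y q])
      - omega_dot E J t p [cbracket E x y p, z p]
      + omega_dot E J t p [cbracket E x z p, y p]
      - omega_dot E J t p [cbracket E y z p, x p]"
      by (simp add: lie_algebroid_d_def omit_def numeral_3_eq_3 lessThan_Suc)
    then show ?thesis
      unfolding canchor_omega_dot[OF x y z] canchor_omega_dot[OF y x z] canchor_omega_dot[OF z x y]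
        omega_dot_cbracket[OF x y z] omega_dot_cbracket[OF x z y] omega_dot_cbracket[OF y z x]
        Let_def defs[symmetric]
      by (simp add: complex_eq_iff d_omega_def)
  qed
  \<comment> \<open>The eight instances are ordered with the choice for x varying slowest and that
    for z fastest, the real part coming first.\<close>
  note key = integrability_derivative_real
  note keys = key[OF m(1,3,5,2,4,6) J1(1) J1(2) J1(3), of p] key[OF m(1,3,6,2,4,5) J1(1) J1(2) J2(3), of p]
    key[OF m(1,4,5,2,3,6) J1(1) J2(2) J1(3), of p] key[OF m(1,4,6,2,3,5) J1(1) J2(2) J2(3), of p]
    key[OF m(2,3,5,1,4,6) J2(1) J1(2) J1(3), of p] key[OF m(2,3,6,1,4,5) J2(1) J1(2) J2(3), of p]
    key[OF m(2,4,5,1,3,6) J2(1) J2(2) J1(3), of p] key[OF m(2,4,6,1,3,5) J2(1) J2(2) J2(3), of p]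
  note an = d_aniso_isotropic[OF m(1) y z, of p, folded defs] d_aniso_isotropic[OF m(2) y z, of p, folded defs]
    d_aniso_isotropic[OF m(3) x z, of p, folded defs] d_aniso_isotropic[OF m(4) x z, of p, folded defs]
  note eqs = d_omega_eq[OF m(1,3,5), of p] d_omega_eq[OF m(1,3,6), of p] d_omega_eq[OF m(1,4,5), of p] d_omega_eq[OF m(1,4,6), of p]
    d_omega_eq[OF m(2,3,5), of p] d_omega_eq[OF m(2,3,6), of p] d_omega_eq[OF m(2,4,5), of p] d_omega_eq[OF m(2,4,6), of p]
  \<comment> \<open>Over the complex numbers the derived identity reads 2i times the wanted
    expression. The factor i crosses the parts: the real part follows from the instances with an odd
    number of imaginary parts, and below the imaginary part from those with an even number.\<close>
  have "?T x1 y1 z1 - ?T x1 y2 z2 - ?T x2 y1 z2 - ?T x2 y2 z1 = 0"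
    unfolding eqs using keys(2,3,5,8) an(1,4,5,8) by (simp add: algebra_simps)
  moreover have "?T x1 y1 z2 + ?T x1 y2 z1 + ?T x2 y1 z1 - ?T x2 y2 z2 = 0"
    unfolding eqs using keys(1,4,6,7) an(2,3,6,7) by (simp add: algebra_simps)
  ultimately show ?thesis unfolding d by (simp add: complex_eq_iff)
qed

end

theorem proposition4p2:
  fixes A :: "('m::{t2_space,second_countable_topology}, 'n::real_inner) atlas"
    and E :: "('m, 'v::real_vector, 'k::real_inner) courant"
    and J :: "real \<Rightarrow> 'm \<Rightarrow> 'v \<Rightarrow> 'v"
    and I :: "real set"
  assumes "smooth_manifold A"
    and "courant_algebroid A E"
    and "open I" and "is_interval I"
    and "smooth_endo_family A E I J"
    and "\<And>t. t \<in> I \<Longrightarrow> gen_complex_structure A E (J t)"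
    and "t \<in> I"
  shows "let L = eigenbundle E (J t); \<omega> = omega_dot E J t in
    form_section A E L 2 \<omega> \<and>
    (\<forall>x\<^sub>0\<in>csections A E L. \<forall>x\<^sub>1\<in>csections A E L. \<forall>x\<^sub>2\<in>csections A E L.
       \<forall>p. lie_algebroid_d E \<omega> [x\<^sub>0, x\<^sub>1, x\<^sub>2] p = 0)"
proof -
  interpret gc_family A E J I t
    by unfold_locales (use assms in auto)
  show ?thesis
    unfolding Let_def using form_section_omega_dot omega_dot_closed by blast
qed

end
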